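(* Let $E\to M$ be a smooth real vector bundle of rank $n>1$, and let $\mathcal S(\mathcal P(E,M))$ be the $\mathbb R$-algebra of symbols of differential operators acting on sections of $E$. Put $\mathcal J(E)=\{P\in\mathcal S(\mathcal P(E,M)) : P^2=0\}$. Then $\mathcal J(E)$ is an ideal of the $\mathbb R$-algebra $\mathcal S(\mathcal P(E,M))$, the product of any two elements of $\mathcal J(E)$ is zero, and there is a direct sum decomposition of $\mathbb R$-vector spaces $$\mathcal S(\mathcal P(E,M))=\mathcal J(E)\oplus \mathrm{Pol}(T^*M),$$ where the summand $\mathrm{Pol}(T^*M)$ stands for a linear subspace of $\mathcal S(\mathcal P(E,M))$ which the map $\delta$ sends isomorphically onto $\mathrm{Pol}(T^*M)$.
   Context: $\Gamma(E)$ is the space of smooth sections of $E\to M$ and $\mathrm{End}(\Gamma(E))$ the space of its $\mathbb R$-linear endomorphisms. For $u\in C^\infty(M)$, $\gamma_u:\Gamma(E)\to\Gamma(E)$, $s\mapsto us$. Define $\mathcal P^i(E,M)=\{0\}$ for $i\le -1$, $\mathcal P^0(E,M)=\mathcal A(E,M)=\{\gamma_u:u\in C^\infty(M)\}$, and for $i\ge 0$, $\mathcal P^{i+1}(E,M)=\{T\in \mathrm{End}(\Gamma(E)) : [T,\gamma_u]\in\mathcal P^i(E,M)\ \forall u\in C^\infty(M)\}$. Put $\mathcal P(E,M)=\bigcup_{i\ge0}\mathcal P^i(E,M)$. $\mathcal S(\mathcal P(E,M))=\bigoplus_{i\in\mathbb Z}\mathcal S^i(\mathcal P(E,M))$ with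 $\mathcal S^i(\mathcal P(E,M))=\mathcal P^i(E,M)/\mathcal P^{i-1}(E,M)$. Let $\sigma_i(T)$ be the class of $T\in\mathcal P^i(E,M)$ in $\mathcal S^i(\mathcal P(E,M))$. For $P=\sigma_i(T)$ and $Q=\sigma_j(D)$, the (commutative, associative) product is $P\cdot Q=\sigma_{i+j}(T\circ D)$, extended bilinearly. $\mathrm{Pol}(T^*M)=\bigoplus_{k\ge0}\mathrm{Pol}^k(T^*M)$ is the algebra of smooth functions on $T^*M$ that are polynomial along the fibers, identified with the algebra $\bigoplus_k\Gamma(S^kTM)$ of symmetric contravariant tensor fields. The map $\delta:\mathcal S(\mathcal P(E,M))\to \mathrm{Pol}(T^*M)$ is the homomorphism of $\mathbb R$-algebras which sends the class in $\mathcal S^k(\mathcal P(E,M))$ of $D\in\mathcal P^k(E,M)$ to $0$ if $D$ is a differential operator of order at most $k-1$ in the usual sense, and otherwise to its usual principal symbol, which is of the form $p\cdot\mathrm{id}$ with $p\in\mathrm{Pol}^k(T^*M)$ and is identified with $p$. *)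

theory Defs
  imports "HOL-Analysis.Analysis" "HOL-Algebra.Ideal" "HOL-Algebra.Module"
begin

section \<open>Smooth functions on open subsets of a finite-dimensional space\<close>

text \<open>For an open set and a finite-dimensional domain, this says that all iterated
  directional derivatives of order at most k exist and are continuous.\<close>

primrec Ck_on :: "nat \<Rightarrow> 'a::real_normed_vector set \<Rightarrow> ('a \<Rightarrow> 'b::real_normed_vector) \<Rightarrow> bool" where
  "Ck_on 0 S f \<longleftrightarrow> continuous_on S f"
| "Ck_on (Suc k) S f \<longleftrightarrow> (\<forall>x\<in>S. f differentiable (at x)) \<and>
     (\<forall>v. Ck_on k S (\<lambda>x. frechet_derivative f (at x) v))"

definition smooth_on :: "'a::real_normed_vector set \<Rightarrow> ('a \<Rightarrow> 'b::real_normed_vector) \<Rightarrow> bool" where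
  "smooth_on S f \<longleftrightarrow> (\<forall>k. Ck_on k S f)"

primrec iterated_derivative ::
    "'a::real_normed_vector list \<Rightarrow> ('a \<Rightarrow> 'b::real_normed_vector) \<Rightarrow> 'a \<Rightarrow> 'b" where
  "iterated_derivative [] f = f"
| "iterated_derivative (v # vs) f =
     (\<lambda>y. frechet_derivative (iterated_derivative vs f) (at y) v)"

text \<open>The model space of a manifold is a finite-dimensional inner product space. The class
  \<open>euclidean_space\<close> is not used because it excludes dimension zero. The orthonormal basis
  below only serves to write polynomials and differential operators in coordinates.\<close>

definition is_coord_basis :: "'b::real_inner set \<Rightarrow> bool" where
  "is_coord_basis B \<longleftrightarrow> finite B \<and> pairwise orthogonal B \<and> (\<forall>b\<in>B. norm b = 1) \<and> span B = UNIV"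

definition coord_basis :: "'b::real_inner set" where
  "coord_basis = (SOME B. is_coord_basis B)"

text \<open>Multi-indices are written as tuples of basis vectors, as in
  \<open>a\<^sup>i\<^sup>j\<dots> \<partial>\<^sub>i \<partial>\<^sub>j \<dots>\<close>; the coefficients need not be symmetric in the indices.\<close>

definition multi_indices :: "int \<Rightarrow> 'b::real_inner list set" where
  "multi_indices k = {\<alpha>. set \<alpha> \<subseteq> coord_basis \<and> int (length \<alpha>) = k}"

definition multi_indices_upto :: "int \<Rightarrow> 'b::real_inner list set" where
  "multi_indices_upto k = {\<alpha>. set \<alpha> \<subseteq> coord_basis \<and> int (length \<alpha>) \<le> k}"

definition monomial :: "'b::real_inner list \<Rightarrow> 'b \<Rightarrow> real" where
  "monomial \<alpha> \<xi> = (\<Prod>b\<leftarrow>\<alpha>. \<xi> \<bullet> b)"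


section \<open>Smooth manifolds\<close>

text \<open>A manifold is a Hausdorff second countable type \<open>'m\<close> with a smooth atlas, a chart being a
  pair of its domain and its coordinate map.\<close>

type_synonym ('m, 'b) chart = "'m set \<times> ('m \<Rightarrow> 'b)"

definition chart_inv :: "('m, 'b) chart \<Rightarrow> 'b \<Rightarrow> 'm" where
  "chart_inv c = inv_into (fst c) (snd c)"

definition smooth_manifold ::
    "('m::{t2_space, second_countable_topology}, 'b::real_inner) chart set \<Rightarrow> bool" where
  "smooth_manifold A \<longleftrightarrow>
     (\<exists>B::'b set. is_coord_basis B) \<and>
     (\<Union>c\<in>A. fst c) = UNIV \<and>
     (\<forall>(U, \<phi>)\<in>A. open U \<and> open (\<phi> ` U) \<and> homeomorphism U (\<phi> ` U) \<phi> (inv_into U \<phi>)) \<and>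
     (\<forall>(U, \<phi>)\<in>A. \<forall>(V, \<psi>)\<in>A. smooth_on (\<phi> ` (U \<inter> V)) (\<psi> \<circ> inv_into U \<phi>))"

definition smooth_map_on ::
    "('m, 'b::real_inner) chart set \<Rightarrow> 'm set \<Rightarrow> ('m \<Rightarrow> 'c::real_normed_vector) \<Rightarrow> bool" where
  "smooth_map_on A W f \<longleftrightarrow> (\<forall>(U, \<phi>)\<in>A. smooth_on (\<phi> ` (U \<inter> W)) (f \<circ> inv_into U \<phi>))"

definition smooth_functions :: "('m, 'b::real_inner) chart set \<Rightarrow> ('m \<Rightarrow> real) set" where
  "smooth_functions A = {u. smooth_map_on A UNIV u}"


section \<open>The cotangent bundle and fiberwise polynomial functions\<close>

text \<open>A cotangent vector at \<open>x\<close> is a class \<open>d\<^sub>x f\<close> of smooth functions that have the same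
  differential at \<open>x\<close>; the cotangent space at \<open>x\<close> is thus a quotient of the space of smooth
  functions.\<close>

type_synonym 'm covector = "('m \<Rightarrow> real) set"

definition differential_at ::
    "('m, 'b::real_inner) chart set \<Rightarrow> 'm \<Rightarrow> ('m \<Rightarrow> real) \<Rightarrow> 'm covector" where
  "differential_at A x f = {g \<in> smooth_functions A. \<forall>(U, \<phi>)\<in>A. x \<in> U \<longrightarrow>
     frechet_derivative (g \<circ> inv_into U \<phi>) (at (\<phi> x)) =
     frechet_derivative (f \<circ> inv_into U \<phi>) (at (\<phi> x))}"

definition cotangent_bundle :: "('m, 'b::real_inner) chart set \<Rightarrow> ('m \<times> 'm covector) set" where
  "cotangent_bundle A = {(x, differential_at A x f) | x f. f \<in> smooth_functions A}"

text \<open>The covector at \<open>x\<close> with components \<open>\<xi>\<close> in the chart \<open>c\<close>, the dual of the model space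
  being identified with the model space through the inner product. The maps
  \<open>(y, \<xi>) \<mapsto> (\<phi>\<^sup>-\<^sup>1 y, covector_at A (U, \<phi>) (\<phi>\<^sup>-\<^sup>1 y) \<xi>)\<close> are the inverses of the induced charts of
  the cotangent bundle.\<close>

definition covector_at ::
    "('m, 'b::real_inner) chart set \<Rightarrow> ('m, 'b) chart \<Rightarrow> 'm \<Rightarrow> 'b \<Rightarrow> 'm covector" where
  "covector_at A c x \<xi> = {g \<in> smooth_functions A.
     ((g \<circ> chart_inv c) has_derivative (\<lambda>v. \<xi> \<bullet> v)) (at (snd c x))}"

text \<open>Functions on the cotangent bundle are extended by zero to the ambient product type.\<close>

type_synonym 'm cofunction = "'m \<times> 'm covector \<Rightarrow> real"

definition smooth_cofunctions :: "('m, 'b::real_inner) chart set \<Rightarrow> 'm cofunction set" where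
  "smooth_cofunctions A = {F. (\<forall>q. q \<notin> cotangent_bundle A \<longrightarrow> F q = 0) \<and>
     (\<forall>c\<in>A. smooth_on ((snd c ` fst c) \<times> UNIV)
        (\<lambda>(y, \<xi>). F (chart_inv c y, covector_at A c (chart_inv c y) \<xi>)))}"

definition Pol_degree :: "('m, 'b::real_inner) chart set \<Rightarrow> nat \<Rightarrow> 'm cofunction set" where
  "Pol_degree A k = {F \<in> smooth_cofunctions A. \<forall>c\<in>A. \<forall>x\<in>fst c. \<exists>a :: 'b list \<Rightarrow> real. \<forall>\<xi>.
     F (x, covector_at A c x \<xi>) = (\<Sum>\<alpha>\<in>multi_indices (int k). a \<alpha> * monomial \<alpha> \<xi>)}"

definition Pol :: "('m, 'b::real_inner) chart set \<Rightarrow> 'm cofunction set" where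
  "Pol A = {\<lambda>q. \<Sum>k\<le>N. F k q | N F. \<forall>k::nat. F k \<in> Pol_degree A k}"


section \<open>Smooth vector bundles\<close>

text \<open>The fibers \<open>E x\<close> are subspaces of one real vector space \<open>'v\<close>. This is no restriction (embed
  all fibers into their direct product), and no topology on \<open>'v\<close> is involved: the smooth
  structure comes from the bundle atlas only. A member \<open>(V, \<Psi>)\<close> of the bundle atlas is a
  local trivialization \<open>V \<times> \<real>\<^sup>n \<rightarrow> E\<close>, \<open>(x, w) \<mapsto> \<Psi> x w\<close> over the open set \<open>V\<close>.\<close>

type_synonym ('m, 'n, 'v) triv = "'m set \<times> ('m \<Rightarrow> (real, 'n) vec \<Rightarrow> 'v)"

definition smooth_vector_bundle ::
    "('m::topological_space, 'b::real_inner) chart set \<Rightarrow> ('m \<Rightarrow> 'v::real_vector set) \<Rightarrow>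
     ('m, 'n::finite, 'v) triv set \<Rightarrow> bool" where
  "smooth_vector_bundle A E L \<longleftrightarrow>
     (\<Union>t\<in>L. fst t) = UNIV \<and>
     (\<forall>(V, \<Psi>)\<in>L. open V \<and> (\<forall>x\<in>V. linear (\<Psi> x) \<and> bij_betw (\<Psi> x) UNIV (E x))) \<and>
     (\<forall>(V, \<Psi>)\<in>L. \<forall>(V', \<Psi>')\<in>L.
        smooth_map_on A (V \<inter> V') (\<lambda>x. matrix (inv_into UNIV (\<Psi>' x) \<circ> \<Psi> x)))"

definition local_section :: "('m, 'n::finite, 'v) triv \<Rightarrow> ('m \<Rightarrow> 'v) \<Rightarrow> 'm \<Rightarrow> (real, 'n) vec" where
  "local_section t s = (\<lambda>x. inv_into UNIV (snd t x) (s x))"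

definition sections ::
    "('m, 'b::real_inner) chart set \<Rightarrow> ('m \<Rightarrow> 'v::real_vector set) \<Rightarrow>
     ('m, 'n::finite, 'v) triv set \<Rightarrow> ('m \<Rightarrow> 'v) set" where
  "sections A E L =
     {s. (\<forall>x. s x \<in> E x) \<and> (\<forall>t\<in>L. smooth_map_on A (fst t) (local_section t s))}"


section \<open>The filtered algebra of operators\<close>

text \<open>Operators on sections are extended by zero to all functions \<open>'m \<Rightarrow> 'v\<close>.\<close>

type_synonym ('m, 'v) operator = "('m \<Rightarrow> 'v) \<Rightarrow> ('m \<Rightarrow> 'v)"

definition op_zero :: "('m, 'v::real_vector) operator" where
  "op_zero = (\<lambda>s x. 0)"

definition op_add :: "('m, 'v::real_vector) operator \<Rightarrow> ('m, 'v) operator \<Rightarrow> ('m, 'v) operator" where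
  "op_add T D = (\<lambda>s x. T s x + D s x)"

definition op_diff :: "('m, 'v::real_vector) operator \<Rightarrow> ('m, 'v) operator \<Rightarrow> ('m, 'v) operator" where
  "op_diff T D = (\<lambda>s x. T s x - D s x)"

definition op_scale :: "real \<Rightarrow> ('m, 'v::real_vector) operator \<Rightarrow> ('m, 'v) operator" where
  "op_scale r T = (\<lambda>s x. r *\<^sub>R T s x)"

definition op_sum :: "'i set \<Rightarrow> ('i \<Rightarrow> ('m, 'v::real_vector) operator) \<Rightarrow> ('m, 'v) operator" where
  "op_sum I T = (\<lambda>s x. \<Sum>i\<in>I. T i s x)"

definition commutator ::
    "('m, 'v::real_vector) operator \<Rightarrow> ('m, 'v) operator \<Rightarrow> ('m, 'v) operator" where
  "commutator T D = op_diff (T \<circ> D) (D \<circ> T)"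

definition End_sections ::
    "('m, 'b::real_inner) chart set \<Rightarrow> ('m \<Rightarrow> 'v::real_vector set) \<Rightarrow>
     ('m, 'n::finite, 'v) triv set \<Rightarrow> ('m, 'v) operator set" where
  "End_sections A E L = {T.
     (\<forall>s\<in>sections A E L. T s \<in> sections A E L) \<and>
     (\<forall>s. s \<notin> sections A E L \<longrightarrow> T s = (\<lambda>x. 0)) \<and>
     (\<forall>s\<in>sections A E L. \<forall>t\<in>sections A E L. T (\<lambda>x. s x + t x) = (\<lambda>x. T s x + T t x)) \<and>
     (\<forall>r::real. \<forall>s\<in>sections A E L. T (\<lambda>x. r *\<^sub>R s x) = (\<lambda>x. r *\<^sub>R T s x))}"

definition mult_op ::
    "('m, 'b::real_inner) chart set \<Rightarrow> ('m \<Rightarrow> 'v::real_vector set) \<Rightarrow>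
     ('m, 'n::finite, 'v) triv set \<Rightarrow> ('m \<Rightarrow> real) \<Rightarrow> ('m, 'v) operator" where
  "mult_op A E L u = (\<lambda>s. if s \<in> sections A E L then (\<lambda>x. u x *\<^sub>R s x) else (\<lambda>x. 0))"

primrec P_nat ::
    "('m, 'b::real_inner) chart set \<Rightarrow> ('m \<Rightarrow> 'v::real_vector set) \<Rightarrow>
     ('m, 'n::finite, 'v) triv set \<Rightarrow> nat \<Rightarrow> ('m, 'v) operator set" where
  "P_nat A E L 0 = {mult_op A E L u | u. u \<in> smooth_functions A}"
| "P_nat A E L (Suc i) = {T \<in> End_sections A E L.
     \<forall>u\<in>smooth_functions A. commutator T (mult_op A E L u) \<in> P_nat A E L i}"

definition P_filtration ::
    "('m, 'b::real_inner) chart set \<Rightarrow> ('m \<Rightarrow> 'v::real_vector set) \<Rightarrow>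
     ('m, 'n::finite, 'v) triv set \<Rightarrow> int \<Rightarrow> ('m, 'v) operator set" where
  "P_filtration A E L i = (if i \<le> -1 then {op_zero} else P_nat A E L (nat i))"


section \<open>The algebra of symbols\<close>

definition symbol_class ::
    "('m, 'b::real_inner) chart set \<Rightarrow> ('m \<Rightarrow> 'v::real_vector set) \<Rightarrow>
     ('m, 'n::finite, 'v) triv set \<Rightarrow> int \<Rightarrow> ('m, 'v) operator \<Rightarrow> ('m, 'v) operator set" where
  "symbol_class A E L i T =
     {T' \<in> P_filtration A E L i. op_diff T' T \<in> P_filtration A E L (i - 1)}"

definition real_ring :: "real ring" where
  "real_ring = \<lparr>carrier = UNIV, monoid.mult = (*), one = 1, ring.zero = 0, add = (+)\<rparr>"

text \<open>An element of the direct sum is a family of cosets \<open>c i \<in> P\<^sup>i / P\<^sup>i\<^sup>-\<^sup>1\<close>, almost all of which are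
  zero, that is, equal to the coset \<open>P\<^sup>i\<^sup>-\<^sup>1\<close>. As in \<open>rcoset_mult\<close>, an operation on cosets is
  the union, over all choices of representatives, of the coset of the result. In the component
  of degree \<open>k\<close> of a product, only the degrees \<open>0 \<le> i \<le> k\<close> are summed, because \<open>P\<^sup>i\<close> is zero for
  negative \<open>i\<close>.\<close>

definition symbol_algebra ::
    "('m, 'b::real_inner) chart set \<Rightarrow> ('m \<Rightarrow> 'v::real_vector set) \<Rightarrow>
     ('m, 'n::finite, 'v) triv set \<Rightarrow> (real, int \<Rightarrow> ('m, 'v) operator set) module" where
  "symbol_algebra A E L = \<lparr>
     carrier = {c. (\<forall>i. c i \<in> symbol_class A E L i ` P_filtration A E L i) \<and>
                   finite {i. c i \<noteq> P_filtration A E L (i - 1)}},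
     monoid.mult = (\<lambda>c d k. \<Union>T \<in> {T. \<forall>i. T i \<in> c i}. \<Union>D \<in> {D. \<forall>j. D j \<in> d j}.
        symbol_class A E L k (op_sum {0..k} (\<lambda>i. T i \<circ> D (k - i)))),
     one = (\<lambda>k. symbol_class A E L k (if k = 0 then mult_op A E L (\<lambda>x. 1) else op_zero)),
     ring.zero = (\<lambda>k. symbol_class A E L k op_zero),
     add = (\<lambda>c d k. \<Union>T\<in>c k. \<Union>D\<in>d k. symbol_class A E L k (op_add T D)),
     smult = (\<lambda>r c k. \<Union>T\<in>c k. symbol_class A E L k (op_scale r T))\<rparr>"

definition square_zero_symbols ::
    "('m, 'b::real_inner) chart set \<Rightarrow> ('m \<Rightarrow> 'v::real_vector set) \<Rightarrow>
     ('m, 'n::finite, 'v) triv set \<Rightarrow> (int \<Rightarrow> ('m, 'v) operator set) set" where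
  "square_zero_symbols A E L = {P \<in> carrier (symbol_algebra A E L).
     P \<otimes>\<^bsub>symbol_algebra A E L\<^esub> P = \<zero>\<^bsub>symbol_algebra A E L\<^esub>}"


section \<open>Differential operators in the usual sense and the map delta\<close>

text \<open>\<open>T\<close> has order at most \<open>r\<close> over \<open>U \<inter> V\<close>, with coefficient matrices \<open>a \<alpha>\<close> in the chart
  \<open>(U, \<phi>)\<close> and the trivialization \<open>(V, \<Psi>)\<close>.\<close>

definition local_expression ::
    "('m, 'b::real_inner) chart set \<Rightarrow> ('m \<Rightarrow> 'v::real_vector set) \<Rightarrow>
     ('m, 'n::finite, 'v) triv set \<Rightarrow> int \<Rightarrow> ('m, 'v) operator \<Rightarrow>
     ('m, 'b) chart \<Rightarrow> ('m, 'n, 'v) triv \<Rightarrow> ('b list \<Rightarrow> 'm \<Rightarrow> ((real, 'n) vec, 'n) vec) \<Rightarrow> bool" where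
  "local_expression A E L r T c t a \<longleftrightarrow>
     (\<forall>\<alpha>\<in>multi_indices_upto r. smooth_map_on A (fst c \<inter> fst t) (a \<alpha>)) \<and>
     (\<forall>s\<in>sections A E L. \<forall>x\<in>fst c \<inter> fst t.
        local_section t (T s) x =
        (\<Sum>\<alpha>\<in>multi_indices_upto r.
           a \<alpha> x *v iterated_derivative \<alpha> (local_section t s \<circ> chart_inv c) (snd c x)))"

definition differential_operators ::
    "('m, 'b::real_inner) chart set \<Rightarrow> ('m \<Rightarrow> 'v::real_vector set) \<Rightarrow>
     ('m, 'n::finite, 'v) triv set \<Rightarrow> int \<Rightarrow> ('m, 'v) operator set" where
  "differential_operators A E L r = {T \<in> End_sections A E L.
     \<forall>c\<in>A. \<forall>t\<in>L. \<exists>a. local_expression A E L r T c t a}"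

text \<open>The principal symbol at \<open>(x, \<omega>)\<close> as an endomorphism of the fiber \<open>E x\<close>: the top-order part
  of any local expression, with derivatives replaced by the components of \<open>\<omega>\<close>. The value does
  not depend on the local expression.\<close>

definition principal_symbol ::
    "('m, 'b::real_inner) chart set \<Rightarrow> ('m \<Rightarrow> 'v::real_vector set) \<Rightarrow>
     ('m, 'n::finite, 'v) triv set \<Rightarrow> int \<Rightarrow> ('m, 'v) operator \<Rightarrow> 'm \<times> 'm covector \<Rightarrow> 'v \<Rightarrow> 'v" where
  "principal_symbol A E L k T q e = (THE e'. \<exists>c\<in>A. \<exists>t\<in>L. \<exists>a \<xi>.
     fst q \<in> fst c \<inter> fst t \<and> local_expression A E L k T c t a \<and>
     snd q = covector_at A c (fst q) \<xi> \<and>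
     e' = snd t (fst q) (\<Sum>\<alpha>\<in>multi_indices k.
            monomial \<alpha> \<xi> *\<^sub>R (a \<alpha> (fst q) *v inv_into UNIV (snd t (fst q)) e)))"

definition scalar_symbol ::
    "('m, 'b::real_inner) chart set \<Rightarrow> ('m \<Rightarrow> 'v::real_vector set) \<Rightarrow>
     ('m, 'n::finite, 'v) triv set \<Rightarrow> int \<Rightarrow> ('m, 'v) operator \<Rightarrow> 'm cofunction" where
  "scalar_symbol A E L k T = (THE p. (\<forall>q. q \<notin> cotangent_bundle A \<longrightarrow> p q = 0) \<and>
     (\<forall>q\<in>cotangent_bundle A. \<forall>e\<in>E (fst q). principal_symbol A E L k T q e = p q *\<^sub>R e))"

definition delta_degree ::
    "('m, 'b::real_inner) chart set \<Rightarrow> ('m \<Rightarrow> 'v::real_vector set) \<Rightarrow>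
     ('m, 'n::finite, 'v) triv set \<Rightarrow> int \<Rightarrow> ('m, 'v) operator set \<Rightarrow> 'm cofunction" where
  "delta_degree A E L k C = (THE p. \<forall>D\<in>C. p =
     (if D \<in> differential_operators A E L (k - 1) then (\<lambda>q. 0) else scalar_symbol A E L k D))"

definition delta ::
    "('m, 'b::real_inner) chart set \<Rightarrow> ('m \<Rightarrow> 'v::real_vector set) \<Rightarrow>
     ('m, 'n::finite, 'v) triv set \<Rightarrow> (int \<Rightarrow> ('m, 'v) operator set) \<Rightarrow> 'm cofunction" where
  "delta A E L c =
     (\<lambda>q. \<Sum>k \<in> {k. c k \<noteq> P_filtration A E L (k - 1)}. delta_degree A E L k (c k) q)"

end

(*
  An operator T in P^k is a differential operator of order at most k whose principal symbol is
  scalar; algebraically the symbol at (x, d_x u) is 1/k! times the k-fold commutator of T with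
  gamma_u, evaluated at x. By polarization it vanishes identically iff T has order less than k, so
  the kernel of delta in degree k is D^(k-1) / P^(k-1), where D^j denotes all differential
  operators of order at most j. Since D^(k-1) D^(l-1) lies in D^(k+l-2), hence in P^(k+l-1), this
  kernel has zero multiplication; conversely the symbol is multiplicative with real values, so
  P^2 = 0 forces delta P = 0. A quantization Pol -> P, linear and right inverse to the symbol and
  built with a partition of unity, provides the complement. That the algebraic symbol is the usual
  one rests on a local coordinate expression of T, obtained by induction on k from Hadamard's lemma.
*)
theory Submission
  imports Defs
begin

section \<open>Calculus of smooth functions\<close>

text \<open>The kernel of the symbol is itself an iterated-commutator class: \<open>G k\<close>
  obeys the recursion of \<open>P k\<close> but starts from zero instead of from the
  multiplications. The two interlace, \<open>G k\<close> inside \<open>P k\<close> inside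
  \<open>G (Suc k)\<close>. An operator of order below k with arbitrary matrix coefficients lies in
  \<open>P k\<close> because its degree-k symbol, being zero, is scalar; these operators are the
  source of the square-zero symbols. The main obstacle is that \<open>principal_symbol\<close>,
  \<open>scalar_symbol\<close> and \<open>delta_degree\<close> are definite descriptions. They have
  a value only once operators of \<open>P k\<close> are known to possess local expressions and every
  local expression is known to compute the same iterated commutator. Locality is part of what must
  be shown; it comes from commutators with cutoff functions. A linear complement needs a
  quantization that is linear in the polynomial. Since multi-indices are ordered words, the
  coefficients of a polynomial are not unique, and a fixed interpolation formula selects them
  linearly and smoothly. The base may be non-compact, so quantization is an infinite sum; it is made
  locally finite, and membership in \<open>P k\<close> is then checked locally.\<close>

lemma Ck_on_eqI:
  assumes "Ck_on k S f" "open S" "\<And>x. x \<in> S \<Longrightarrow> f x = g x"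
  shows "Ck_on k S g"
  using assms(1,3)
proof (induction k arbitrary: f g)
  case 0
  then show ?case by (simp cong: continuous_on_cong)
next
  case (Suc k)
  have "g differentiable (at x)" if "x \<in> S" for x
    using has_derivative_transform_within_open[OF _ \<open>open S\<close> that Suc.prems(2)] Suc.prems(1) that
    by (fastforce simp: differentiable_def)
  moreover have "frechet_derivative f (at x) v = frechet_derivative g (at x) v" if "x \<in> S" for x v
    using frechet_derivative_transform_within_open[OF _ \<open>open S\<close> that Suc.prems(2)] Suc.prems(1) that
    by simp
  then have "Ck_on k S (\<lambda>x. frechet_derivative g (at x) v)" for v
    using Suc.IH[of "\<lambda>x. frechet_derivative f (at x) v"] Suc.prems(1) by simp
  ultimately show ?case by simp
qed

lemma Ck_on_subset: "Ck_on k S f \<Longrightarrow> T \<subseteq> S \<Longrightarrow> Ck_on k T f"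
  by (induction k arbitrary: f) (auto intro: continuous_on_subset)

lemma Ck_on_SucD: "Ck_on (Suc k) S f \<Longrightarrow> Ck_on k S f"
proof (induction k arbitrary: f)
  case 0
  then show ?case
    by (auto intro!: continuous_at_imp_continuous_on differentiable_imp_continuous_within)
next
  case (Suc k)
  then show ?case by (metis Ck_on.simps(2))
qed

lemma Ck_on_mono: "j \<le> k \<Longrightarrow> Ck_on k S f \<Longrightarrow> Ck_on j S f"
  by (induction k) (auto dest: Ck_on_SucD simp: le_Suc_eq simp del: Ck_on.simps)

text \<open>\<open>Ck_on\<close> uses derivatives at a point in the full space, never within the
  set, so each clause can be checked on a neighbourhood of the point.\<close>

lemma Ck_on_local:
  assumes "\<And>x. x \<in> S \<Longrightarrow> \<exists>T. open T \<and> x \<in> T \<and> Ck_on k T f"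
  shows "Ck_on k S f"
  using assms
proof (induction k arbitrary: f)
  case 0
  show ?case
    unfolding Ck_on.simps
  proof (rule continuous_at_imp_continuous_on, rule ballI)
    fix x assume "x \<in> S"
    then obtain T where "open T" "x \<in> T" "continuous_on T f" using 0[of x] by auto
    then show "isCont f x" by (simp add: continuous_on_eq_continuous_at)
  qed
next
  case (Suc k)
  show ?case
    unfolding Ck_on.simps
  proof (intro conjI ballI allI)
    fix x assume "x \<in> S"
    then show "f differentiable (at x)" using Suc.prems[of x] by auto
  next
    fix v show "Ck_on k S (\<lambda>x. frechet_derivative f (at x) v)"
      by (rule Suc.IH) (use Suc.prems in fastforce)
  qed
qed

lemma Ck_on_const: "Ck_on k S (\<lambda>x. c)"
  by (induction k arbitrary: c) auto

text \<open>\<open>frechet_derivative\<close> is a choice operator. This rule trades it for an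
  explicit derivative formula, and the closure properties below are all proved by supplying
  one.\<close>

lemma Ck_on_SucI:
  assumes "open S" "\<And>x. x \<in> S \<Longrightarrow> (f has_derivative f' x) (at x)"
    "\<And>v. Ck_on k S (\<lambda>x. f' x v)"
  shows "Ck_on (Suc k) S f"
  unfolding Ck_on.simps
proof (intro conjI ballI allI)
  show "f differentiable at x" if "x \<in> S" for x
    using assms(2)[OF that] by (auto simp: differentiable_def)
  show "Ck_on k S (\<lambda>x. frechet_derivative f (at x) v)" for v
    by (rule Ck_on_eqI[OF assms(3)[of v] assms(1)]) (use frechet_derivative_at[OF assms(2)] in metis)
qed

lemma Ck_on_has_derivative:
  "Ck_on (Suc k) S f \<Longrightarrow> x \<in> S \<Longrightarrow> (f has_derivative frechet_derivative f (at x)) (at x)"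
  by (simp flip: frechet_derivative_works)

lemma Ck_on_derivative: "Ck_on (Suc k) S f \<Longrightarrow> Ck_on k S (\<lambda>x. frechet_derivative f (at x) v)"
  by simp

lemma Ck_on_linear_outer:
  assumes "open S" "bounded_linear h" "Ck_on k S f" shows "Ck_on k S (\<lambda>x. h (f x))"
  using assms(3)
proof (induction k arbitrary: f)
  case 0
  then show ?case by (simp add: bounded_linear.continuous_on[OF assms(2)])
next
  case (Suc k)
  show ?case
    by (rule Ck_on_SucI[OF assms(1)
        bounded_linear.has_derivative[OF assms(2) Ck_on_has_derivative[OF Suc.prems]]])
      (use Suc.IH[OF Ck_on_derivative[OF Suc.prems]] in auto)
qed

lemma Ck_on_linear:
  assumes "open S" "bounded_linear h" shows "Ck_on k S h"
proof (cases k)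
  case 0
  then show ?thesis using bounded_linear.continuous_on[OF assms(2) continuous_on_id] by simp
next
  case (Suc j)
  then show ?thesis
    by (auto intro!: Ck_on_SucI[OF assms(1)] bounded_linear_imp_has_derivative[OF assms(2)] Ck_on_const
        simp del: Ck_on.simps)
qed

lemma Ck_on_add:
  assumes "open S" "Ck_on k S f" "Ck_on k S g" shows "Ck_on k S (\<lambda>x. f x + g x)"
  using assms(2,3)
proof (induction k arbitrary: f g)
  case 0
  then show ?case by (simp add: continuous_on_add)
next
  case (Suc k)
  show ?case
    by (rule Ck_on_SucI[OF assms(1)
        has_derivative_add[OF Ck_on_has_derivative[OF Suc.prems(1)] Ck_on_has_derivative[OF Suc.prems(2)]]])
      (use Suc.IH[OF Ck_on_derivative[OF Suc.prems(1)] Ck_on_derivative[OF Suc.prems(2)]] in auto)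
qed

text \<open>By the Leibniz rule the derivative is a sum of two terms of the same bilinear shape, so
  the induction generalizes over both factors.\<close>

lemma Ck_on_bilinear:
  assumes "open S" "bounded_bilinear p" "Ck_on k S f" "Ck_on k S g"
  shows "Ck_on k S (\<lambda>x. p (f x) (g x))"
  using assms(3,4)
proof (induction k arbitrary: f g)
  case 0
  then show ?case by (simp add: bounded_bilinear.continuous_on[OF assms(2)])
next
  case (Suc k)
  show ?case
  proof (rule Ck_on_SucI[OF assms(1) bounded_bilinear.FDERIV[OF assms(2)
          Ck_on_has_derivative[OF Suc.prems(1)] Ck_on_has_derivative[OF Suc.prems(2)]]])
    fix v
    show "Ck_on k S (\<lambda>x. p (f x) (frechet_derivative g (at x) v) + p (frechet_derivative f (at x) v) (g x))"
      by (intro Ck_on_add assms(1) Suc.IH Ck_on_SucD[OF Suc.prems(1)] Ck_on_SucD[OF Suc.prems(2)]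
          Ck_on_derivative[OF Suc.prems(1)] Ck_on_derivative[OF Suc.prems(2)])
  qed
qed

lemma Ck_on_sum:
  assumes "open S" "\<And>i. i \<in> I \<Longrightarrow> Ck_on k S (f i)" shows "Ck_on k S (\<lambda>x. \<Sum>i\<in>I. f i x)"
  using assms(2) by (induction I rule: infinite_finite_induct) (auto intro: Ck_on_const Ck_on_add assms(1))

text \<open>The difference of the two sides is orthogonal to the basis, hence to its span, hence to
  itself.\<close>

lemma coord_basis_expand:
  assumes "is_coord_basis B" shows "(\<Sum>b\<in>B. (x \<bullet> b) *\<^sub>R b) = x"
proof -
  have B: "finite B" "pairwise orthogonal B" "\<And>b. b \<in> B \<Longrightarrow> norm b = 1" "span B = UNIV"
    using assms by (auto simp: is_coord_basis_def)
  define y where "y = x - (\<Sum>b\<in>B. (x \<bullet> b) *\<^sub>R b)"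
  have "y \<bullet> c = 0" if "c \<in> B" for c
  proof -
    have "(\<Sum>b\<in>B. (x \<bullet> b) *\<^sub>R b) \<bullet> c = (\<Sum>b\<in>B. if b = c then x \<bullet> c else 0)"
      unfolding inner_sum_left
      by (rule sum.cong) (use B(2) that B(3)[OF that] in \<open>auto simp: pairwise_def orthogonal_def norm_eq_1\<close>)
    then show ?thesis using B(1) that by (simp add: y_def inner_diff_left)
  qed
  then have "orthogonal y z" if "z \<in> B" for z using that by (simp add: orthogonal_def)
  then have "orthogonal y y" using orthogonal_to_span[of y B y] B(4) by auto
  then have "y = 0" by (simp add: orthogonal_def)
  then show ?thesis by (simp add: y_def)
qed

lemma linear_coord_expand:
  assumes "is_coord_basis B" "linear h" shows "h x = (\<Sum>b\<in>B. (x \<bullet> b) *\<^sub>R h b)"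
proof -
  have "h x = h (\<Sum>b\<in>B. (x \<bullet> b) *\<^sub>R b)" by (simp only: coord_basis_expand[OF assms(1)])
  also have "\<dots> = (\<Sum>b\<in>B. (x \<bullet> b) *\<^sub>R h b)" by (simp add: linear_sum[OF assms(2)] linear_scale[OF assms(2)])
  finally show ?thesis .
qed

text \<open>In the chain rule the direction in which \<open>f\<close> is differentiated varies with
  the point, while \<open>Ck_on\<close> only knows fixed directions. Expanding the direction in a
  finite orthonormal basis reduces to fixed ones with scalar coefficients of class C^k.\<close>

lemma Ck_on_compose:
  fixes f :: "'a::real_inner \<Rightarrow> 'c::real_normed_vector"
  assumes "is_coord_basis (B::'a set)" "open S" "open T" "Ck_on k T f" "Ck_on k S g" "g ` S \<subseteq> T"
  shows "Ck_on k S (\<lambda>x. f (g x))"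
  using assms(4,5)
proof (induction k arbitrary: f)
  case 0
  then show ?case using assms(6) by (auto intro: continuous_on_compose2)
next
  case (Suc k)
  have gT: "g x \<in> T" if "x \<in> S" for x using that assms(6) by auto
  show ?case
  proof (rule Ck_on_SucI[OF assms(2)])
    fix x assume x: "x \<in> S"
    have fd: "(f has_derivative frechet_derivative f (at (g x))) (at (g x))"
      by (rule Ck_on_has_derivative[OF Suc.prems(1) gT[OF x]])
    show "((\<lambda>x. f (g x)) has_derivative
        (\<lambda>v. \<Sum>b\<in>B. (frechet_derivative g (at x) v \<bullet> b) *\<^sub>R frechet_derivative f (at (g x)) b)) (at x)"
      unfolding linear_coord_expand[OF assms(1) has_derivative_linear[OF fd], symmetric]
      by (rule has_derivative_compose[OF Ck_on_has_derivative[OF Suc.prems(2) x] fd])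
  next
    fix v
    have "Ck_on k S (\<lambda>x. frechet_derivative f (at (g x)) b)" for b
      by (rule Suc.IH[OF Ck_on_derivative[OF Suc.prems(1)] Ck_on_SucD[OF Suc.prems(2)]])
    then show "Ck_on k S (\<lambda>x. \<Sum>b\<in>B. (frechet_derivative g (at x) v \<bullet> b) *\<^sub>R frechet_derivative f (at (g x)) b)"
      by (intro Ck_on_sum Ck_on_bilinear[OF _ bounded_bilinear_scaleR] assms(2)
          Ck_on_linear_outer[OF _ bounded_linear_inner_left] Ck_on_derivative[OF Suc.prems(2)])
  qed
qed

lemma smooth_on_eqI: "smooth_on S f \<Longrightarrow> open S \<Longrightarrow> (\<And>x. x \<in> S \<Longrightarrow> f x = g x) \<Longrightarrow> smooth_on S g"
  by (meson smooth_on_def Ck_on_eqI)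

lemma smooth_on_subset: "smooth_on S f \<Longrightarrow> T \<subseteq> S \<Longrightarrow> smooth_on T f"
  by (meson smooth_on_def Ck_on_subset)

lemma smooth_on_local:
  "(\<And>x. x \<in> S \<Longrightarrow> \<exists>T. open T \<and> x \<in> T \<and> smooth_on T f) \<Longrightarrow> smooth_on S f"
  unfolding smooth_on_def by (intro allI Ck_on_local) metis

lemma smooth_on_const: "smooth_on S (\<lambda>x. c)"
  by (simp add: smooth_on_def Ck_on_const)

lemma smooth_on_linear_outer:
  "open S \<Longrightarrow> bounded_linear h \<Longrightarrow> smooth_on S f \<Longrightarrow> smooth_on S (\<lambda>x. h (f x))"
  by (simp add: smooth_on_def Ck_on_linear_outer)

lemma smooth_on_linear: "open S \<Longrightarrow> bounded_linear h \<Longrightarrow> smooth_on S h"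
  by (simp add: smooth_on_def Ck_on_linear)

lemma smooth_on_ident: "open S \<Longrightarrow> smooth_on S (\<lambda>x. x)"
  by (simp add: smooth_on_linear bounded_linear_ident)

lemma smooth_on_add: "open S \<Longrightarrow> smooth_on S f \<Longrightarrow> smooth_on S g \<Longrightarrow> smooth_on S (\<lambda>x. f x + g x)"
  by (simp add: smooth_on_def Ck_on_add)

lemma smooth_on_bilinear:
  "open S \<Longrightarrow> bounded_bilinear p \<Longrightarrow> smooth_on S f \<Longrightarrow> smooth_on S g \<Longrightarrow> smooth_on S (\<lambda>x. p (f x) (g x))"
  by (simp add: smooth_on_def Ck_on_bilinear)

lemmas smooth_on_scaleR = smooth_on_bilinear[OF _ bounded_bilinear_scaleR]
  and smooth_on_mult = smooth_on_bilinear[OF _ bounded_bilinear_mult]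

lemma smooth_on_minus: "open S \<Longrightarrow> smooth_on S f \<Longrightarrow> smooth_on S (\<lambda>x. - f x)"
  by (rule smooth_on_linear_outer[OF _ bounded_linear_minus[OF bounded_linear_ident]])

lemma smooth_on_diff: "open S \<Longrightarrow> smooth_on S f \<Longrightarrow> smooth_on S g \<Longrightarrow> smooth_on S (\<lambda>x. f x - g x)"
  using smooth_on_add[OF _ _ smooth_on_minus, of S f g] by simp

lemma smooth_on_sum:
  "open S \<Longrightarrow> (\<And>i. i \<in> I \<Longrightarrow> smooth_on S (f i)) \<Longrightarrow> smooth_on S (\<lambda>x. \<Sum>i\<in>I. f i x)"
  by (simp add: smooth_on_def Ck_on_sum)

lemma smooth_on_compose:
  fixes f :: "'a::real_inner \<Rightarrow> 'c::real_normed_vector"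
  assumes "is_coord_basis (B::'a set)" "open S" "open T" "smooth_on T f" "smooth_on S g" "g ` S \<subseteq> T"
  shows "smooth_on S (\<lambda>x. f (g x))"
  using assms(4,5) Ck_on_compose[OF assms(1-3) _ _ assms(6)] unfolding smooth_on_def by blast

lemma smooth_on_has_derivative:
  "smooth_on S f \<Longrightarrow> x \<in> S \<Longrightarrow> (f has_derivative frechet_derivative f (at x)) (at x)"
  unfolding smooth_on_def by (rule Ck_on_has_derivative) (erule spec)

lemma smooth_on_derivative: "smooth_on S f \<Longrightarrow> smooth_on S (\<lambda>x. frechet_derivative f (at x) v)"
  unfolding smooth_on_def by (intro allI Ck_on_derivative) simp

lemma smooth_on_continuous: "smooth_on S f \<Longrightarrow> continuous_on S f"
  unfolding smooth_on_def using Ck_on.simps(1) by blast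

lemma smooth_on_iterated: "smooth_on S f \<Longrightarrow> smooth_on S (iterated_derivative \<alpha> f)"
  by (induction \<alpha>) (auto intro: smooth_on_derivative)

lemma iterated_derivative_cong:
  assumes "smooth_on S f" "open S" "\<And>x. x \<in> S \<Longrightarrow> f x = g x" "x \<in> S"
  shows "iterated_derivative \<alpha> f x = iterated_derivative \<alpha> g x"
  using assms(4)
proof (induction \<alpha> arbitrary: x)
  case Nil
  have "f x = g x" using assms(3) Nil by blast
  then show ?case by simp
next
  case (Cons v \<alpha>)
  have "iterated_derivative \<alpha> f differentiable at x"
    unfolding differentiable_def
    by (rule exI, rule smooth_on_has_derivative[OF smooth_on_iterated[OF assms(1)] Cons.prems])
  then have "frechet_derivative (iterated_derivative \<alpha> f) (at x) = frechet_derivative (iterated_derivative \<alpha> g) (at x)"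
    by (rule frechet_derivative_transform_within_open[OF _ assms(2) Cons.prems Cons.IH])
  then show ?case by simp
qed

lemma iterated_derivative_append:
  "iterated_derivative (\<alpha> @ \<beta>) f = iterated_derivative \<alpha> (iterated_derivative \<beta> f)"
  by (induction \<alpha>) auto

lemma frechet_derivative_eq: "(f has_derivative f') (at x) \<Longrightarrow> frechet_derivative f (at x) v = f' v"
  by (metis frechet_derivative_at)

section \<open>Bump functions\<close>

text \<open>The functions exp(-1/t) / t^n, extended by zero. Derivatives of members are linear
  combinations of members, so one induction over the whole family proves smoothness.\<close>

definition exp_tail :: "nat \<Rightarrow> real \<Rightarrow> real" where
  "exp_tail n t = (if t > 0 then exp (- inverse t) * inverse t ^ n else 0)"

text \<open>From the right, substituting 1/t turns the claim into the decay of a power divided by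
  the exponential at infinity.\<close>

lemma exp_tail_tendsto_0: "(exp_tail n \<longlongrightarrow> 0) (at 0)"
proof (rule filterlim_split_at)
  show "(exp_tail n \<longlongrightarrow> 0) (at_left 0)"
    by (rule tendsto_eventually) (auto simp: exp_tail_def eventually_at_filter)
  have "((\<lambda>t. inverse t ^ n / exp (inverse t)) \<longlongrightarrow> (0::real)) (at_right 0)"
    by (rule filterlim_compose[OF tendsto_power_div_exp_0 filterlim_inverse_at_top_right])
  then show "(exp_tail n \<longlongrightarrow> 0) (at_right 0)"
    by (rule Lim_transform_eventually)
      (auto simp: exp_tail_def eventually_at_filter exp_minus divide_inverse mult.commute)
qed

lemma exp_tail_deriv:
  "(exp_tail n has_real_derivative (exp_tail (n + 2) t + (- real n) * exp_tail (Suc n) t)) (at t)"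
proof -
  consider "t > 0" | "t < 0" | "t = 0" by linarith
  then show ?thesis
  proof cases
    case 1
    have "((\<lambda>t. exp (- inverse t) * inverse t ^ n) has_real_derivative
        (exp (- inverse t) * (inverse t ^ 2)) * inverse t ^ n
        + exp (- inverse t) * (real n * inverse t ^ (n - 1) * (- (inverse t ^ 2)))) (at t)"
      using 1 by (auto intro!: derivative_eq_intros simp: power2_eq_square)
    moreover have "real n * inverse t ^ (n - 1) * (- (inverse t ^ 2)) = - real n * inverse t ^ Suc n"
      by (cases n) (auto simp: power2_eq_square algebra_simps)
    then have "exp (- inverse t) * (inverse t ^ 2) * inverse t ^ n
        + exp (- inverse t) * (real n * inverse t ^ (n - 1) * (- (inverse t ^ 2)))
        = exp_tail (n + 2) t + (- real n) * exp_tail (Suc n) t"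
      using 1 by (simp only: exp_tail_def) (simp add: algebra_simps power2_eq_square)
    ultimately have "((\<lambda>t. exp (- inverse t) * inverse t ^ n) has_real_derivative
        (exp_tail (n + 2) t + (- real n) * exp_tail (Suc n) t)) (at t)"
      by (simp only:)
    then show ?thesis
      by (rule has_field_derivative_transform_within_open[of _ _ _ "{0<..}"])
        (use 1 in \<open>auto simp: exp_tail_def\<close>)
  next
    case 2
    have "((\<lambda>t. 0) has_real_derivative (exp_tail (n + 2) t + (- real n) * exp_tail (Suc n) t)) (at t)"
      using 2 by (simp add: exp_tail_def)
    then show ?thesis
      by (rule has_field_derivative_transform_within_open[of _ _ _ "{..<0}"])
        (use 2 in \<open>auto simp: exp_tail_def\<close>)
  next
    case 3
    \<comment> \<open>The difference quotient at 0 is again a member of the family, so the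
      derivative at 0 is a limit that is already known to be 0.\<close>
    have "(\<lambda>h. (exp_tail n (0 + h) - exp_tail n 0) / h) = exp_tail (Suc n)"
      by (auto simp: exp_tail_def fun_eq_iff divide_inverse)
    then show ?thesis using exp_tail_tendsto_0[of "Suc n"] 3 by (simp add: DERIV_def exp_tail_def)
  qed
qed

lemma smooth_exp_tail: "smooth_on UNIV (exp_tail n)"
proof -
  have "Ck_on k UNIV (exp_tail n)" for k
  proof (induction k arbitrary: n)
    case 0
    show ?case using DERIV_continuous_on[OF has_field_derivative_at_within[OF exp_tail_deriv]] by auto
  next
    case (Suc k)
    show ?case
    proof (rule Ck_on_SucI[OF open_UNIV has_field_derivative_imp_has_derivative[OF exp_tail_deriv]])
      show "Ck_on k UNIV (\<lambda>t. (exp_tail (n + 2) t + (- real n) * exp_tail (Suc n) t) * v)" for v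
        by (intro Ck_on_linear_outer[OF _ bounded_linear_mult_left] Ck_on_add Suc.IH open_UNIV
            Ck_on_linear_outer[OF _ bounded_linear_mult_right])
    qed
  qed
  then show ?thesis by (simp add: smooth_on_def)
qed

lemma smooth_inverse: "smooth_on {0<..} (inverse :: real \<Rightarrow> real)"
proof -
  have "Ck_on k {0<..} (inverse :: real \<Rightarrow> real)" for k
  proof (induction k)
    case 0
    show ?case by (auto intro!: continuous_intros)
  next
    case (Suc k)
    show ?case
    proof (rule Ck_on_SucI)
      show "(inverse has_derivative (\<lambda>v. - (inverse x * v * inverse x))) (at x)" if "x \<in> {0<..}" for x :: real
        using that has_derivative_inverse'[of x UNIV] by simp
      show "Ck_on k {0<..} (\<lambda>x. - (inverse x * v * inverse x))" for v :: real
        by (intro Ck_on_linear_outer[OF _ bounded_linear_minus[OF bounded_linear_ident]] open_greaterThan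
            Ck_on_bilinear[OF _ bounded_bilinear_mult] Ck_on_linear_outer[OF _ bounded_linear_mult_left] Suc.IH)
    qed auto
  qed
  then show ?thesis by (simp add: smooth_on_def)
qed

lemma is_coord_basis_real: "is_coord_basis {1::real}"
  by (auto simp: is_coord_basis_def span_singleton pairwise_def)

text \<open>The arguments 2 - r and r - 1 add up to 1, so at least one of them is positive and the
  denominator never vanishes.\<close>

definition plateau :: "real \<Rightarrow> real" where
  "plateau r = exp_tail 0 (2 - r) * inverse (exp_tail 0 (2 - r) + exp_tail 0 (r - 1))"

lemma plateau_1: "r \<le> 1 \<Longrightarrow> plateau r = 1" and plateau_0: "r \<ge> 2 \<Longrightarrow> plateau r = 0"
  by (simp_all add: plateau_def exp_tail_def)

lemma smooth_plateau: "smooth_on UNIV plateau"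
proof -
  have 1: "smooth_on UNIV (\<lambda>r::real. exp_tail 0 (2 - r))" "smooth_on UNIV (\<lambda>r::real. exp_tail 0 (r - 1))"
    by (rule smooth_on_compose[OF is_coord_basis_real open_UNIV open_UNIV smooth_exp_tail];
        simp add: smooth_on_diff smooth_on_const smooth_on_ident)+
  have "exp_tail 0 (2 - r) + exp_tail 0 (r - 1) > 0" for r :: real
    by (auto simp: exp_tail_def intro: add_pos_pos)
  then have "smooth_on UNIV (\<lambda>r::real. inverse (exp_tail 0 (2 - r) + exp_tail 0 (r - 1)))"
    by (intro smooth_on_compose[OF is_coord_basis_real open_UNIV open_greaterThan smooth_inverse]
        smooth_on_add 1 open_UNIV) auto
  then show ?thesis
    unfolding plateau_def by (intro smooth_on_mult 1 open_UNIV)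
qed

text \<open>The plateau is applied to the squared distance, which unlike the distance is smooth at
  the centre.\<close>

lemma bump_function:
  fixes y :: "'a::real_inner"
  assumes "r > 0"
  obtains f :: "'a \<Rightarrow> real" where "smooth_on UNIV f" "\<And>z. z \<in> ball y (r / 2) \<Longrightarrow> f z = 1"
    "\<And>z. z \<notin> ball y (3 / 4 * r) \<Longrightarrow> f z = 0"
proof
  \<comment> \<open>The factor places the threshold 1 exactly at radius r/2; at radius 3r/4 the
    value is 9/4, above the threshold 2 of the plateau.\<close>
  define q where "q z = 4 / r\<^sup>2 * ((z - y) \<bullet> (z - y))" for z
  have q: "q z = 4 * (dist y z / r)\<^sup>2" for z
    unfolding q_def power_divide dist_commute[of y z] unfolding dist_norm power2_norm_eq_inner by simp
  show "smooth_on UNIV (\<lambda>z. plateau (q z))"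
    unfolding q_def
    by (intro smooth_on_compose[OF is_coord_basis_real open_UNIV open_UNIV smooth_plateau] open_UNIV
        smooth_on_linear_outer[OF _ bounded_linear_mult_right] smooth_on_diff smooth_on_ident smooth_on_const
        smooth_on_bilinear[OF _ bounded_bilinear_inner]) simp
  show "plateau (q z) = 1" if "z \<in> ball y (r / 2)" for z
  proof (rule plateau_1)
    have "(dist y z / r)\<^sup>2 \<le> (1 / 2)\<^sup>2"
      by (rule power_mono) (use that assms in \<open>auto simp: field_simps\<close>)
    moreover have "(1 / 2)\<^sup>2 = (1 / 4 :: real)" by (simp add: power2_eq_square)
    ultimately show "q z \<le> 1" unfolding q by linarith
  qed
  show "plateau (q z) = 0" if "z \<notin> ball y (3 / 4 * r)" for z
  proof (rule plateau_0)
    have "(3 / 4)\<^sup>2 \<le> (dist y z / r)\<^sup>2"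
      by (rule power_mono) (use that assms in \<open>auto simp: field_simps\<close>)
    moreover have "(3 / 4)\<^sup>2 = (9 / 16 :: real)" by (simp add: power2_eq_square)
    ultimately show "2 \<le> q z" unfolding q by linarith
  qed
qed

text \<open>The ball is a closed part of a coordinate cube, and the cube is a finite sum of compact
  segments.\<close>

lemma compact_cball_coord_basis:
  fixes y :: "'a::real_inner"
  assumes "is_coord_basis (B :: 'a set)" shows "compact (cball y r)"
proof -
  define R where "R = norm y + \<bar>r\<bar>"
  have B: "finite B" "\<And>b. b \<in> B \<Longrightarrow> norm b = 1" using assms by (auto simp: is_coord_basis_def)
  have "compact {\<Sum>b\<in>C. c b *\<^sub>R b | c. \<forall>b\<in>C. c b \<in> {-R..R}}" if "finite C" for C :: "'a set"
    using that
  proof induction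
    case (insert a C)
    let ?K = "\<lambda>C::'a set. {\<Sum>b\<in>C. c b *\<^sub>R b | c. \<forall>b\<in>C. c b \<in> {-R..R}}"
    have E: "?K (insert a C) = {u + v | u v. u \<in> (\<lambda>t. t *\<^sub>R a) ` {-R..R} \<and> v \<in> ?K C}" (is "?l = ?r")
    proof (rule subset_antisym; rule subsetI)
      fix p assume "p \<in> ?l"
      then obtain c where c: "\<forall>b\<in>insert a C. c b \<in> {-R..R}" "p = (\<Sum>b\<in>insert a C. c b *\<^sub>R b)" by blast
      then have "p = c a *\<^sub>R a + (\<Sum>b\<in>C. c b *\<^sub>R b)" using insert(1,2) by simp
      moreover have "c a *\<^sub>R a \<in> (\<lambda>t. t *\<^sub>R a) ` {-R..R}" using c by blast
      moreover have "(\<Sum>b\<in>C. c b *\<^sub>R b) \<in> ?K C" using c by blast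
      ultimately show "p \<in> ?r" by blast
    next
      fix p assume "p \<in> ?r"
      then obtain t c where tc: "t \<in> {-R..R}" "\<forall>b\<in>C. c b \<in> {-R..R}" "p = t *\<^sub>R a + (\<Sum>b\<in>C. c b *\<^sub>R b)"
        by auto
      have "(\<Sum>b\<in>C. c b *\<^sub>R b) = (\<Sum>b\<in>C. (c(a := t)) b *\<^sub>R b)"
        by (rule sum.cong) (use insert(2) in auto)
      then have "p = (\<Sum>b\<in>insert a C. (c(a := t)) b *\<^sub>R b)" using insert(1,2) tc(3) by simp
      moreover have "\<forall>b\<in>insert a C. (c(a := t)) b \<in> {-R..R}" using tc by auto
      ultimately show "p \<in> ?l" by blast
    qed
    have "compact ((\<lambda>t. t *\<^sub>R a) ` {-R..R})"
      by (intro compact_continuous_image continuous_intros) auto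
    then show ?case unfolding E by (intro compact_sums insert.IH)
  qed simp
  from compact_Int_closed[OF this[OF B(1)] closed_cball, of y r] 
  have "compact ({\<Sum>b\<in>B. c b *\<^sub>R b | c. \<forall>b\<in>B. c b \<in> {-R..R}} \<inter> cball y r)" .
  moreover have "cball y r \<subseteq> {\<Sum>b\<in>B. c b *\<^sub>R b | c. \<forall>b\<in>B. c b \<in> {-R..R}}"
  proof
    fix z assume "z \<in> cball y r"
    then have "norm z \<le> R" using norm_triangle_sub[of z y] by (auto simp: R_def dist_norm norm_minus_commute)
    then have "\<bar>z \<bullet> b\<bar> \<le> R" if "b \<in> B" for b
      using Cauchy_Schwarz_ineq2[of z b] B(2)[OF that] by simp
    then have "\<forall>b\<in>B. z \<bullet> b \<in> {-R..R}" by (auto simp: abs_le_iff minus_le_iff)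
    then show "z \<in> {\<Sum>b\<in>B. c b *\<^sub>R b | c. \<forall>b\<in>B. c b \<in> {-R..R}}"
      using coord_basis_expand[OF assms, of z] by (intro CollectI exI[of _ "\<lambda>b. z \<bullet> b"]) auto
  qed
  ultimately show ?thesis by (simp only: Int_absorb1)
qed


section \<open>Averages along rays and the lemma of Hadamard\<close>

text \<open>The weight t^m is there because every differentiation in the endpoint \<open>y\<close>
  produces one more factor t.\<close>

definition ray_mean :: "'a::real_normed_vector \<Rightarrow> nat \<Rightarrow> ('a \<Rightarrow> 'c::banach) \<Rightarrow> 'a \<Rightarrow> 'c" where
  "ray_mean x m f y = integral {0..1} (\<lambda>t. t ^ m *\<^sub>R f (x + t *\<^sub>R (y - x)))"

locale open_starlike =
  fixes S :: "'a::real_inner set" and x :: 'a and B :: "'a set"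
  assumes open_S: "open S" and x_S: "x \<in> S"
    and ray: "\<And>y t. y \<in> S \<Longrightarrow> t \<in> {0..1} \<Longrightarrow> x + t *\<^sub>R (y - x) \<in> S"
    and B: "is_coord_basis B"
begin

lemma continuous_on_ray:
  assumes "continuous_on S f" "y \<in> S"
  shows "continuous_on {0..1} (\<lambda>t. t ^ m *\<^sub>R (f (x + t *\<^sub>R (y - x)) :: 'c::banach))"
proof -
  have "continuous_on {0..1} (\<lambda>t. f (x + t *\<^sub>R (y - x)))"
    by (rule continuous_on_compose2[OF assms(1)])
      (use ray[OF assms(2)] in \<open>auto intro!: continuous_intros\<close>)
  then show ?thesis by (intro continuous_intros)
qed

lemma integrable_ray:
  assumes "continuous_on S f" "y \<in> S"
  shows "(\<lambda>t. t ^ m *\<^sub>R (f (x + t *\<^sub>R (y - x)) :: 'c::banach)) integrable_on {0..1}"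
  by (rule integrable_continuous_real[OF continuous_on_ray[OF assms]])

text \<open>A Lebesgue number for a cover of the compact segment from \<open>x\<close> to
  \<open>y\<close> by open sets on which \<open>g\<close> oscillates by less than \<open>e\<close>.
  Moving the endpoint by less than d moves every point of the segment by less than d.\<close>

lemma ray_uniform:
  fixes g :: "'a \<Rightarrow> 'c::metric_space"
  assumes "continuous_on S g" "y \<in> S" "e > 0"
  obtains d where "d > 0" "\<And>t z. t \<in> {0..1} \<Longrightarrow> dist y z < d \<Longrightarrow>
     x + t *\<^sub>R (z - x) \<in> S \<and> dist (g (x + t *\<^sub>R (z - x))) (g (x + t *\<^sub>R (y - x))) < e"
proof -
  define K where "K = (\<lambda>t. x + t *\<^sub>R (y - x)) ` {0..1}"
  define G where "G = {O'. open O' \<and> O' \<subseteq> S \<and> (\<forall>p\<in>O'. \<forall>q\<in>O'. dist (g p) (g q) < e)}"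
  have "compact K" unfolding K_def by (intro compact_continuous_image continuous_intros) auto
  moreover have "K \<subseteq> \<Union>G"
  proof
    fix p assume "p \<in> K"
    then have p: "p \<in> S" using ray[OF assms(2)] by (auto simp: K_def)
    define O' where "O' = S \<inter> g -` ball (g p) (e / 2)"
    have "open O'" unfolding O'_def by (rule continuous_open_preimage[OF assms(1) open_S open_ball])
    moreover have "dist (g q) (g q') < e" if "q \<in> O'" "q' \<in> O'" for q q'
      using that dist_triangle_half_r[of "g p" "g q" e "g q'"] by (auto simp: O'_def)
    ultimately have "O' \<in> G" by (auto simp: G_def O'_def)
    moreover have "p \<in> O'" using p assms(3) by (simp add: O'_def)
    ultimately show "p \<in> \<Union>G" by blast
  qed
  ultimately obtain d where d: "0 < d" "\<And>p. p \<in> K \<Longrightarrow> \<exists>O'\<in>G. ball p d \<subseteq> O'"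
    by (rule Heine_Borel_lemma[of K G]) (auto simp: G_def)
  show ?thesis
  proof
    show "d > 0" by fact
    fix t :: real and z assume t: "t \<in> {0..1}" and z: "dist y z < d"
    let ?p = "x + t *\<^sub>R (y - x)" and ?q = "x + t *\<^sub>R (z - x)"
    have "?p \<in> K" unfolding K_def using t by (rule imageI)
    then obtain O' where O': "O' \<in> G" "ball ?p d \<subseteq> O'" using d(2) by blast
    have "dist ?p ?q = t * dist y z"
      using t by (simp add: dist_norm scaleR_diff_right[symmetric] del: scaleR_diff_right)
    also have "\<dots> \<le> dist y z" using t by (simp add: mult_left_le_one_le)
    finally have "?q \<in> ball ?p d" using z by simp
    then have "?q \<in> O'" "?p \<in> O'" using O' d(1) by auto
    then show "?q \<in> S \<and> dist (g ?q) (g ?p) < e" using O'(1) by (auto simp: G_def)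
  qed
qed

lemma ray_mean_continuous:
  assumes "continuous_on S f" shows "continuous_on S (ray_mean x m f)"
  unfolding continuous_on_iff
proof (intro ballI allI impI)
  fix y and e :: real assume y: "y \<in> S" and e: "e > 0"
  obtain d where d: "d > 0" "\<And>t z. t \<in> {0..1} \<Longrightarrow> dist y z < d \<Longrightarrow>
     x + t *\<^sub>R (z - x) \<in> S \<and> dist (f (x + t *\<^sub>R (z - x))) (f (x + t *\<^sub>R (y - x))) < e / 2"
    using ray_uniform[OF assms y, of "e / 2"] e by auto
  have "dist (ray_mean x m f z) (ray_mean x m f y) < e" if "z \<in> S" "dist z y < d" for z
  proof -
    have "ray_mean x m f z - ray_mean x m f y = integral {0..1} (\<lambda>t. t ^ m *\<^sub>R f (x + t *\<^sub>R (z - x)) - t ^ m *\<^sub>R f (x + t *\<^sub>R (y - x)))"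
      unfolding ray_mean_def by (rule integral_diff[symmetric]; rule integrable_ray[OF assms]; fact)
    also have "norm \<dots> \<le> (e / 2) * (1 - 0)"
    proof (rule integral_bound)
      fix t :: real assume t: "t \<in> {0..1}"
      have "norm (t ^ m *\<^sub>R f (x + t *\<^sub>R (z - x)) - t ^ m *\<^sub>R f (x + t *\<^sub>R (y - x)))
          = t ^ m * dist (f (x + t *\<^sub>R (z - x))) (f (x + t *\<^sub>R (y - x)))"
        using t by (simp add: dist_norm scaleR_diff_right[symmetric] del: scaleR_diff_right)
      also have "\<dots> \<le> 1 * (e / 2)"
        by (rule mult_mono) (use t d(2)[OF t, of z] that e in \<open>auto simp: dist_commute power_le_one\<close>)
      finally show "norm (t ^ m *\<^sub>R f (x + t *\<^sub>R (z - x)) - t ^ m *\<^sub>R f (x + t *\<^sub>R (y - x))) \<le> e / 2" by simp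
    qed (auto intro!: continuous_on_diff continuous_on_ray assms that y)
    finally show ?thesis using e by (simp add: dist_norm)
  qed
  then show "\<exists>d>0. \<forall>z\<in>S. dist z y < d \<longrightarrow> dist (ray_mean x m f z) (ray_mean x m f y) < e"
    using d(1) by blast
qed

text \<open>Differentiation under the integral sign. The linearization error of \<open>f\<close> is
  controlled by the oscillation of its finitely many partial derivatives, which
  \<open>ray_uniform\<close> makes small uniformly in t. The inner derivative t raises the weight by
  one.\<close>

lemma ray_mean_has_derivative:
  assumes f: "Ck_on (Suc 0) S f" and y: "y \<in> S"
  shows "(ray_mean x m f has_derivative
     (\<lambda>v. ray_mean x (Suc m) (\<lambda>p. frechet_derivative f (at p) v) y)) (at y)"
proof -
  let ?D = "\<lambda>v p. frechet_derivative f (at p) v"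
  let ?p = "\<lambda>t y. x + t *\<^sub>R (y - x)"
  have contD: "continuous_on S (?D v)" for v using f by simp
  have fd: "(f has_derivative frechet_derivative f (at p)) (at p)" if "p \<in> S" for p
    by (rule Ck_on_has_derivative[OF f that])
  have finB: "finite B" "\<And>b. b \<in> B \<Longrightarrow> norm b = 1" using B by (auto simp: is_coord_basis_def)
  have L: "ray_mean x (Suc m) (?D v) y = (\<Sum>b\<in>B. (v \<bullet> b) *\<^sub>R ray_mean x (Suc m) (?D b) y)" for v
  proof -
    have "ray_mean x (Suc m) (?D v) y = integral {0..1} (\<lambda>t. \<Sum>b\<in>B. (v \<bullet> b) *\<^sub>R (t ^ Suc m *\<^sub>R ?D b (?p t y)))"
      unfolding ray_mean_def
    proof (rule integral_cong)
      fix t :: real assume t: "t \<in> {0..1}"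
      have "?D v (?p t y) = (\<Sum>b\<in>B. (v \<bullet> b) *\<^sub>R ?D b (?p t y))"
        by (rule linear_coord_expand[OF B has_derivative_linear[OF fd[OF ray[OF y t]]]])
      then show "t ^ Suc m *\<^sub>R ?D v (?p t y) = (\<Sum>b\<in>B. (v \<bullet> b) *\<^sub>R (t ^ Suc m *\<^sub>R ?D b (?p t y)))"
        by (simp add: scaleR_sum_right mult.commute mult.left_commute)
    qed
    also have "\<dots> = (\<Sum>b\<in>B. integral {0..1} (\<lambda>t. (v \<bullet> b) *\<^sub>R (t ^ Suc m *\<^sub>R ?D b (?p t y))))"
      by (rule integral_sum[OF finB(1)]) (intro integrable_cmul integrable_ray contD y)
    also have "\<dots> = (\<Sum>b\<in>B. (v \<bullet> b) *\<^sub>R ray_mean x (Suc m) (?D b) y)"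
      unfolding ray_mean_def by (simp only: integral_cmul)
    finally show ?thesis .
  qed
  have bl: "bounded_linear (\<lambda>v. ray_mean x (Suc m) (?D v) y)"
  proof -
    have "(\<lambda>v. ray_mean x (Suc m) (?D v) y) = (\<lambda>v. \<Sum>b\<in>B. (v \<bullet> b) *\<^sub>R ray_mean x (Suc m) (?D b) y)"
      by (rule ext) (rule L)
    then show ?thesis
      by (rule ssubst[where P = bounded_linear])
        (intro bounded_linear_sum bounded_linear_scaleR_const bounded_linear_inner_left)
  qed
  show ?thesis
    unfolding has_derivative_at_alt
  proof (intro conjI bl allI impI)
    fix e :: real assume e: "e > 0"
    \<comment> \<open>The errors in the \<open>card B\<close> coordinates add up to at most
      \<open>e\<close>; the extra 1 keeps the quotient meaningful in dimension zero.\<close>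
    define e' where "e' = e / (real (card B) + 1)"
    have e': "e' > 0" "real (card B) * e' \<le> e" using e by (auto simp: e'_def field_simps)
    have "\<exists>d>0. \<forall>t\<in>{0..1}. \<forall>z. dist y z < d \<longrightarrow> ?p t z \<in> S \<and> dist (?D b (?p t z)) (?D b (?p t y)) < e'" for b
      using ray_uniform[OF contD y e'(1), of b] by metis
    then obtain d where d: "\<And>b. d b > 0" "\<And>b t z. t \<in> {0..1} \<Longrightarrow> dist y z < d b \<Longrightarrow>
        ?p t z \<in> S \<and> dist (?D b (?p t z)) (?D b (?p t y)) < e'" by metis
    \<comment> \<open>Inserting \<open>d 0\<close> keeps the minimum over a nonempty set when the
      basis is empty.\<close>
    define \<delta> where "\<delta> = Min (insert (d 0) (d ` B))"
    have \<delta>: "\<delta> > 0" "\<delta> \<le> d 0" "\<And>b. b \<in> B \<Longrightarrow> \<delta> \<le> d b"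
      using d(1) finB(1) by (auto simp: \<delta>_def)
    have "norm (ray_mean x m f z - ray_mean x m f y - ray_mean x (Suc m) (?D (z - y)) y) \<le> e * norm (z - y)"
      if z: "norm (z - y) < \<delta>" for z
    proof -
      have zd: "dist y z < \<delta>" using z by (simp add: dist_norm norm_minus_commute)
      have zS: "z \<in> S" using d(2)[of 1 z 0] zd \<delta>(2) by simp
      have contf: "continuous_on S f" using Ck_on_SucD[OF f] by simp
      note i1 = integrable_ray[OF contf zS, of m] and i2 = integrable_ray[OF contf y, of m]
        and i3 = integrable_ray[OF contD y, of "Suc m" "z - y"]
      have eq: "ray_mean x m f z - ray_mean x m f y - ray_mean x (Suc m) (?D (z - y)) y =
        integral {0..1} (\<lambda>t. t ^ m *\<^sub>R f (?p t z) - t ^ m *\<^sub>R f (?p t y) - t ^ Suc m *\<^sub>R ?D (z - y) (?p t y))"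
        unfolding ray_mean_def by (simp only: integral_diff[OF i1 i2] integral_diff[OF integrable_diff[OF i1 i2] i3])
      have "norm (integral {0..1} (\<lambda>t. t ^ m *\<^sub>R f (?p t z) - t ^ m *\<^sub>R f (?p t y) - t ^ Suc m *\<^sub>R ?D (z - y) (?p t y)))
          \<le> (e * norm (z - y)) * (1 - 0)"
      proof (rule integral_bound)
        fix t :: real assume t: "t \<in> {0..1}"
        define T where "T = (\<lambda>s. ?p t y + s *\<^sub>R (?p t z - ?p t y)) ` {0..1}"
        have TS: "p \<in> S \<and> (\<forall>b\<in>B. dist (?D b p) (?D b (?p t y)) < e')" if "p \<in> T" for p
        proof -
          from that obtain s where s: "s \<in> {0..1}" "p = ?p t y + s *\<^sub>R (?p t z - ?p t y)" by (auto simp: T_def)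
          have p: "p = ?p t (y + s *\<^sub>R (z - y))" by (simp add: s(2) algebra_simps)
          have "dist y (y + s *\<^sub>R (z - y)) \<le> dist y z"
            using s(1) by (simp add: dist_norm mult_left_le_one_le norm_minus_commute)
          then show ?thesis using d(2)[OF t, of "y + s *\<^sub>R (z - y)"] zd \<delta> p
            by (meson less_le_trans le_less_trans)
        qed
        have "norm (f (?p t z) - f (?p t y) - frechet_derivative f (at (?p t y)) (?p t z - ?p t y))
            \<le> norm (?p t z - ?p t y) * e"
        proof (rule differentiable_bound_linearization[where S = T])
          show "?p t y + s *\<^sub>R (?p t z - ?p t y) \<in> T" if "s \<in> {0..1}" for s using that by (auto simp: T_def)
          show "(f has_derivative frechet_derivative f (at p)) (at p within T)" if "p \<in> T" for p
            using fd TS[OF that] has_derivative_at_withinI by blast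
          show "?p t y \<in> T" by (auto simp: T_def intro: image_eqI[of _ _ 0])
          show "onorm (frechet_derivative f (at p) - frechet_derivative f (at (?p t y))) \<le> e" if p: "p \<in> T" for p
          proof (rule onorm_bound)
            show "0 \<le> e" using e by simp
            fix v
            have "norm ((frechet_derivative f (at p) - frechet_derivative f (at (?p t y))) v)
               = norm (\<Sum>b\<in>B. (v \<bullet> b) *\<^sub>R (?D b p - ?D b (?p t y)))"
              using linear_coord_expand[OF B has_derivative_linear[OF fd[of p]], of v]
                linear_coord_expand[OF B has_derivative_linear[OF fd[OF ray[OF y t]]], of v] TS[OF p]
              by (simp add: sum_subtractf scaleR_diff_right)
            also have "\<dots> \<le> (\<Sum>b\<in>B. norm v * e')"
            proof (rule sum_norm_le)
              fix b assume b: "b \<in> B"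
              have "norm ((v \<bullet> b) *\<^sub>R (?D b p - ?D b (?p t y))) = \<bar>v \<bullet> b\<bar> * dist (?D b p) (?D b (?p t y))"
                by (simp add: dist_norm)
              also have "\<dots> \<le> norm v * e'"
                by (rule mult_mono) (use TS[OF p] b Cauchy_Schwarz_ineq2[of v b] finB(2)[OF b] in auto)
              finally show "norm ((v \<bullet> b) *\<^sub>R (?D b p - ?D b (?p t y))) \<le> norm v * e'" .
            qed
            also have "\<dots> = norm v * (real (card B) * e')" by (simp add: algebra_simps)
            also have "\<dots> \<le> norm v * e" by (rule mult_left_mono[OF e'(2)]) simp
            finally show "norm ((frechet_derivative f (at p) - frechet_derivative f (at (?p t y))) v) \<le> e * norm v"
              by (simp add: mult.commute)
          qed
        qed
        moreover have "?p t z - ?p t y = t *\<^sub>R (z - y)" by (simp add: algebra_simps)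
        ultimately have *: "norm (f (?p t z) - f (?p t y) - t *\<^sub>R ?D (z - y) (?p t y)) \<le> t * norm (z - y) * e"
          using t linear_scale[OF has_derivative_linear[OF fd[OF ray[OF y t]]], of t "z - y"] by simp
        have "t ^ m *\<^sub>R f (?p t z) - t ^ m *\<^sub>R f (?p t y) - t ^ Suc m *\<^sub>R ?D (z - y) (?p t y)
          = t ^ m *\<^sub>R (f (?p t z) - f (?p t y) - t *\<^sub>R ?D (z - y) (?p t y))"
          by (simp add: scaleR_diff_right mult.commute)
        then have "norm (t ^ m *\<^sub>R f (?p t z) - t ^ m *\<^sub>R f (?p t y) - t ^ Suc m *\<^sub>R ?D (z - y) (?p t y))
           = t ^ m * norm (f (?p t z) - f (?p t y) - t *\<^sub>R ?D (z - y) (?p t y))"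
          using t by simp
        also have "\<dots> \<le> 1 * (1 * norm (z - y) * e)"
          by (intro mult_mono order.trans[OF *]) (use t e in \<open>auto simp: power_le_one\<close>)
        finally show "norm (t ^ m *\<^sub>R f (?p t z) - t ^ m *\<^sub>R f (?p t y) - t ^ Suc m *\<^sub>R ?D (z - y) (?p t y)) \<le> e * norm (z - y)"
          by (simp add: mult.commute)
      qed (auto intro!: continuous_on_diff continuous_on_ray contD y zS contf simp del: power_Suc)
      then show ?thesis unfolding eq by simp
    qed
    then show "\<exists>d>0. \<forall>z. norm (z - y) < d \<longrightarrow>
        norm (ray_mean x m f z - ray_mean x m f y - ray_mean x (Suc m) (?D (z - y)) y) \<le> e * norm (z - y)"
      using \<delta>(1) by blast
  qed
qed

lemma ray_mean_smooth: "smooth_on S f \<Longrightarrow> smooth_on S (ray_mean x m f)"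
proof -
  have "Ck_on k S f \<Longrightarrow> Ck_on k S (ray_mean x m f)" for k
  proof (induction k arbitrary: f m)
    case 0
    then show ?case by (simp add: ray_mean_continuous)
  next
    case (Suc k)
    have "Ck_on (Suc 0) S f" by (rule Ck_on_mono[OF _ Suc.prems]) simp
    then show ?case
      by (intro Ck_on_SucI[OF open_S ray_mean_has_derivative]) (use Suc in auto)
  qed
  then show "smooth_on S f \<Longrightarrow> smooth_on S (ray_mean x m f)" by (simp add: smooth_on_def)
qed

lemma ray_mean_iterated:
  assumes "smooth_on S f" "y \<in> S"
  shows "iterated_derivative \<alpha> (ray_mean x m f) y = ray_mean x (m + length \<alpha>) (iterated_derivative \<alpha> f) y"
  using assms(2)
proof (induction \<alpha> arbitrary: y)
  case (Cons v \<alpha>)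
  have sm: "smooth_on S (iterated_derivative \<alpha> f)" by (rule smooth_on_iterated[OF assms(1)])
  then have "Ck_on (Suc 0) S (iterated_derivative \<alpha> f)" unfolding smooth_on_def by blast
  from ray_mean_has_derivative[OF this Cons.prems, of "m + length \<alpha>"]
  have "(iterated_derivative \<alpha> (ray_mean x m f) has_derivative
    (\<lambda>v. ray_mean x (Suc (m + length \<alpha>)) (\<lambda>p. frechet_derivative (iterated_derivative \<alpha> f) (at p) v) y)) (at y)"
    by (rule has_derivative_transform_within_open[OF _ open_S Cons.prems]) (simp add: Cons.IH)
  from frechet_derivative_eq[OF this] show ?case by simp
qed simp

text \<open>At the centre only the integral of t^m remains. Together with
  \<open>ray_mean_iterated\<close> this yields the factor 1/(length + 1) that reappears in the
  coefficients of local expressions.\<close>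

lemma ray_mean_center: "ray_mean x m f x = (1 / (real m + 1)) *\<^sub>R f x"
proof -
  have "((\<lambda>t::real. t ^ m) has_integral (1 ^ Suc m / real (Suc m) - 0 ^ Suc m / real (Suc m))) {0..1}"
  proof (rule fundamental_theorem_of_calculus)
    show "((\<lambda>t. t ^ Suc m / real (Suc m)) has_vector_derivative t ^ m) (at t within {0..1})" for t :: real
      unfolding has_real_derivative_iff_has_vector_derivative[symmetric]
      by (rule derivative_eq_intros refl | simp)+
  qed simp
  from has_integral_scaleR_left[OF this, of "f x"] show ?thesis
    by (simp add: ray_mean_def integral_unique add.commute)
qed

text \<open>Fundamental theorem of calculus along the ray, with the direction \<open>y - x\<close>
  expanded in the basis. The point of the formula is that its remainder factors are ray means, hence
  smooth.\<close>

lemma hadamard: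
  fixes f :: "'a \<Rightarrow> 'c::banach"
  assumes "smooth_on S f" "y \<in> S"
  shows "f y = f x + (\<Sum>b\<in>B. ((y - x) \<bullet> b) *\<^sub>R ray_mean x 0 (\<lambda>p. frechet_derivative f (at p) b) y)"
proof -
  let ?D = "\<lambda>v p. frechet_derivative f (at p) v"
  let ?p = "\<lambda>t. x + t *\<^sub>R (y - x)"
  have fd: "(f has_derivative frechet_derivative f (at p)) (at p)" if "p \<in> S" for p
    by (rule smooth_on_has_derivative[OF assms(1) that])
  have contD: "continuous_on S (?D v)" for v
    by (rule smooth_on_continuous[OF smooth_on_derivative[OF assms(1)]])
  have "((\<lambda>t. ?D (y - x) (?p t)) has_integral (f (?p 1) - f (?p 0))) {0..1}"
  proof (rule fundamental_theorem_of_calculus)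
    fix t :: real assume t: "t \<in> {0..1}"
    have "((\<lambda>t. ?p t) has_derivative (\<lambda>s. s *\<^sub>R (y - x))) (at t within {0..1})"
      by (auto intro!: derivative_eq_intros)
    from has_derivative_compose[OF this fd[OF ray[OF assms(2) t]]]
    show "((\<lambda>t. f (?p t)) has_vector_derivative ?D (y - x) (?p t)) (at t within {0..1})"
      using linear_scale[OF has_derivative_linear[OF fd[OF ray[OF assms(2) t]]]]
      by (simp add: has_vector_derivative_def)
  qed simp
  then have "f y - f x = integral {0..1} (\<lambda>t. ?D (y - x) (?p t))" by (simp add: integral_unique)
  also have "\<dots> = integral {0..1} (\<lambda>t. \<Sum>b\<in>B. ((y - x) \<bullet> b) *\<^sub>R (t ^ 0 *\<^sub>R ?D b (?p t)))"
  proof (rule integral_cong)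
    fix t :: real assume t: "t \<in> {0..1}"
    show "?D (y - x) (?p t) = (\<Sum>b\<in>B. ((y - x) \<bullet> b) *\<^sub>R (t ^ 0 *\<^sub>R ?D b (?p t)))"
      using linear_coord_expand[OF B has_derivative_linear[OF fd[OF ray[OF assms(2) t]]], of "y - x"] by simp
  qed
  also have "\<dots> = (\<Sum>b\<in>B. ((y - x) \<bullet> b) *\<^sub>R ray_mean x 0 (?D b) y)"
    unfolding ray_mean_def integral_cmul[symmetric]
    by (rule integral_sum)
      (use B in \<open>simp add: is_coord_basis_def\<close>, intro integrable_cmul integrable_ray contD assms(2))
  finally show ?thesis by (simp add: diff_eq_eq add.commute)
qed

end

section \<open>Smooth maps on manifolds and sections of bundles\<close>

lemma bounded_bilinear_matrix_vector:
  "bounded_bilinear ((*v) :: real^'n^'m \<Rightarrow> real^'n \<Rightarrow> real^'m)"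
  unfolding bilinear_conv_bounded_bilinear[symmetric] bilinear_def
  by (auto intro!: linearI simp: matrix_vector_right_distrib matrix_vector_mult_add_rdistrib
      scaleR_matrix_vector_assoc matrix_vector_mult_scaleR)

lemma smooth_map_on_chart_inv:
  "smooth_map_on A W f \<longleftrightarrow> (\<forall>c\<in>A. smooth_on (snd c ` (fst c \<inter> W)) (\<lambda>y. f (chart_inv c y)))"
  by (auto simp: smooth_map_on_def chart_inv_def o_def split_beta)

locale manifold =
  fixes A :: "('m::{t2_space, second_countable_topology}, 'b::real_inner) chart set"
  assumes manifold: "smooth_manifold A"
begin

lemma coord_basis: "is_coord_basis (coord_basis :: 'b set)"
  using manifold unfolding smooth_manifold_def coord_basis_def by (blast intro: someI)

lemma chart_exists: obtains c where "c \<in> A" "x \<in> fst c"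
  using manifold unfolding smooth_manifold_def by blast

lemma
  assumes "c \<in> A"
  shows chart_open: "open (fst c)" and chart_range_open: "open (snd c ` fst c)"
    and chart_homeomorphism: "homeomorphism (fst c) (snd c ` fst c) (snd c) (chart_inv c)"
  using manifold assms unfolding smooth_manifold_def chart_inv_def by (fastforce simp: split_beta)+

lemma chart_image_open:
  assumes "c \<in> A" "open W" shows "open (snd c ` (fst c \<inter> W))"
  using homeomorphism_imp_open_map[OF chart_homeomorphism[OF assms(1)] openin_open_Int[OF assms(2)]]
    openin_open_trans[OF _ chart_range_open[OF assms(1)]] by blast

lemma chart_inv_left [simp]: "c \<in> A \<Longrightarrow> x \<in> fst c \<Longrightarrow> chart_inv c (snd c x) = x"
  using chart_homeomorphism homeomorphism_apply1 by blast

lemma smooth_map_onD: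
  "smooth_map_on A W f \<Longrightarrow> c \<in> A \<Longrightarrow> smooth_on (snd c ` (fst c \<inter> W)) (\<lambda>y. f (chart_inv c y))"
  by (simp add: smooth_map_on_chart_inv)

lemma transition_smooth:
  assumes "c \<in> A" "c' \<in> A"
  shows "smooth_on (snd c ` (fst c \<inter> fst c')) (\<lambda>y. snd c' (chart_inv c y))"
  using manifold assms unfolding smooth_manifold_def chart_inv_def
  by (fastforce simp: split_beta o_def)

text \<open>One chart is enough, since any other differs from it by a smooth transition map.\<close>

lemma smooth_map_chart:
  assumes "c \<in> A" "open W" "W \<subseteq> fst c" "smooth_on (snd c ` W) (\<lambda>y. f (chart_inv c y))"
  shows "smooth_map_on A W f"
  unfolding smooth_map_on_chart_inv
proof
  fix c' assume c': "c' \<in> A"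
  have o: "open (snd c' ` (fst c' \<inter> W))" "open (snd c ` W)"
    using chart_image_open[OF c' assms(2)] chart_image_open[OF assms(1,2)] assms(3)
    by (simp_all add: Int_absorb1)
  have "smooth_on (snd c' ` (fst c' \<inter> W)) (\<lambda>y. (\<lambda>z. f (chart_inv c z)) (snd c (chart_inv c' y)))"
  proof (rule smooth_on_compose[OF coord_basis o assms(4)])
    show "smooth_on (snd c' ` (fst c' \<inter> W)) (\<lambda>y. snd c (chart_inv c' y))"
      by (rule smooth_on_subset[OF transition_smooth[OF c' assms(1)]]) (use assms(3) in auto)
    show "(\<lambda>y. snd c (chart_inv c' y)) ` snd c' ` (fst c' \<inter> W) \<subseteq> snd c ` W"
      using c' by auto
  qed
  then show "smooth_on (snd c' ` (fst c' \<inter> W)) (\<lambda>y. f (chart_inv c' y))"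
    by (rule smooth_on_eqI[OF _ o(1)]) (use c' assms(1,3) in auto)
qed

lemma smooth_map_subset: "smooth_map_on A W f \<Longrightarrow> V \<subseteq> W \<Longrightarrow> smooth_map_on A V f"
  unfolding smooth_map_on_chart_inv by (meson smooth_on_subset image_mono Int_mono order_refl)

lemma smooth_map_local:
  assumes "\<And>x. x \<in> W \<Longrightarrow> \<exists>V. open V \<and> x \<in> V \<and> smooth_map_on A V f"
  shows "smooth_map_on A W f"
  unfolding smooth_map_on_chart_inv
proof
  fix c assume c: "c \<in> A"
  show "smooth_on (snd c ` (fst c \<inter> W)) (\<lambda>y. f (chart_inv c y))"
  proof (rule smooth_on_local)
    fix y assume "y \<in> snd c ` (fst c \<inter> W)"
    then obtain x where x: "x \<in> fst c" "x \<in> W" "y = snd c x" by auto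
    obtain V where V: "open V" "x \<in> V" "smooth_map_on A V f" using assms[OF x(2)] by blast
    have "open (snd c ` (fst c \<inter> V))" by (rule chart_image_open[OF c V(1)])
    moreover have "y \<in> snd c ` (fst c \<inter> V)" using x V by blast
    moreover have "smooth_on (snd c ` (fst c \<inter> V)) (\<lambda>y. f (chart_inv c y))"
      by (rule smooth_map_onD[OF V(3) c])
    ultimately show "\<exists>T. open T \<and> y \<in> T \<and> smooth_on T (\<lambda>y. f (chart_inv c y))" by blast
  qed
qed

lemma smooth_map_eqI:
  assumes "smooth_map_on A W f" "open W" "\<And>x. x \<in> W \<Longrightarrow> f x = g x" shows "smooth_map_on A W g"
  unfolding smooth_map_on_chart_inv
proof
  fix c assume c: "c \<in> A"
  show "smooth_on (snd c ` (fst c \<inter> W)) (\<lambda>y. g (chart_inv c y))"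
    by (rule smooth_on_eqI[OF smooth_map_onD[OF assms(1) c] chart_image_open[OF c assms(2)]])
      (use assms(3) c in auto)
qed

lemma smooth_map_const: "smooth_map_on A W (\<lambda>x. k)"
  by (simp add: smooth_map_on_chart_inv smooth_on_const)

lemma smooth_map_add:
  "open W \<Longrightarrow> smooth_map_on A W f \<Longrightarrow> smooth_map_on A W g \<Longrightarrow> smooth_map_on A W (\<lambda>x. f x + g x)"
  by (simp add: smooth_map_on_chart_inv smooth_on_add chart_image_open)

lemma smooth_map_diff:
  "open W \<Longrightarrow> smooth_map_on A W f \<Longrightarrow> smooth_map_on A W g \<Longrightarrow> smooth_map_on A W (\<lambda>x. f x - g x)"
  by (simp add: smooth_map_on_chart_inv smooth_on_diff chart_image_open)

lemma smooth_map_bilinear: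
  assumes "open W" "bounded_bilinear p" "smooth_map_on A W f" "smooth_map_on A W g"
  shows "smooth_map_on A W (\<lambda>x. p (f x) (g x))"
  unfolding smooth_map_on_chart_inv
  by (intro ballI smooth_on_bilinear[OF _ assms(2)] chart_image_open smooth_map_onD assms)

lemmas smooth_map_mult = smooth_map_bilinear[OF _ bounded_bilinear_mult]
  and smooth_map_scaleR = smooth_map_bilinear[OF _ bounded_bilinear_scaleR]

lemma smooth_map_linear_outer:
  assumes "open W" "bounded_linear h" "smooth_map_on A W f" shows "smooth_map_on A W (\<lambda>x. h (f x))"
  unfolding smooth_map_on_chart_inv
  by (intro ballI smooth_on_linear_outer[OF _ assms(2)] chart_image_open smooth_map_onD assms)

lemma smooth_map_sum:
  "open W \<Longrightarrow> (\<And>i. i \<in> I \<Longrightarrow> smooth_map_on A W (f i)) \<Longrightarrow> smooth_map_on A W (\<lambda>x. \<Sum>i\<in>I. f i x)"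
  by (simp add: smooth_map_on_chart_inv smooth_on_sum chart_image_open)

lemma smooth_map_coord:
  assumes "c \<in> A" shows "smooth_map_on A (fst c) (snd c)"
  by (rule smooth_map_chart[OF assms chart_open[OF assms] order_refl],
      rule smooth_on_eqI[OF smooth_on_ident[OF chart_range_open[OF assms]] chart_range_open[OF assms]])
    (use assms in auto)

text \<open>The set \<open>W\<close> and the complement of \<open>C\<close> are open and cover the
  manifold; on the latter the function is zero. This is the standard way below to globalize local
  data.\<close>

lemma smooth_map_extend:
  assumes "smooth_map_on A W f" "open W" "closed C" "C \<subseteq> W" "\<And>x. x \<notin> C \<Longrightarrow> f x = 0"
  shows "smooth_map_on A UNIV f"
proof (rule smooth_map_local)
  fix x
  have "smooth_map_on A (- C) f"
    by (rule smooth_map_eqI[OF smooth_map_const[of _ 0]]) (use assms(3,5) in auto)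
  moreover have "open (- C)" using assms(3) by (rule open_Compl)
  ultimately show "\<exists>V. open V \<and> x \<in> V \<and> smooth_map_on A V f"
    using assms(1,2,4) by (cases "x \<in> C") blast+
qed

lemma smooth_functions_iff: "u \<in> smooth_functions A \<longleftrightarrow> smooth_map_on A UNIV u"
  by (simp add: smooth_functions_def)

lemma smooth_functions_const: "(\<lambda>x. k) \<in> smooth_functions A"
  and smooth_functions_add: "u \<in> smooth_functions A \<Longrightarrow> v \<in> smooth_functions A \<Longrightarrow> (\<lambda>x. u x + v x) \<in> smooth_functions A"
  and smooth_functions_diff: "u \<in> smooth_functions A \<Longrightarrow> v \<in> smooth_functions A \<Longrightarrow> (\<lambda>x. u x - v x) \<in> smooth_functions A"
  and smooth_functions_mult: "u \<in> smooth_functions A \<Longrightarrow> v \<in> smooth_functions A \<Longrightarrow> (\<lambda>x. u x * v x) \<in> smooth_functions A"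
  by (simp_all add: smooth_functions_def smooth_map_const smooth_map_add smooth_map_diff smooth_map_mult)

lemma smooth_functions_prod:
  "(\<And>i. i \<in> I \<Longrightarrow> f i \<in> smooth_functions A) \<Longrightarrow> (\<lambda>x. \<Prod>i\<in>I. f i x) \<in> smooth_functions A"
  by (induction I rule: infinite_finite_induct) (auto intro: smooth_functions_const smooth_functions_mult)

text \<open>A bump function of the model space is transported by a chart. Its support lies in the
  image \<open>C\<close> of a closed ball, which is compact and therefore closed in the Hausdorff
  manifold; this makes extension by zero smooth.\<close>

lemma bump_on_manifold:
  assumes "open W" "x \<in> W"
  obtains \<theta> N C where "\<theta> \<in> smooth_functions A" "open N" "closed C" "x \<in> N" "N \<subseteq> C" "C \<subseteq> W"
    "\<And>z. z \<in> N \<Longrightarrow> \<theta> z = 1" "\<And>z. z \<notin> C \<Longrightarrow> \<theta> z = 0"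
proof -
  obtain c where c: "c \<in> A" "x \<in> fst c" by (rule chart_exists)
  define y where "y = snd c x"
  have "open (snd c ` (fst c \<inter> W))" "y \<in> snd c ` (fst c \<inter> W)"
    using chart_image_open[OF c(1) assms(1)] c assms(2) by (auto simp: y_def)
  then obtain r where r: "r > 0" "ball y r \<subseteq> snd c ` (fst c \<inter> W)"
    by (meson openE)
  obtain f :: "'b \<Rightarrow> real" where f: "smooth_on UNIV f" "\<And>z. z \<in> ball y (r / 2) \<Longrightarrow> f z = 1"
    "\<And>z. z \<notin> ball y (3 / 4 * r) \<Longrightarrow> f z = 0"
    by (rule bump_function[OF r(1)]) blast
  have K: "cball y (3 / 4 * r) \<subseteq> ball y r" using r(1) by (auto simp: subset_eq)
  then have K': "cball y (3 / 4 * r) \<subseteq> snd c ` (fst c \<inter> W)" using r(2) by blast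
  define N where "N = fst c \<inter> snd c -` ball y (r / 2)"
  define C where "C = chart_inv c ` cball y (3 / 4 * r)"
  define \<theta> where "\<theta> z = (if z \<in> fst c then f (snd c z) else 0)" for z
  have cont: "continuous_on (fst c) (snd c)" "continuous_on (snd c ` fst c) (chart_inv c)"
    using chart_homeomorphism[OF c(1)] by (auto simp: homeomorphism_def)
  have "compact C" unfolding C_def
    by (rule compact_continuous_image[OF continuous_on_subset[OF cont(2)]
          compact_cball_coord_basis[OF coord_basis]]) (use K' in blast)
  then have clC: "closed C" by (rule compact_imp_closed)
  have CW: "C \<subseteq> W" "C \<subseteq> fst c" using K' c(1) by (auto simp: C_def)
  have inC: "z \<in> C" if "z \<in> fst c" "snd c z \<in> cball y (3 / 4 * r)" for z
    unfolding C_def using that c(1) by (metis chart_inv_left imageI)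
  have \<theta>0: "\<theta> z = 0" if "z \<notin> C" for z
  proof (cases "z \<in> fst c")
    case True
    then have "snd c z \<notin> ball y (3 / 4 * r)" using inC that ball_subset_cball by blast
    then show ?thesis using f(3) True by (simp add: \<theta>_def)
  qed (simp add: \<theta>_def)
  have oN: "open N" unfolding N_def by (rule continuous_open_preimage[OF cont(1) chart_open[OF c(1)] open_ball])
  have "ball y (r / 2) \<subseteq> cball y (3 / 4 * r)" using r(1) by (auto simp: subset_eq)
  then have NC: "N \<subseteq> C" using inC by (auto simp: N_def)
  have "smooth_on (snd c ` fst c) (\<lambda>p. \<theta> (chart_inv c p))"
    by (rule smooth_on_eqI[OF smooth_on_subset[OF f(1)] chart_range_open[OF c(1)]]) (use c in \<open>auto simp: \<theta>_def\<close>)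
  then have "smooth_map_on A (fst c) \<theta>"
    by (rule smooth_map_chart[OF c(1) chart_open[OF c(1)] order_refl])
  then have "\<theta> \<in> smooth_functions A"
    unfolding smooth_functions_iff by (rule smooth_map_extend[OF _ chart_open[OF c(1)] clC CW(2) \<theta>0])
  moreover have "\<theta> z = 1" if "z \<in> N" for z using that f(2) by (auto simp: N_def \<theta>_def)
  moreover have "x \<in> N" using c r(1) by (simp add: N_def y_def)
  ultimately show ?thesis using that oN clC NC CW(1) \<theta>0 by blast
qed

end

section \<open>Sections of a vector bundle: local coordinates, gluing, extension by zero\<close>

locale vector_bundle = manifold A
  for A :: "('m::{t2_space, second_countable_topology}, 'b::real_inner) chart set" +
  fixes E :: "'m \<Rightarrow> 'v::real_vector set" and L :: "('m, 'n::finite, 'v) triv set"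
  assumes vector_bundle: "smooth_vector_bundle A E L"
begin

abbreviation "\<Gamma> \<equiv> sections A E L"
abbreviation "Cinf \<equiv> smooth_functions A"
abbreviation "mu \<equiv> mult_op A E L"
abbreviation "loc \<equiv> local_section :: ('m, 'n, 'v) triv \<Rightarrow> _"

lemma triv_exists: obtains t where "t \<in> L" "x \<in> fst t"
  using vector_bundle unfolding smooth_vector_bundle_def by blast

lemma triv_open: "t \<in> L \<Longrightarrow> open (fst t)"
  and triv_linear: "t \<in> L \<Longrightarrow> x \<in> fst t \<Longrightarrow> linear (snd t x)"
  and triv_bij: "t \<in> L \<Longrightarrow> x \<in> fst t \<Longrightarrow> bij_betw (snd t x) UNIV (E x)"
  using vector_bundle unfolding smooth_vector_bundle_def by (fastforce simp: split_beta)+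

lemma triv_transition:
  "t \<in> L \<Longrightarrow> t' \<in> L \<Longrightarrow>
    smooth_map_on A (fst t \<inter> fst t') (\<lambda>x. matrix (inv_into UNIV (snd t' x) \<circ> snd t x))"
  using vector_bundle unfolding smooth_vector_bundle_def by (fastforce simp: split_beta)

lemma fiber_eq_range: "t \<in> L \<Longrightarrow> x \<in> fst t \<Longrightarrow> E x = range (snd t x)"
  using triv_bij by (metis bij_betw_imp_surj_on)

lemma triv_inv [simp]: "t \<in> L \<Longrightarrow> x \<in> fst t \<Longrightarrow> inv_into UNIV (snd t x) (snd t x w) = w"
  using triv_bij by (metis bij_betw_inv_into_left UNIV_I)

lemma triv_inv_right: "t \<in> L \<Longrightarrow> x \<in> fst t \<Longrightarrow> e \<in> E x \<Longrightarrow> snd t x (inv_into UNIV (snd t x) e) = e"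
  using triv_bij by (metis bij_betw_inv_into_right)

lemma fiber_subspace: "subspace (E x)"
proof -
  obtain t where t: "t \<in> L" "x \<in> fst t" by (rule triv_exists)
  show ?thesis unfolding fiber_eq_range[OF t]
    by (rule linear_subspace_image[OF triv_linear[OF t] subspace_UNIV])
qed

lemmas fiber_0 = subspace_0[OF fiber_subspace] and fiber_add = subspace_add[OF fiber_subspace]
  and fiber_scale = subspace_scale[OF fiber_subspace]

lemma
  assumes t: "t \<in> L" "x \<in> fst t"
  shows triv_inv_add: "e \<in> E x \<Longrightarrow> e' \<in> E x \<Longrightarrow>
      inv_into UNIV (snd t x) (e + e') = inv_into UNIV (snd t x) e + inv_into UNIV (snd t x) e'"
    and triv_inv_scale: "e \<in> E x \<Longrightarrow> inv_into UNIV (snd t x) (r *\<^sub>R e) = r *\<^sub>R inv_into UNIV (snd t x) e"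
  unfolding fiber_eq_range[OF t]
  using t by (auto simp: linear_add[OF triv_linear[OF t], symmetric] linear_scale[OF triv_linear[OF t], symmetric])

lemma section_fiber: "s \<in> \<Gamma> \<Longrightarrow> s x \<in> E x" by (simp add: sections_def)

lemma loc_add: "t \<in> L \<Longrightarrow> x \<in> fst t \<Longrightarrow> s x \<in> E x \<Longrightarrow> s' x \<in> E x \<Longrightarrow>
    loc t (\<lambda>x. s x + s' x) x = loc t s x + loc t s' x"
  and loc_scale: "t \<in> L \<Longrightarrow> x \<in> fst t \<Longrightarrow> s x \<in> E x \<Longrightarrow>
    loc t (\<lambda>x. u x *\<^sub>R s x) x = u x *\<^sub>R loc t s x"
  by (simp_all add: local_section_def triv_inv_add triv_inv_scale)

lemma loc_inverse: "t \<in> L \<Longrightarrow> x \<in> fst t \<Longrightarrow> s x \<in> E x \<Longrightarrow> snd t x (loc t s x) = s x"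
  by (simp add: local_section_def triv_inv_right)

lemma loc_smooth: "s \<in> \<Gamma> \<Longrightarrow> t \<in> L \<Longrightarrow> smooth_map_on A (fst t) (loc t s)"
  by (simp add: sections_def)

lemma loc_change:
  assumes "t \<in> L" "t' \<in> L" "x \<in> fst t" "x \<in> fst t'" "s x \<in> E x"
  shows "loc t' s x = matrix (inv_into UNIV (snd t' x) \<circ> snd t x) *v loc t s x"
proof -
  have r: "snd t x w \<in> E x" for w using fiber_eq_range[OF assms(1,3)] by blast
  have "linear (inv_into UNIV (snd t' x) \<circ> snd t x)"
    by (rule linearI) (simp_all add: linear_add[OF triv_linear[OF assms(1,3)]]
        linear_scale[OF triv_linear[OF assms(1,3)]] triv_inv_add[OF assms(2,4) r r] triv_inv_scale[OF assms(2,4) r])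
  then show ?thesis
    by (simp add: matrix_works) (simp add: local_section_def triv_inv_right[OF assms(1,3,5)])
qed

text \<open>Near each point a single trivialization suffices, because the coordinates in any other
  one arise by a smooth matrix.\<close>

lemma sectionI:
  assumes "\<And>x. s x \<in> E x"
    and "\<And>x. \<exists>t\<in>L. \<exists>V. open V \<and> x \<in> V \<and> V \<subseteq> fst t \<and> smooth_map_on A V (loc t s)"
  shows "s \<in> \<Gamma>"
  unfolding sections_def mem_Collect_eq
proof (intro conjI allI ballI assms(1))
  fix t' assume t': "t' \<in> L"
  show "smooth_map_on A (fst t') (loc t' s)"
  proof (rule smooth_map_local)
    fix x assume x: "x \<in> fst t'"
    obtain t V where t: "t \<in> L" "open V" "x \<in> V" "V \<subseteq> fst t" "smooth_map_on A V (loc t s)"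
      using assms(2)[of x] by blast
    have o: "open (V \<inter> fst t')" using t(2) triv_open[OF t'] by blast
    have "smooth_map_on A (V \<inter> fst t') (\<lambda>x. matrix (inv_into UNIV (snd t' x) \<circ> snd t x) *v loc t s x)"
      by (intro smooth_map_bilinear[OF o bounded_bilinear_matrix_vector]
          smooth_map_subset[OF triv_transition[OF t(1) t']] smooth_map_subset[OF t(5)]) (use t in auto)
    then have "smooth_map_on A (V \<inter> fst t') (loc t' s)"
      by (rule smooth_map_eqI[OF _ o]) (use t t' assms(1) in \<open>auto intro: loc_change[symmetric]\<close>)
    then show "\<exists>V. open V \<and> x \<in> V \<and> smooth_map_on A V (loc t' s)" using o x t(3) by blast
  qed
qed

lemma section_localI:
  assumes "\<And>x. \<exists>s'\<in>\<Gamma>. \<exists>V. open V \<and> x \<in> V \<and> (\<forall>z\<in>V. s z = s' z)"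
  shows "s \<in> \<Gamma>"
proof (rule sectionI)
  fix x
  obtain s' V where s': "s' \<in> \<Gamma>" "open V" "x \<in> V" "\<forall>z\<in>V. s z = s' z" using assms[of x] by blast
  obtain t where t: "t \<in> L" "x \<in> fst t" by (rule triv_exists)
  show "s x \<in> E x" using s' section_fiber by simp
  have o: "open (fst t \<inter> V)" using triv_open[OF t(1)] s'(2) by blast
  have "smooth_map_on A (fst t \<inter> V) (loc t s)"
    by (rule smooth_map_eqI[OF smooth_map_subset[OF loc_smooth[OF s'(1) t(1)]] o])
      (use s'(4) in \<open>auto simp: local_section_def\<close>)
  then show "\<exists>t\<in>L. \<exists>V. open V \<and> x \<in> V \<and> V \<subseteq> fst t \<and> smooth_map_on A V (loc t s)"
    using o t s'(3) by blast
qed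

lemma section_add:
  assumes "s \<in> \<Gamma>" "s' \<in> \<Gamma>" shows "(\<lambda>x. s x + s' x) \<in> \<Gamma>"
  unfolding sections_def mem_Collect_eq
proof (intro conjI allI ballI)
  show "s x + s' x \<in> E x" for x by (intro fiber_add section_fiber assms)
  fix t assume t: "t \<in> L"
  show "smooth_map_on A (fst t) (loc t (\<lambda>x. s x + s' x))"
    by (rule smooth_map_eqI[OF smooth_map_add[OF triv_open[OF t] loc_smooth[OF assms(1) t] loc_smooth[OF assms(2) t]] triv_open[OF t]])
      (simp add: loc_add t section_fiber assms)
qed

lemma section_mult:
  assumes "u \<in> Cinf" "s \<in> \<Gamma>" shows "(\<lambda>x. u x *\<^sub>R s x) \<in> \<Gamma>"
  unfolding sections_def mem_Collect_eq
proof (intro conjI allI ballI)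
  show "u x *\<^sub>R s x \<in> E x" for x by (intro fiber_scale section_fiber assms)
  fix t assume t: "t \<in> L"
  have "smooth_map_on A (fst t) u"
    by (rule smooth_map_subset[OF assms(1)[unfolded smooth_functions_iff]]) simp
  from smooth_map_scaleR[OF triv_open[OF t] this loc_smooth[OF assms(2) t]]
  show "smooth_map_on A (fst t) (loc t (\<lambda>x. u x *\<^sub>R s x))"
    by (rule smooth_map_eqI[OF _ triv_open[OF t]]) (simp add: loc_scale t section_fiber assms)
qed

lemma section_scale: "s \<in> \<Gamma> \<Longrightarrow> (\<lambda>x. r *\<^sub>R s x) \<in> \<Gamma>"
  using section_mult[OF smooth_functions_const] by blast

lemma section_diff: "s \<in> \<Gamma> \<Longrightarrow> s' \<in> \<Gamma> \<Longrightarrow> (\<lambda>x. s x - s' x) \<in> \<Gamma>"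
  using section_add[OF _ section_scale, of s s' "-1"] by simp

text \<open>The section with coordinates \<open>w\<close> in the frame of \<open>t\<close>. Used
  with a closed \<open>C\<close> inside the domain of \<open>t\<close> and \<open>w\<close>
  vanishing off \<open>C\<close>, so that the extension by zero is smooth.\<close>

definition frame_section :: "('m, 'n, 'v) triv \<Rightarrow> 'm set \<Rightarrow> ('m \<Rightarrow> (real, 'n) vec) \<Rightarrow> 'm \<Rightarrow> 'v" where
  "frame_section t C w = (\<lambda>z. if z \<in> C then snd t z (w z) else 0)"

lemma frame_section_fiber:
  "t \<in> L \<Longrightarrow> C \<subseteq> fst t \<Longrightarrow> frame_section t C w z \<in> E z"
  by (auto simp: frame_section_def fiber_0 fiber_eq_range)

lemma loc_frame_section:
  assumes "t \<in> L" "z \<in> fst t" "z \<notin> C \<Longrightarrow> w z = 0"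
  shows "loc t (frame_section t C w) z = w z"
  using assms triv_inv[OF assms(1,2), of 0] linear_0[OF triv_linear[OF assms(1,2)]]
  by (auto simp: local_section_def frame_section_def)

lemma frame_section_in:
  assumes "t \<in> L" "open W" "W \<subseteq> fst t" "closed C" "C \<subseteq> W" "smooth_map_on A W w" "\<And>z. z \<notin> C \<Longrightarrow> w z = 0"
  shows "frame_section t C w \<in> \<Gamma>"
proof (rule sectionI)
  have Ct: "C \<subseteq> fst t" using assms by blast
  show "frame_section t C w z \<in> E z" for z by (rule frame_section_fiber[OF assms(1) Ct])
  have w: "smooth_map_on A UNIV w" by (rule smooth_map_extend[OF assms(6,2,4,5,7)])
  fix x
  show "\<exists>p\<in>L. \<exists>V. open V \<and> x \<in> V \<and> V \<subseteq> fst p \<and> smooth_map_on A V (loc p (frame_section t C w))"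
  proof (cases "x \<in> fst t")
    case True
    have "smooth_map_on A (fst t) (loc t (frame_section t C w))"
      by (rule smooth_map_eqI[OF smooth_map_subset[OF w] triv_open[OF assms(1)]])
        (use assms loc_frame_section in auto)
    then show ?thesis using True assms(1) triv_open by blast
  next
    case False
    obtain t' where t': "t' \<in> L" "x \<in> fst t'" by (rule triv_exists)
    have o: "open (fst t' \<inter> - C)" using triv_open[OF t'(1)] assms(4) by blast
    have "loc t' (frame_section t C w) z = 0" if "z \<in> fst t' \<inter> - C" for z
      using that triv_inv[OF t'(1), of z 0] linear_0[OF triv_linear[OF t'(1)]]
      by (auto simp: local_section_def frame_section_def)
    then have "smooth_map_on A (fst t' \<inter> - C) (loc t' (frame_section t C w))"
      by (intro smooth_map_eqI[OF smooth_map_const[of _ 0] o]) simp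
    moreover have "x \<in> fst t' \<inter> - C" using t' False Ct by blast
    ultimately show ?thesis using o
      by (intro bexI[OF _ t'(1)] exI[of _ "fst t' \<inter> - C"] conjI) (assumption | rule Int_lower1)+
  qed
qed

lemma section_through:
  assumes "e \<in> E x" obtains s where "s \<in> \<Gamma>" "s x = e"
proof -
  obtain t where t: "t \<in> L" "x \<in> fst t" by (rule triv_exists)
  obtain \<theta> N C where \<theta>: "\<theta> \<in> Cinf" "open N" "closed C" "x \<in> N" "N \<subseteq> C" "C \<subseteq> fst t"
    "\<And>z. z \<in> N \<Longrightarrow> \<theta> z = 1" "\<And>z. z \<notin> C \<Longrightarrow> \<theta> z = 0"
    by (rule bump_on_manifold[OF triv_open[OF t(1)] t(2)]) blast
  define w where "w z = \<theta> z *\<^sub>R inv_into UNIV (snd t x) e" for z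
  have "smooth_map_on A (fst t) w" unfolding w_def
    by (intro smooth_map_scaleR smooth_map_const triv_open t smooth_map_subset[OF \<theta>(1)[unfolded smooth_functions_iff]]) simp
  then have "frame_section t C w \<in> \<Gamma>"
    by (intro frame_section_in[OF t(1) triv_open[OF t(1)] order_refl \<theta>(3,6)]) (simp_all add: w_def \<theta>(8))
  moreover have "frame_section t C w x = e"
    using \<theta> t assms by (auto simp: frame_section_def w_def triv_inv_right)
  ultimately show ?thesis by (rule that)
qed

lemma fiber_nonzero: obtains e where "e \<in> E x" "e \<noteq> 0"
proof -
  obtain t where t: "t \<in> L" "x \<in> fst t" by (rule triv_exists)
  \<comment> \<open>Here 1 is the vector with all entries 1; it differs from 0 because the index
    type is nonempty.\<close>
  have "snd t x 1 \<noteq> 0"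
    using triv_inv[OF t, of 1] triv_inv[OF t, of 0] linear_0[OF triv_linear[OF t]] by (metis one_neq_zero)
  then show ?thesis using that fiber_eq_range[OF t] by blast
qed

text \<open>Such a section is the test object that recovers the scalar by which a multiplication
  operator acts at \<open>x\<close>.\<close>

lemma nonvanishing_section: obtains s where "s \<in> \<Gamma>" "s x \<noteq> 0"
  by (rule fiber_nonzero[of x]) (use section_through in metis)

end

section \<open>The filtered algebra of operators\<close>

context vector_bundle begin

abbreviation "\<E> \<equiv> End_sections A E L"
abbreviation "P \<equiv> P_nat A E L"
abbreviation "ad u T \<equiv> commutator T (mu u)"

lemma section_0: "(\<lambda>x. 0) \<in> \<Gamma>"
proof -
  obtain s where "s \<in> \<Gamma>" by (rule nonvanishing_section)
  from section_scale[OF this, of 0] show ?thesis by simp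
qed

lemma End_closed: "T \<in> \<E> \<Longrightarrow> s \<in> \<Gamma> \<Longrightarrow> T s \<in> \<Gamma>"
  and End_out: "T \<in> \<E> \<Longrightarrow> s \<notin> \<Gamma> \<Longrightarrow> T s = (\<lambda>x. 0)"
  and End_add: "T \<in> \<E> \<Longrightarrow> s \<in> \<Gamma> \<Longrightarrow> t \<in> \<Gamma> \<Longrightarrow> T (\<lambda>x. s x + t x) = (\<lambda>x. T s x + T t x)"
  and End_scale: "T \<in> \<E> \<Longrightarrow> s \<in> \<Gamma> \<Longrightarrow> T (\<lambda>x. r *\<^sub>R s x) = (\<lambda>x. r *\<^sub>R T s x)"
  by (simp_all add: End_sections_def)

lemma End_diff:
  assumes "T \<in> \<E>" "s \<in> \<Gamma>" "t \<in> \<Gamma>" shows "T (\<lambda>x. s x - t x) = (\<lambda>x. T s x - T t x)"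
  using End_add[OF assms(1,2) section_scale[OF assms(3), of "-1"]] End_scale[OF assms(1,3), of "-1"] by simp

lemma End_0: "T \<in> \<E> \<Longrightarrow> T (\<lambda>x. 0) = (\<lambda>x. 0)"
  using End_scale[OF _ section_0, of T 0] by simp

lemma End_sum:
  assumes "T \<in> \<E>" "finite I" "\<And>i. i \<in> I \<Longrightarrow> s i \<in> \<Gamma>"
  shows "(\<lambda>x. \<Sum>i\<in>I. s i x) \<in> \<Gamma> \<and> T (\<lambda>x. \<Sum>i\<in>I. s i x) = (\<lambda>x. \<Sum>i\<in>I. T (s i) x)"
  using assms(2,3) by (induction I) (simp_all add: section_0 section_add End_0[OF assms(1)] End_add[OF assms(1)])

lemma EndI:
  assumes "\<And>s. s \<in> \<Gamma> \<Longrightarrow> T s \<in> \<Gamma>" "\<And>s. s \<notin> \<Gamma> \<Longrightarrow> T s = (\<lambda>x. 0)"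
    "\<And>s t. s \<in> \<Gamma> \<Longrightarrow> t \<in> \<Gamma> \<Longrightarrow> T (\<lambda>x. s x + t x) = (\<lambda>x. T s x + T t x)"
    "\<And>r s. s \<in> \<Gamma> \<Longrightarrow> T (\<lambda>x. r *\<^sub>R s x) = (\<lambda>x. r *\<^sub>R T s x)"
  shows "T \<in> \<E>"
  using assms by (simp add: End_sections_def)

text \<open>Members of \<open>End_sections\<close> vanish outside the sections by convention, so
  equality is decided on sections.\<close>

lemma End_eqI:
  assumes "T \<in> \<E>" "D \<in> \<E>" "\<And>s x. s \<in> \<Gamma> \<Longrightarrow> T s x = D s x" shows "T = D"
proof
  fix s show "T s = D s" by (cases "s \<in> \<Gamma>") (use assms End_out in auto)
qed

lemma mu_apply: "s \<in> \<Gamma> \<Longrightarrow> mu u s = (\<lambda>x. u x *\<^sub>R s x)"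
  by (simp add: mult_op_def)

lemma op_add_apply: "op_add T D s = (\<lambda>x. T s x + D s x)"
  and op_scale_apply: "op_scale r T s = (\<lambda>x. r *\<^sub>R T s x)"
  and op_diff_apply: "op_diff T D s = (\<lambda>x. T s x - D s x)"
  and op_zero_apply: "op_zero s = (\<lambda>x. 0)"
  and op_sum_apply: "op_sum I F s = (\<lambda>x. \<Sum>i\<in>I. F i s x)"
  and commutator_apply: "commutator T D s = (\<lambda>x. T (D s) x - D (T s) x)"
  by (simp_all add: op_add_def op_scale_def op_diff_def op_zero_def op_sum_def commutator_def)

lemmas op_apply = op_add_apply op_scale_apply op_diff_apply op_zero_apply op_sum_apply o_apply

lemma op_add_End: "T \<in> \<E> \<Longrightarrow> D \<in> \<E> \<Longrightarrow> op_add T D \<in> \<E>"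
  by (rule EndI) (simp_all add: op_apply section_add End_closed End_out End_add End_scale algebra_simps)

lemma op_scale_End: "T \<in> \<E> \<Longrightarrow> op_scale r T \<in> \<E>"
  by (rule EndI) (simp_all add: op_apply section_scale End_closed End_out End_add End_scale algebra_simps)

lemma op_diff_eq: "op_diff T D = op_add T (op_scale (-1) D)"
  by (simp add: op_diff_def op_add_def op_scale_def)

lemma op_diff_End: "T \<in> \<E> \<Longrightarrow> D \<in> \<E> \<Longrightarrow> op_diff T D \<in> \<E>"
  by (simp add: op_diff_eq op_add_End op_scale_End)

lemma op_zero_End: "op_zero \<in> \<E>"
  by (rule EndI) (simp_all add: op_apply section_0)

lemma comp_End: "T \<in> \<E> \<Longrightarrow> D \<in> \<E> \<Longrightarrow> T \<circ> D \<in> \<E>"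
  by (rule EndI) (simp_all add: End_closed End_out End_add End_scale End_0)

lemma mu_End: "u \<in> Cinf \<Longrightarrow> mu u \<in> \<E>"
  by (rule EndI) (simp_all add: mult_op_def section_mult section_add section_scale scaleR_add_right mult.commute)

lemma commutator_End: "T \<in> \<E> \<Longrightarrow> D \<in> \<E> \<Longrightarrow> commutator T D \<in> \<E>"
  by (simp add: commutator_def op_diff_End comp_End)

lemma op_sum_empty: "op_sum {} F = op_zero"
  by (simp add: op_sum_def op_zero_def)

lemma op_sum_insert: "finite I \<Longrightarrow> i \<notin> I \<Longrightarrow> op_sum (insert i I) F = op_add (F i) (op_sum I F)"
  by (simp add: op_sum_def op_add_def)

lemma ad_apply:
  "T \<in> \<E> \<Longrightarrow> s \<in> \<Gamma> \<Longrightarrow> ad u T s = (\<lambda>x. T (\<lambda>x. u x *\<^sub>R s x) x - u x *\<^sub>R T s x)"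
  by (simp add: commutator_apply mu_apply End_closed)

lemmas End_simps = End_closed End_add End_diff End_scale End_0 section_mult section_add section_diff section_scale section_0
  op_add_End op_scale_End op_diff_End op_zero_End comp_End mu_End commutator_End

section \<open>Commutators with multiplication operators as commuting derivations\<close>

lemma ad_op_add: "T \<in> \<E> \<Longrightarrow> D \<in> \<E> \<Longrightarrow> u \<in> Cinf \<Longrightarrow> ad u (op_add T D) = op_add (ad u T) (ad u D)"
  by (rule End_eqI) (simp_all add: End_simps ad_apply op_apply scaleR_add_right)

lemma ad_op_scale: "T \<in> \<E> \<Longrightarrow> u \<in> Cinf \<Longrightarrow> ad u (op_scale r T) = op_scale r (ad u T)"
  by (rule End_eqI) (simp_all add: End_simps ad_apply op_apply scaleR_diff_right mult.commute)

lemma ad_op_zero: "u \<in> Cinf \<Longrightarrow> ad u op_zero = op_zero"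
  by (rule End_eqI) (simp_all add: End_simps ad_apply op_apply)

lemma ad_mu: "u \<in> Cinf \<Longrightarrow> v \<in> Cinf \<Longrightarrow> ad u (mu v) = op_zero"
  by (rule End_eqI) (simp_all add: End_simps ad_apply op_apply mu_apply mult.commute)

lemma ad_comp:
  "T \<in> \<E> \<Longrightarrow> D \<in> \<E> \<Longrightarrow> u \<in> Cinf \<Longrightarrow> ad u (T \<circ> D) = op_add (T \<circ> ad u D) (ad u T \<circ> D)"
proof (rule End_eqI)
  fix s x assume *: "T \<in> \<E>" "D \<in> \<E>" "u \<in> Cinf" "s \<in> \<Gamma>"
  then show "ad u (T \<circ> D) s x = op_add (T \<circ> ad u D) (ad u T \<circ> D) s x"
    by (simp add: End_simps ad_apply op_apply End_diff[OF *(1)])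
qed (simp_all add: End_simps)

text \<open>The Jacobi identity, in the form that \<open>ad u\<close> is a derivation of the
  commutator bracket.\<close>

lemma ad_commutator:
  "T \<in> \<E> \<Longrightarrow> D \<in> \<E> \<Longrightarrow> u \<in> Cinf \<Longrightarrow>
    ad u (commutator T D) = op_add (commutator (ad u T) D) (commutator T (ad u D))"
proof (rule End_eqI)
  fix s x assume *: "T \<in> \<E>" "D \<in> \<E>" "u \<in> Cinf" "s \<in> \<Gamma>"
  have "commutator (ad u T) D s x = ad u T (D s) x - D (ad u T s) x"
    and "commutator T (ad u D) s x = T (ad u D s) x - ad u D (T s) x"
    and "commutator T D s' = (\<lambda>x. T (D s') x - D (T s') x)" for s'
    by (simp_all only: commutator_apply)
  then show "ad u (commutator T D) s x = op_add (commutator (ad u T) D) (commutator T (ad u D)) s x"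
    using * by (simp add: End_simps ad_apply op_apply scaleR_diff_right End_diff[OF *(1)] End_diff[OF *(2)])
qed (simp_all add: End_simps)

lemma ad_commute:
  "T \<in> \<E> \<Longrightarrow> u \<in> Cinf \<Longrightarrow> v \<in> Cinf \<Longrightarrow> ad u (ad v T) = ad v (ad u T)"
  by (rule End_eqI) (simp_all add: End_simps ad_apply algebra_simps)

lemma ad_add_fun:
  "T \<in> \<E> \<Longrightarrow> u \<in> Cinf \<Longrightarrow> v \<in> Cinf \<Longrightarrow> ad (\<lambda>x. u x + v x) T = op_add (ad u T) (ad v T)"
proof (rule End_eqI)
  fix s x assume *: "T \<in> \<E>" "u \<in> Cinf" "v \<in> Cinf" "s \<in> \<Gamma>"
  then show "ad (\<lambda>x. u x + v x) T s x = op_add (ad u T) (ad v T) s x"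
    by (simp add: End_simps ad_apply op_apply scaleR_add_left End_add[OF *(1)])
qed (simp_all add: End_simps smooth_functions_add)

lemma smooth_functions_scale: "u \<in> Cinf \<Longrightarrow> (\<lambda>x. r * u x) \<in> Cinf"
  by (rule smooth_functions_mult[OF smooth_functions_const])

lemma ad_scale_fun: "T \<in> \<E> \<Longrightarrow> u \<in> Cinf \<Longrightarrow> ad (\<lambda>x. r * u x) T = op_scale r (ad u T)"
proof (rule End_eqI)
  fix s x assume *: "T \<in> \<E>" "u \<in> Cinf" "s \<in> \<Gamma>"
  have "T (\<lambda>x. (r * u x) *\<^sub>R s x) = (\<lambda>x. r *\<^sub>R T (\<lambda>x. u x *\<^sub>R s x) x)"
    using End_scale[OF *(1) section_mult[OF *(2,3)], of r] by simp
  then show "ad (\<lambda>x. r * u x) T s x = op_scale r (ad u T) s x"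
    using * by (simp add: ad_apply op_apply scaleR_diff_right)
qed (simp_all add: End_simps smooth_functions_scale)

lemma op_add_zero: "op_add op_zero T = T" "op_add T op_zero = T"
  and op_scale_zero: "op_scale r op_zero = op_zero"
  and zero_comp: "op_zero \<circ> T = op_zero"
  by (simp_all add: op_add_def op_zero_def op_scale_def fun_eq_iff)

lemma comp_zero: "T \<in> \<E> \<Longrightarrow> T \<circ> op_zero = op_zero"
  by (simp add: fun_eq_iff op_zero_def End_0)

lemma P_0: "T \<in> P 0 \<longleftrightarrow> (\<exists>w\<in>Cinf. T = mu w)" by auto

lemma P_End: "T \<in> P k \<Longrightarrow> T \<in> \<E>"
  by (cases k) (auto simp: mu_End)

lemma P_ad: "T \<in> P (Suc k) \<Longrightarrow> u \<in> Cinf \<Longrightarrow> ad u T \<in> P k"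
  by simp

lemma P_SucI: "T \<in> \<E> \<Longrightarrow> (\<And>u. u \<in> Cinf \<Longrightarrow> ad u T \<in> P k) \<Longrightarrow> T \<in> P (Suc k)"
  by simp

declare P_nat.simps [simp del]

lemma mu_zero: "mu (\<lambda>x. 0) = op_zero"
  by (simp add: mult_op_def op_zero_def fun_eq_iff)

lemma P_zero: "op_zero \<in> P k"
proof (induction k)
  case 0
  show ?case unfolding P_0 using smooth_functions_const mu_zero by metis
qed (auto intro: P_SucI op_zero_End simp: ad_op_zero)

lemma P_Suc: "T \<in> P k \<Longrightarrow> T \<in> P (Suc k)"
proof (induction k arbitrary: T)
  case 0
  then show ?case by (intro P_SucI) (auto simp: P_0 mu_End ad_mu intro: P_zero[of 0, unfolded P_0])
next
  case (Suc k)
  then show ?case by (metis P_SucI P_End P_ad)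
qed

lemma P_mono: "i \<le> j \<Longrightarrow> T \<in> P i \<Longrightarrow> T \<in> P j"
  by (induction j) (auto simp: le_Suc_eq intro: P_Suc)

lemma P_add: "T \<in> P k \<Longrightarrow> D \<in> P k \<Longrightarrow> op_add T D \<in> P k"
proof (induction k arbitrary: T D)
  case 0
  then obtain u v where "u \<in> Cinf" "v \<in> Cinf" "T = mu u" "D = mu v" by (auto simp: P_0)
  then have "op_add T D = mu (\<lambda>x. u x + v x)" "(\<lambda>x. u x + v x) \<in> Cinf"
    by (auto simp: smooth_functions_add mult_op_def op_add_def fun_eq_iff scaleR_add_left)
  then show ?case by (auto simp: P_0)
next
  case (Suc k)
  then show ?case by (intro P_SucI) (auto simp: ad_op_add P_End op_add_End P_ad)
qed

lemma P_scale: "T \<in> P k \<Longrightarrow> op_scale r T \<in> P k"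
proof (induction k arbitrary: T)
  case 0
  then obtain u where "u \<in> Cinf" "T = mu u" by (auto simp: P_0)
  then have "op_scale r T = mu (\<lambda>x. r * u x)" "(\<lambda>x. r * u x) \<in> Cinf"
    by (auto simp: smooth_functions_scale mult_op_def op_scale_def fun_eq_iff)
  then show ?case by (auto simp: P_0)
next
  case (Suc k)
  then show ?case by (intro P_SucI) (auto simp: ad_op_scale P_End op_scale_End P_ad)
qed

lemma P_diff: "T \<in> P k \<Longrightarrow> D \<in> P k \<Longrightarrow> op_diff T D \<in> P k"
  by (simp add: op_diff_eq P_add P_scale)

lemma mu_comp: "u \<in> Cinf \<Longrightarrow> v \<in> Cinf \<Longrightarrow> mu u \<circ> mu v = mu (\<lambda>x. u x * v x)"
  by (rule End_eqI) (simp_all add: End_simps mu_apply smooth_functions_mult)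

text \<open>By the Leibniz rule a commutator lowers the degree of one factor at a time, whence
  induction on the total degree. A factor of degree 0 commutes with all multiplications, so its term
  drops out.\<close>

lemma P_comp: "T \<in> P i \<Longrightarrow> D \<in> P j \<Longrightarrow> T \<circ> D \<in> P (i + j)"
proof (induction "i + j" arbitrary: i j T D)
  case 0
  then obtain u v where "u \<in> Cinf" "v \<in> Cinf" "T = mu u" "D = mu v" by (auto simp: P_0)
  then show ?case using 0 by (auto simp: P_0 mu_comp intro: smooth_functions_mult)
next
  case (Suc m)
  have "ad u (T \<circ> D) \<in> P m" if u: "u \<in> Cinf" for u
  proof -
    have "T \<circ> ad u D \<in> P m"
    proof (cases j)
      case 0
      then have "ad u D = op_zero" using Suc.prems(2) u by (auto simp: P_0 ad_mu)
      then show ?thesis using comp_zero[OF P_End[OF Suc.prems(1)]] by (simp add: P_zero)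
    next
      case (Suc j')
      then show ?thesis using Suc.hyps Suc.prems P_ad u by (metis add_Suc_right nat.inject)
    qed
    moreover have "ad u T \<circ> D \<in> P m"
    proof (cases i)
      case 0
      then have "ad u T = op_zero" using Suc.prems(1) u by (auto simp: P_0 ad_mu)
      then show ?thesis by (simp add: zero_comp P_zero)
    next
      case (Suc i')
      then show ?thesis using Suc.hyps Suc.prems P_ad u by (metis add_Suc nat.inject)
    qed
    ultimately show ?thesis using Suc.prems u by (simp add: ad_comp P_End P_add)
  qed
  then show ?case unfolding Suc.hyps(2)[symmetric]
    using Suc.prems by (intro P_SucI comp_End P_End)
qed

lemma commutator_mu_left: "commutator (mu v) D = op_scale (-1) (ad v D)"
  by (simp add: commutator_def op_diff_def op_scale_def)

text \<open>This is what makes the symbol algebra commutative. The Jacobi identity passes to smaller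
  total degree; the case of total degree 0 is separate because subtraction on \<open>nat\<close>
  cannot reach the degree -1, where only zero is left.\<close>

lemma P_commutator: "T \<in> P i \<Longrightarrow> D \<in> P j \<Longrightarrow>
    if i + j = 0 then commutator T D = op_zero else commutator T D \<in> P (i + j - 1)"
proof (induction "i + j" arbitrary: i j T D rule: less_induct)
  case less
  consider "i = 0" | "j = 0" | i' j' where "i = Suc i'" "j = Suc j'" by (metis not0_implies_Suc)
  then show ?case
  proof cases
    case 1
    then obtain v where v: "v \<in> Cinf" "T = mu v" using less.prems(1) by (auto simp: P_0)
    show ?thesis
    proof (cases j)
      case 0
      then have "ad v D = op_zero" using less.prems(2) v by (auto simp: P_0 ad_mu)
      then show ?thesis using 1 0 v by (simp add: commutator_mu_left op_scale_zero)
    next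
      case (Suc j')
      then show ?thesis using 1 less.prems(2) v by (simp add: commutator_mu_left P_scale P_ad)
    qed
  next
    case 2
    then obtain v where v: "v \<in> Cinf" "D = mu v" using less.prems(2) by (auto simp: P_0)
    show ?thesis
    proof (cases i)
      case 0
      then have "ad v T = op_zero" using less.prems(1) v by (auto simp: P_0 ad_mu)
      then show ?thesis using 2 0 v by simp
    next
      case (Suc j')
      then show ?thesis using 2 less.prems(1) v by (simp add: P_ad)
    qed
  next
    case 3
    have "commutator T D \<in> P (Suc (i' + j'))"
    proof (rule P_SucI)
      show "commutator T D \<in> \<E>" using less.prems by (simp add: commutator_End P_End)
      fix u assume u: "u \<in> Cinf"
      have "commutator (ad u T) D \<in> P (i' + j')"
        using less.hyps[of i' j "ad u T" D] less.prems 3 u by (simp add: P_ad)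
      moreover have "commutator T (ad u D) \<in> P (i' + j')"
        using less.hyps[of i j' T "ad u D"] less.prems 3 u by (simp add: P_ad)
      ultimately show "ad u (commutator T D) \<in> P (i' + j')"
        using less.prems u by (simp add: ad_commutator P_End P_add)
    qed
    then show ?thesis using 3 by simp
  qed
qed

text \<open>The operators of order less than \<open>k\<close>, without any condition on the symbol; note the shift by one.\<close>

primrec G :: "nat \<Rightarrow> ('m, 'v) operator set" where
  "G 0 = {op_zero}"
| "G (Suc k) = {T \<in> \<E>. \<forall>u\<in>Cinf. ad u T \<in> G k}"

lemma G_End: "T \<in> G k \<Longrightarrow> T \<in> \<E>" by (cases k) (auto simp: op_zero_End)

lemma G_P: "T \<in> G k \<Longrightarrow> T \<in> P k"
  by (induction k arbitrary: T) (auto simp: P_zero intro: P_SucI)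

text \<open>With \<open>G_P\<close> this interlaces the two filtrations: zero is a multiplication,
  and multiplications are killed by every \<open>ad u\<close>.\<close>

lemma P_G: "T \<in> P k \<Longrightarrow> T \<in> G (Suc k)"
proof (induction k arbitrary: T)
  case 0 then show ?case by (auto simp: P_0 mu_End ad_mu)
next
  case (Suc k)
  then have "ad u T \<in> G (Suc k)" if "u \<in> Cinf" for u using that P_ad by blast
  then show ?case using P_End[OF Suc.prems] by simp
qed

lemma G_zero: "op_zero \<in> G k"
  by (induction k) (auto simp: op_zero_End ad_op_zero)

lemma G_add: "T \<in> G k \<Longrightarrow> D \<in> G k \<Longrightarrow> op_add T D \<in> G k"
  by (induction k arbitrary: T D) (auto simp: op_add_zero ad_op_add op_add_End)

lemma G_scale: "T \<in> G k \<Longrightarrow> op_scale r T \<in> G k"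
  by (induction k arbitrary: T) (auto simp: op_scale_zero ad_op_scale op_scale_End)

text \<open>In terms of orders, at most i - 1 and at most j - 1 compose to at most i + j - 2, which
  is the index i + j - 1 after the shift. The degree lost here makes products of square-zero symbols
  vanish. If an index is 0 the composition is zero, so truncated subtraction does no harm.\<close>

lemma G_comp: "T \<in> G i \<Longrightarrow> D \<in> G j \<Longrightarrow> T \<circ> D \<in> G (i + j - 1)"
proof (induction "i + j" arbitrary: i j T D rule: less_induct)
  case less
  consider "i = 0" | "j = 0" | i' j' where "i = Suc i'" "j = Suc j'" by (metis not0_implies_Suc)
  then show ?case
  proof cases
    case 1
    then have "T \<circ> D = op_zero" using less.prems by (simp add: zero_comp)
    then show ?thesis by (simp only: G_zero)
  next
    case 2
    then have "T \<circ> D = op_zero" using less.prems by (simp add: comp_zero G_End)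
    then show ?thesis by (simp only: G_zero)
  next
    case 3
    have "T \<circ> D \<in> G (Suc (i' + j'))"
      unfolding G.simps mem_Collect_eq
    proof (intro conjI ballI)
      show "T \<circ> D \<in> \<E>" using less.prems by (simp add: comp_End G_End del: G.simps)
      fix u assume u: "u \<in> Cinf"
      have "ad u T \<circ> D \<in> G (i' + j')" using less.hyps[of i' j "ad u T" D] less.prems 3 u by simp
      moreover have "T \<circ> ad u D \<in> G (i' + j')" using less.hyps[of i j' T "ad u D"] less.prems 3 u by simp
      ultimately show "ad u (T \<circ> D) \<in> G (i' + j')"
        using less.prems u by (simp add: ad_comp G_End G_add del: G.simps)
    qed
    then show ?thesis using 3 by simp
  qed
qed

declare G.simps [simp del]

lemma G_0: "T \<in> G 0 \<longleftrightarrow> T = op_zero" by (simp add: G.simps)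
lemma G_ad: "T \<in> G (Suc k) \<Longrightarrow> u \<in> Cinf \<Longrightarrow> ad u T \<in> G k" by (simp add: G.simps)
lemma G_SucI: "T \<in> \<E> \<Longrightarrow> (\<And>u. u \<in> Cinf \<Longrightarrow> ad u T \<in> G k) \<Longrightarrow> T \<in> G (Suc k)" by (simp add: G.simps)

text \<open>Take u = 1 - \<theta> with \<theta> supported where \<open>s\<close> vanishes and equal
  to 1 at \<open>x\<close>. Then u s = s and u(x) = 0, so [T, u] s and T s agree at
  \<open>x\<close>, and the commutator has a smaller index.\<close>

lemma G_local:
  assumes "T \<in> G k" "s \<in> \<Gamma>" "open V" "x \<in> V" "\<And>z. z \<in> V \<Longrightarrow> s z = 0"
  shows "T s x = 0"
  using assms(1)
proof (induction k arbitrary: T)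
  case 0 then show ?case by (simp add: G_0 op_apply)
next
  case (Suc k)
  obtain \<theta> N C where \<theta>: "\<theta> \<in> Cinf" "x \<in> N" "C \<subseteq> V" "\<And>z. z \<in> N \<Longrightarrow> \<theta> z = 1" "\<And>z. z \<notin> C \<Longrightarrow> \<theta> z = 0"
    by (rule bump_on_manifold[OF assms(3,4)]) blast
  define u where "u z = 1 - \<theta> z" for z
  have u: "u \<in> Cinf" unfolding u_def by (intro smooth_functions_diff smooth_functions_const \<theta>)
  have "(\<lambda>z. u z *\<^sub>R s z) = s"
  proof
    fix z show "u z *\<^sub>R s z = s z"
      using \<theta>(3) \<theta>(5)[of z] assms(5)[of z] by (cases "z \<in> C") (auto simp: u_def)
  qed
  moreover have "ad u T s x = 0" by (rule Suc.IH[OF G_ad[OF Suc.prems u]])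
  ultimately show ?case using ad_apply[OF G_End[OF Suc.prems] assms(2), of u] \<theta>(2,4) by (simp add: u_def)
qed

lemma G_local_eq:
  assumes "T \<in> G k" "s \<in> \<Gamma>" "s' \<in> \<Gamma>" "open V" "x \<in> V" "\<And>z. z \<in> V \<Longrightarrow> s z = s' z"
  shows "T s x = T s' x"
  using G_local[OF assms(1) section_diff[OF assms(2,3)] assms(4,5)] assms(6) End_diff[OF G_End[OF assms(1)] assms(2,3)]
  by simp

text \<open>By locality \<open>u\<close> may be replaced near \<open>x\<close> by the constant, and
  linear operators commute with constants.\<close>

lemma ad_locally_const:
  assumes "T \<in> G k" "u \<in> Cinf" "s \<in> \<Gamma>" "open V" "x \<in> V" "\<And>z. z \<in> V \<Longrightarrow> u z = r"
  shows "ad u T s x = 0"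
proof -
  have "T (\<lambda>z. u z *\<^sub>R s z) x = T (\<lambda>z. r *\<^sub>R s z) x"
    by (rule G_local_eq[OF assms(1) section_mult[OF assms(2,3)] section_scale[OF assms(3)] assms(4,5)])
      (simp add: assms(6))
  then show ?thesis using assms by (simp add: ad_apply[OF G_End[OF assms(1)]] End_scale[OF G_End[OF assms(1)]])
qed


section \<open>The symbol as an iterated commutator\<close>

text \<open>Dividing by \<open>Suc k\<close> at each level accumulates 1/k!, which absorbs the
  combinatorial factors of the Leibniz rule and makes the symbol multiplicative. In degree 0 the
  description is determined because some section is nonzero at \<open>x\<close>.\<close>

primrec symb :: "nat \<Rightarrow> ('m, 'v) operator \<Rightarrow> ('m \<Rightarrow> real) \<Rightarrow> 'm \<Rightarrow> real" where
  "symb 0 T u x = (THE w. \<forall>s\<in>\<Gamma>. T s x = w *\<^sub>R s x)"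
| "symb (Suc k) T u x = symb k (ad u T) u x / real (Suc k)"

lemma symb_mu: "symb 0 (mu w) u x = w x"
  unfolding symb.simps
proof (rule the_equality)
  show "\<forall>s\<in>\<Gamma>. mu w s x = w x *\<^sub>R s x" by (simp add: mu_apply)
  fix r assume *: "\<forall>s\<in>\<Gamma>. mu w s x = r *\<^sub>R s x"
  obtain s where s: "s \<in> \<Gamma>" "s x \<noteq> 0" by (rule nonvanishing_section)
  have "mu w s x = r *\<^sub>R s x" using * s(1) by (rule bspec)
  then show "r = w x" using s by (simp add: mu_apply)
qed

lemma symb_0_eq: "T \<in> P 0 \<Longrightarrow> s \<in> \<Gamma> \<Longrightarrow> T s x = symb 0 T u x *\<^sub>R s x"
  by (auto simp: P_0 mu_apply symb_mu simp del: symb.simps)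

lemma symb_zero: "u \<in> Cinf \<Longrightarrow> symb k op_zero u x = 0"
proof (induction k)
  case 0 show ?case using symb_mu[of "\<lambda>x. 0"] by (simp add: mu_zero)
qed (simp add: ad_op_zero)

lemma symb_add:
  "T \<in> P k \<Longrightarrow> D \<in> P k \<Longrightarrow> u \<in> Cinf \<Longrightarrow> symb k (op_add T D) u x = symb k T u x + symb k D u x"
proof (induction k arbitrary: T D)
  case 0
  then obtain v w where *: "v \<in> Cinf" "w \<in> Cinf" "T = mu v" "D = mu w" by (auto simp: P_0)
  then have "op_add T D = mu (\<lambda>x. v x + w x)"
    by (auto simp: mult_op_def op_add_def fun_eq_iff scaleR_add_left)
  then show ?case using * by (simp add: symb_mu del: symb.simps)
next
  case (Suc k)
  then show ?case by (simp add: ad_op_add P_End P_ad add_divide_distrib)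
qed

lemma symb_scale: "T \<in> P k \<Longrightarrow> u \<in> Cinf \<Longrightarrow> symb k (op_scale r T) u x = r * symb k T u x"
proof (induction k arbitrary: T)
  case 0
  then obtain v where *: "v \<in> Cinf" "T = mu v" by (auto simp: P_0)
  then have "op_scale r T = mu (\<lambda>x. r * v x)"
    by (auto simp: mult_op_def op_scale_def fun_eq_iff)
  then show ?case using * by (simp add: symb_mu del: symb.simps)
next
  case (Suc k)
  then show ?case by (simp add: ad_op_scale P_End P_ad)
qed

text \<open>Homogeneity of degree k; it later separates the degrees inside a sum of symbols.\<close>

lemma symb_scale_fun: "T \<in> P k \<Longrightarrow> u \<in> Cinf \<Longrightarrow> symb k T (\<lambda>x. r * u x) x = r ^ k * symb k T u x"
proof (induction k arbitrary: T)
  case 0 then show ?case by simp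
next
  case (Suc k)
  then show ?case
    by (simp add: ad_scale_fun P_End P_ad symb_scale smooth_functions_scale)
qed

text \<open>The two Leibniz terms contribute j and i times the product of the symbols, because
  passing from a degree to the one below undoes the division by that degree. Their sum i + j cancels
  against the divisor of the total degree.\<close>

lemma symb_comp:
  "T \<in> P i \<Longrightarrow> D \<in> P j \<Longrightarrow> u \<in> Cinf \<Longrightarrow> symb (i + j) (T \<circ> D) u x = symb i T u x * symb j D u x"
proof (induction "i + j" arbitrary: i j T D)
  case 0
  then obtain v w where *: "v \<in> Cinf" "w \<in> Cinf" "T = mu v" "D = mu w" by (auto simp: P_0)
  then show ?case using 0 by (simp add: mu_comp symb_mu del: symb.simps)
next
  case (Suc m)
  have TE: "T \<in> \<E>" "D \<in> \<E>" using Suc.prems P_End by auto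
  have 1: "T \<circ> ad u D \<in> P m \<and> symb m (T \<circ> ad u D) u x = real j * (symb i T u x * symb j D u x)"
  proof (cases j)
    case 0
    then have "ad u D = op_zero" using Suc.prems by (auto simp: P_0 ad_mu)
    then show ?thesis using 0 comp_zero[OF TE(1)] Suc.prems(3) by (simp add: P_zero symb_zero)
  next
    case (Suc j')
    have D: "ad u D \<in> P j'" using Suc Suc.prems P_ad by blast
    have m: "m = i + j'" using Suc Suc.hyps(2) by simp
    show ?thesis using Suc.hyps(1)[OF m Suc.prems(1) D Suc.prems(3)] P_comp[OF Suc.prems(1) D] m Suc
      by simp
  qed
  have 2: "ad u T \<circ> D \<in> P m \<and> symb m (ad u T \<circ> D) u x = real i * (symb i T u x * symb j D u x)"
  proof (cases i)
    case 0
    then have "ad u T = op_zero" using Suc.prems by (auto simp: P_0 ad_mu)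
    then show ?thesis using 0 Suc.prems(3) by (simp add: zero_comp P_zero symb_zero)
  next
    case (Suc i')
    have D: "ad u T \<in> P i'" using Suc Suc.prems P_ad by blast
    have m: "m = i' + j" using Suc Suc.hyps(2) by simp
    show ?thesis using Suc.hyps(1)[OF m D Suc.prems(2,3)] P_comp[OF D Suc.prems(2)] m Suc by simp
  qed
  have "symb (Suc m) (T \<circ> D) u x = (symb m (T \<circ> ad u D) u x + symb m (ad u T \<circ> D) u x) / real (Suc m)"
    using 1 2 Suc.prems TE by (simp add: ad_comp symb_add)
  also have "\<dots> = (real (i + j) * (symb i T u x * symb j D u x)) / real (i + j)"
    using 1 2 Suc.hyps(2) by (simp add: algebra_simps)
  finally show ?case using Suc.hyps(2) by simp
qed

text \<open>Polarization: the values of the symbol of \<open>T\<close> determine those of all \<open>ad v T\<close>, although its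
  definition only involves equal arguments.\<close>

lemma symb_deriv:
  assumes "T \<in> P k" "u \<in> Cinf" "v \<in> Cinf"
  shows "((\<lambda>r. symb k T (\<lambda>x. u x + r * v x) x) has_real_derivative
     (if k = 0 then 0 else symb (k - 1) (ad v T) u x)) (at 0)"
  using assms(1)
proof (induction k arbitrary: T)
  case 0 show ?case by simp
next
  case (Suc k)
  let ?w = "\<lambda>r x. u x + r * v x"
  have w: "?w r \<in> Cinf" for r by (intro smooth_functions_add smooth_functions_scale assms)
  have TE: "T \<in> \<E>" by (rule P_End[OF Suc.prems])
  have P: "ad u T \<in> P k" "ad v T \<in> P k" using Suc.prems P_ad assms by auto
  have eq: "symb (Suc k) T (?w r) x = (symb k (ad u T) (?w r) x + r * symb k (ad v T) (?w r) x) / real (Suc k)" for r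
    using P by (simp add: ad_add_fun ad_scale_fun TE assms smooth_functions_scale symb_add symb_scale P_scale w)
  \<comment> \<open>Only differentiability of this factor matters: it is multiplied by r, so its
    derivative disappears at r = 0.\<close>
  obtain d where d: "((\<lambda>r. symb k (ad v T) (?w r) x) has_real_derivative d) (at 0)"
    using Suc.IH[OF P(2)] by blast
  have "((\<lambda>r. symb (Suc k) T (?w r) x) has_real_derivative
     ((if k = 0 then 0 else symb (k - 1) (ad v (ad u T)) u x) + symb k (ad v T) u x) / real (Suc k)) (at 0)"
    unfolding eq
    by (rule derivative_eq_intros Suc.IH[OF P(1)] d refl | simp)+
  moreover have "(if k = 0 then 0 else symb (k - 1) (ad v (ad u T)) u x) = real k * symb k (ad v T) u x"
    using ad_commute[OF TE assms(3,2)] by (cases k) simp_all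
  then have "((if k = 0 then 0 else symb (k - 1) (ad v (ad u T)) u x) + symb k (ad v T) u x) / real (Suc k)
      = symb k (ad v T) u x" by (simp add: field_simps)
  ultimately show ?case by simp
qed

text \<open>If the symbol vanishes for all arguments, so does its derivative in direction
  \<open>v\<close>, which by \<open>symb_deriv\<close> is the symbol of \<open>ad v T\<close>; the
  induction hypothesis then applies to every such commutator.\<close>

lemma symb_eq_0_iff:
  assumes "T \<in> P k"
  shows "(\<forall>u\<in>Cinf. \<forall>x. symb k T u x = 0) \<longleftrightarrow> T \<in> G k"
  using assms
proof (induction k arbitrary: T)
  case 0
  then obtain w where w: "w \<in> Cinf" "T = mu w" by (auto simp: P_0)
  have "(\<forall>u\<in>Cinf. \<forall>x. symb 0 T u x = 0) \<longleftrightarrow> w = (\<lambda>x. 0)"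
    unfolding w(2) symb_mu using w(1) by (auto simp: fun_eq_iff)
  also have "\<dots> \<longleftrightarrow> T \<in> G 0"
    unfolding G_0 w(2) mu_zero[symmetric] using symb_mu by (metis ext)
  finally show ?case .
next
  case (Suc k)
  have *: "(\<forall>u\<in>Cinf. \<forall>x. symb k (ad v T) u x = 0) \<longleftrightarrow> ad v T \<in> G k" if "v \<in> Cinf" for v
    by (rule Suc.IH[OF P_ad[OF Suc.prems that]])
  show ?case
  proof
    assume z: "\<forall>u\<in>Cinf. \<forall>x. symb (Suc k) T u x = 0"
    show "T \<in> G (Suc k)"
    proof (rule G_SucI[OF P_End[OF Suc.prems]])
      fix v assume v: "v \<in> Cinf"
      have "symb k (ad v T) u x = 0" if u: "u \<in> Cinf" for u x
      proof -
        have "(\<lambda>r. symb (Suc k) T (\<lambda>x. u x + r * v x) x) = (\<lambda>r. 0)"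
          using z u v by (intro ext) (simp add: smooth_functions_add smooth_functions_scale del: symb.simps)
        with symb_deriv[OF Suc.prems u v, of x]
        have "((\<lambda>r. 0) has_real_derivative symb k (ad v T) u x) (at 0)" by (simp del: symb.simps)
        then show ?thesis using DERIV_unique[OF _ DERIV_const] by blast
      qed
      then show "ad v T \<in> G k" using *[OF v] by blast
    qed
  next
    assume "T \<in> G (Suc k)"
    then show "\<forall>u\<in>Cinf. \<forall>x. symb (Suc k) T u x = 0" using * G_ad by simp
  qed
qed

end

section \<open>Local expressions of operators\<close>

lemma multi_indices_upto_eq: "multi_indices_upto (int k - 1) = {\<alpha>. set \<alpha> \<subseteq> coord_basis \<and> length \<alpha> < k}"
  by (auto simp: multi_indices_upto_def)

text \<open>Reassembles a matrix from its columns, so that smoothness can be checked column by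
  column.\<close>

lemma matrix_sum_columns:
  fixes M :: "real^'n^'n"
  shows "M = (\<Sum>i\<in>UNIV. (\<chi> j i'. if i' = i then (M *v axis i 1) $ j else 0))"
  by (simp add: vec_eq_iff matrix_vector_mult_basis column_def if_distrib cong: if_cong)

lemma bounded_linear_column: "bounded_linear (\<lambda>v::real^'n. (\<chi> j i'. if i' = i then v $ j else 0) :: real^'n^'n)"
  unfolding linear_conv_bounded_linear[symmetric]
  by (rule linearI) (simp_all add: vec_eq_iff)

context vector_bundle begin

lemma finite_coord_basis: "finite (coord_basis :: 'b set)"
  using coord_basis by (simp add: is_coord_basis_def)

lemma finite_multi_indices: "finite (multi_indices_upto r :: 'b list set)" "finite (multi_indices r :: 'b list set)"
proof -
  have "finite {\<alpha>::'b list. set \<alpha> \<subseteq> coord_basis \<and> length \<alpha> \<le> nat r}"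
    by (rule finite_lists_length_le[OF finite_coord_basis])
  then show "finite (multi_indices_upto r :: 'b list set)" "finite (multi_indices r :: 'b list set)"
    by (rule finite_subset[rotated]; auto simp: multi_indices_upto_def multi_indices_def)+
qed

lemma loc_0: "t \<in> L \<Longrightarrow> x \<in> fst t \<Longrightarrow> loc t (\<lambda>x. 0) x = 0"
  using triv_inv[of t x 0] linear_0[OF triv_linear[of t x]] by (simp add: local_section_def)

lemma loc_sum:
  assumes "t \<in> L" "x \<in> fst t" "finite I" "\<And>i. i \<in> I \<Longrightarrow> s i \<in> \<Gamma>"
  shows "loc t (\<lambda>x. \<Sum>i\<in>I. s i x) x = (\<Sum>i\<in>I. loc t (s i) x)"
  using assms(3,4)
proof (induction I)
  case (insert i I)
  have "(\<Sum>i\<in>I. s i x) \<in> E x" by (rule subspace_sum[OF fiber_subspace]) (use insert section_fiber in blast)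
  then have "loc t (\<lambda>x. s i x + (\<Sum>i\<in>I. s i x)) x = loc t (s i) x + loc t (\<lambda>x. \<Sum>i\<in>I. s i x) x"
    by (intro loc_add assms) (use insert.prems section_fiber in auto)
  then show ?case using insert by simp
qed (simp add: loc_0 assms)

lemma G_Suc: "T \<in> G k \<Longrightarrow> T \<in> G (Suc k)"
  by (rule P_G[OF G_P])

lemma G_ad_same: "T \<in> G k \<Longrightarrow> u \<in> Cinf \<Longrightarrow> ad u T \<in> G k"
  by (rule G_ad[OF G_Suc])

text \<open>A coordinate function made global by a cutoff. The free constant allows it to vanish at
  a chosen point.\<close>

lemma cutoff_coordinate:
  assumes "c \<in> A" "open W" "W \<subseteq> fst c" "x \<in> W"
  obtains u N where "u \<in> Cinf" "open N" "x \<in> N" "N \<subseteq> W" "\<And>z. z \<in> N \<Longrightarrow> u z = snd c z \<bullet> b + r"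
proof -
  obtain \<theta> N C where \<theta>: "\<theta> \<in> Cinf" "open N" "closed C" "x \<in> N" "N \<subseteq> C" "C \<subseteq> W"
    "\<And>z. z \<in> N \<Longrightarrow> \<theta> z = 1" "\<And>z. z \<notin> C \<Longrightarrow> \<theta> z = 0"
    by (rule bump_on_manifold[OF assms(2,4)]) blast
  have "smooth_map_on A W (\<lambda>z. \<theta> z * (snd c z \<bullet> b + r))"
    using \<theta>(1) assms(2,3)
    by (intro smooth_map_mult smooth_map_add smooth_map_const smooth_map_linear_outer[OF _ bounded_linear_inner_left]
        smooth_map_subset[OF smooth_map_coord[OF assms(1)]]) (auto simp: smooth_functions_iff intro: smooth_map_subset)
  then have "(\<lambda>z. \<theta> z * (snd c z \<bullet> b + r)) \<in> Cinf"
    unfolding smooth_functions_iff by (rule smooth_map_extend[OF _ assms(2) \<theta>(3,6)]) (simp add: \<theta>(8))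
  then show ?thesis using that[of "\<lambda>z. \<theta> z * (snd c z \<bullet> b + r)" N] \<theta> by auto
qed

text \<open>The additive constant is left open because commutators do not see locally constant
  functions.\<close>

definition coordinate_germ :: "('m, 'b) chart \<Rightarrow> 'b \<Rightarrow> 'm \<Rightarrow> ('m \<Rightarrow> real) \<Rightarrow> bool" where
  "coordinate_germ c b x u \<longleftrightarrow> u \<in> Cinf \<and>
     (\<exists>V r. open V \<and> x \<in> V \<and> (\<forall>z\<in>V. u z = snd c z \<bullet> b + r))"

definition frame_germ :: "('m, 'n, 'v) triv \<Rightarrow> (real, 'n) vec \<Rightarrow> 'm \<Rightarrow> ('m \<Rightarrow> 'v) \<Rightarrow> bool" where
  "frame_germ t w x s \<longleftrightarrow> s \<in> \<Gamma> \<and> (\<exists>V. open V \<and> x \<in> V \<and> (\<forall>z\<in>V. s z = snd t z w))"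

text \<open>The coefficients of a local expression; the multi-index is reversed, so that the innermost
  derivative comes first.\<close>

primrec coef :: "('m, 'b) chart \<Rightarrow> ('m, 'n, 'v) triv \<Rightarrow> 'b list \<Rightarrow> ('m, 'v) operator \<Rightarrow> 'm \<Rightarrow> ((real, 'n) vec, 'n) vec" where
  "coef c t [] T x = (\<chi> j i. loc t (T (SOME s. frame_germ t (axis i 1) x s)) x $ j)"
| "coef c t (b # \<alpha>) T x =
     (1 / (real (length \<alpha>) + 1)) *\<^sub>R coef c t \<alpha> (ad (SOME u. coordinate_germ c b x u) T) x"

lemma coordinate_germ_exists:
  assumes "c \<in> A" "x \<in> fst c" obtains u where "coordinate_germ c b x u"
proof -
  obtain u N where "u \<in> Cinf" "open N" "x \<in> N" "\<And>z. z \<in> N \<Longrightarrow> u z = snd c z \<bullet> b + 0"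
    by (rule cutoff_coordinate[OF assms(1) chart_open[OF assms(1)] order_refl assms(2)]) blast
  then have "coordinate_germ c b x u" unfolding coordinate_germ_def by blast
  then show ?thesis by (rule that)
qed

lemma frame_germ_exists:
  assumes "t \<in> L" "open W" "W \<subseteq> fst t" "x \<in> W" "smooth_map_on A W w"
  obtains s N where "s \<in> \<Gamma>" "open N" "x \<in> N" "N \<subseteq> W" "\<And>z. z \<in> N \<Longrightarrow> s z = snd t z (w z)"
proof -
  obtain \<theta> N C where \<theta>: "\<theta> \<in> Cinf" "open N" "closed C" "x \<in> N" "N \<subseteq> C" "C \<subseteq> W"
    "\<And>z. z \<in> N \<Longrightarrow> \<theta> z = 1" "\<And>z. z \<notin> C \<Longrightarrow> \<theta> z = 0"
    by (rule bump_on_manifold[OF assms(2,4)]) blast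
  have "smooth_map_on A W (\<lambda>z. \<theta> z *\<^sub>R w z)"
    by (intro smooth_map_scaleR assms smooth_map_subset[OF \<theta>(1)[unfolded smooth_functions_iff]]) simp
  then have "frame_section t C (\<lambda>z. \<theta> z *\<^sub>R w z) \<in> \<Gamma>"
    by (rule frame_section_in[OF assms(1,2,3) \<theta>(3,6)]) (simp add: \<theta>(8))
  moreover have "frame_section t C (\<lambda>z. \<theta> z *\<^sub>R w z) z = snd t z (w z)" if "z \<in> N" for z
    using \<theta>(5,7) that by (auto simp: frame_section_def)
  ultimately show ?thesis using that[of _ N] \<theta> by blast
qed

text \<open>Near \<open>x\<close> the section is the combination of the chosen frame germs with
  constant weights, so locality and linearity give the value. Hence the choice of the germs in
  \<open>coef\<close> has no influence.\<close>

lemma coef_Nil: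
  assumes T: "T \<in> G k" and t: "t \<in> L" "x \<in> fst t" and s: "s \<in> \<Gamma>" "open V" "x \<in> V" "\<And>z. z \<in> V \<Longrightarrow> s z = snd t z w"
  shows "loc t (T s) x = coef c t [] T x *v w"
proof -
  have TE: "T \<in> \<E>" by (rule G_End[OF T])
  define \<sigma> where "\<sigma> i = (SOME s. frame_germ t (axis i 1) x s)" for i
  have "\<exists>s. frame_germ t (axis i 1) x s" for i
  proof -
    obtain s N where "s \<in> \<Gamma>" "open N" "x \<in> N" "\<And>z. z \<in> N \<Longrightarrow> s z = snd t z (axis i 1)"
      by (rule frame_germ_exists[OF t(1) triv_open[OF t(1)] order_refl t(2) smooth_map_const[of _ "axis i 1"]]) blast
    then show ?thesis unfolding frame_germ_def by blast
  qed
  then have "frame_germ t (axis i 1) x (\<sigma> i)" for i unfolding \<sigma>_def by (rule someI_ex)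
  then have \<sigma>: "\<sigma> i \<in> \<Gamma>" "\<exists>V. open V \<and> x \<in> V \<and> (\<forall>z\<in>V. \<sigma> i z = snd t z (axis i 1))" for i
    by (simp_all add: frame_germ_def)
  obtain U where U: "\<And>i. open (U i)" "\<And>i. x \<in> U i" "\<And>i z. z \<in> U i \<Longrightarrow> \<sigma> i z = snd t z (axis i 1)"
    using \<sigma>(2) by metis
  define s' where "s' z = (\<Sum>i\<in>UNIV. w $ i *\<^sub>R \<sigma> i z)" for z
  have s': "s' \<in> \<Gamma>" "T s' = (\<lambda>x. \<Sum>i\<in>UNIV. T (\<lambda>z. w $ i *\<^sub>R \<sigma> i z) x)"
    using End_sum[OF TE finite_class.finite_UNIV, of "\<lambda>i z. w $ i *\<^sub>R \<sigma> i z"] section_scale[OF \<sigma>(1)] by (auto simp: s'_def[abs_def])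
  have "T s x = T s' x"
  proof (rule G_local_eq[OF T s(1) s'(1)])
    show "open (V \<inter> (\<Inter>i. U i) \<inter> fst t)" using s(2) U(1) triv_open[OF t(1)] by (intro open_Int open_INT) auto
    show "x \<in> V \<inter> (\<Inter>i. U i) \<inter> fst t" using s U t by blast
    fix z assume z: "z \<in> V \<inter> (\<Inter>i. U i) \<inter> fst t"
    have lin: "linear (snd t z)" using triv_linear[OF t(1)] z by blast
    have "(\<Sum>i\<in>UNIV. w $ i *\<^sub>R axis i 1) = w" by (simp add: vec_eq_iff axis_def if_distrib cong: if_cong)
    then have "snd t z w = snd t z (\<Sum>i\<in>UNIV. w $ i *\<^sub>R axis i 1)" by simp
    also have "\<dots> = (\<Sum>i\<in>UNIV. w $ i *\<^sub>R snd t z (axis i 1))" by (simp add: linear_sum[OF lin] linear_scale[OF lin])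
    finally show "s z = s' z" using z s(4) U(3) by (auto simp: s'_def intro!: sum.cong)
  qed
  then have "loc t (T s) x = loc t (T s') x" by (simp add: local_section_def)
  also have "\<dots> = (\<Sum>i\<in>UNIV. loc t (T (\<lambda>z. w $ i *\<^sub>R \<sigma> i z)) x)"
    unfolding s'(2) by (rule loc_sum[OF t]) (auto intro: End_closed[OF TE] section_scale \<sigma>)
  also have "\<dots> = (\<Sum>i\<in>UNIV. w $ i *\<^sub>R loc t (T (\<sigma> i)) x)"
  proof (rule sum.cong[OF refl])
    fix i
    show "loc t (T (\<lambda>z. w $ i *\<^sub>R \<sigma> i z)) x = w $ i *\<^sub>R loc t (T (\<sigma> i)) x"
      unfolding End_scale[OF TE \<sigma>(1)] by (rule loc_scale[where s = "T (\<sigma> i)" and u = "\<lambda>_. w $ i", OF t])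
        (rule section_fiber[OF End_closed[OF TE \<sigma>(1)]])
  qed
  also have "\<dots> = coef c t [] T x *v w"
    by (simp add: vec_eq_iff matrix_vector_mult_def \<sigma>_def mult.commute)
  finally show ?thesis .
qed

text \<open>The coefficients at \<open>x\<close> are built from values near \<open>x\<close> only.
  This is what permits changing the coordinate function chosen in \<open>coef\<close>.\<close>

lemma coef_germ:
  assumes "T \<in> G k" "T' \<in> G k" "c \<in> A" "x \<in> fst c" "open V" "x \<in> V"
    "\<And>s z. s \<in> \<Gamma> \<Longrightarrow> z \<in> V \<Longrightarrow> T s z = T' s z" "t \<in> L" "x \<in> fst t"
  shows "coef c t \<alpha> T x = coef c t \<alpha> T' x"
  using assms(1,2,7)
proof (induction \<alpha> arbitrary: T T')
  case Nil
  have "\<exists>s. frame_germ t (axis i 1) x s" for i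
  proof -
    obtain s N where "s \<in> \<Gamma>" "open N" "x \<in> N" "\<And>z. z \<in> N \<Longrightarrow> s z = snd t z (axis i 1)"
      by (rule frame_germ_exists[OF assms(8) triv_open[OF assms(8)] order_refl assms(9) smooth_map_const[of _ "axis i 1"]]) blast
    then show ?thesis unfolding frame_germ_def by blast
  qed
  then have "(SOME s. frame_germ t (axis i 1) x s) \<in> \<Gamma>" for i
    using someI_ex[of "frame_germ t (axis i 1) x"] by (simp add: frame_germ_def)
  then show ?case using Nil.prems(3) assms(6) by (simp add: local_section_def)
next
  case (Cons b \<alpha>)
  define u where "u = (SOME u. coordinate_germ c b x u)"
  have "\<exists>u. coordinate_germ c b x u" using coordinate_germ_exists[OF assms(3,4)] by metis
  then have "coordinate_germ c b x u" unfolding u_def by (rule someI_ex)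
  then have u: "u \<in> Cinf" by (simp add: coordinate_germ_def)
  have "coef c t \<alpha> (ad u T) x = coef c t \<alpha> (ad u T') x"
  proof (rule Cons.IH)
    show "ad u T s z = ad u T' s z" if "s \<in> \<Gamma>" "z \<in> V" for s z
      using Cons.prems(3)[OF section_mult[OF u that(1)] that(2)] Cons.prems(3)[OF that]
      by (simp add: ad_apply[OF G_End[OF Cons.prems(1)] that(1)] ad_apply[OF G_End[OF Cons.prems(2)] that(1)])
  qed (intro G_ad_same Cons.prems u)+
  then show ?case by (simp add: u_def)
qed

text \<open>Two admissible coordinate functions differ near \<open>x\<close> by a constant, so their
  commutators with \<open>T\<close> agree near \<open>x\<close>, and \<open>coef_germ\<close>
  applies.\<close>

lemma coef_Cons:
  assumes T: "T \<in> G k" and c: "c \<in> A" "x \<in> fst c" and t: "t \<in> L" "x \<in> fst t"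
    and u: "u \<in> Cinf" and V: "open V" "x \<in> V" "\<And>z. z \<in> V \<Longrightarrow> u z = snd c z \<bullet> b + r"
  shows "coef c t (b # \<alpha>) T x = (1 / (real (length \<alpha>) + 1)) *\<^sub>R coef c t \<alpha> (ad u T) x"
proof -
  define u0 where "u0 = (SOME u. coordinate_germ c b x u)"
  have "\<exists>u. coordinate_germ c b x u" using coordinate_germ_exists[OF c] by metis
  then have "coordinate_germ c b x u0" unfolding u0_def by (rule someI_ex)
  then obtain V0 r0 where u0: "u0 \<in> Cinf" "open V0" "x \<in> V0" "\<And>z. z \<in> V0 \<Longrightarrow> u0 z = snd c z \<bullet> b + r0"
    by (auto simp: coordinate_germ_def)
  have d: "(\<lambda>z. u0 z - u z) \<in> Cinf" by (intro smooth_functions_diff u u0)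
  have "coef c t \<alpha> (ad u0 T) x = coef c t \<alpha> (ad u T) x"
  proof (rule coef_germ[OF G_ad_same[OF T u0(1)] G_ad_same[OF T u] c])
    show "open (V \<inter> V0)" "x \<in> V \<inter> V0" using V u0 by auto
    fix s z assume s: "s \<in> \<Gamma>" and z: "z \<in> V \<inter> V0"
    have "ad (\<lambda>z. u z + (u0 z - u z)) T s z = ad u T s z + ad (\<lambda>z. u0 z - u z) T s z"
      by (simp only: ad_add_fun[OF G_End[OF T] u d] op_add_apply)
    moreover have "ad (\<lambda>z. u0 z - u z) T s z = 0"
      by (rule ad_locally_const[OF T d s \<open>open (V \<inter> V0)\<close> z, of "r0 - r"]) (use V u0 in auto)
    ultimately show "ad u0 T s z = ad u T s z" by simp
  qed (fact t)+
  then show ?thesis by (simp add: u0_def)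
qed

text \<open>The definition makes a new choice at every point, which hides smoothness. Near a given
  point, however, one fixed section or coordinate function serves all neighbouring points at
  once.\<close>

lemma coef_smooth:
  assumes "T \<in> G k" "c \<in> A" "t \<in> L"
  shows "smooth_map_on A (fst c \<inter> fst t) (coef c t \<alpha> T)"
  using assms(1)
proof (induction \<alpha> arbitrary: T)
  let ?W = "fst c \<inter> fst t"
  have oW: "open ?W" using chart_open[OF assms(2)] triv_open[OF assms(3)] by (rule open_Int)
  case Nil
  have TE: "T \<in> \<E>" by (rule G_End[OF Nil])
  show ?case
  proof (rule smooth_map_local)
    fix x assume x: "x \<in> ?W"
    have "\<exists>s N. s \<in> \<Gamma> \<and> open N \<and> x \<in> N \<and> (\<forall>z\<in>N. s z = snd t z (axis i 1))" for i
      using frame_germ_exists[OF assms(3) oW _ x smooth_map_const[of _ "axis i 1"]] by (metis inf_le2)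
    then obtain s N where s: "\<And>i. s i \<in> \<Gamma>" "\<And>i. open (N i)" "\<And>i. x \<in> N i"
      "\<And>i z. z \<in> N i \<Longrightarrow> s i z = snd t z (axis i 1)" by metis
    define V where "V = ?W \<inter> (\<Inter>i. N i)"
    have V: "open V" "x \<in> V" unfolding V_def using oW s x by (auto intro!: open_Int open_INT)
    have "smooth_map_on A V (\<lambda>z. \<Sum>i\<in>UNIV. (\<chi> j i'. if i' = i then loc t (T (s i)) z $ j else 0))"
      by (intro smooth_map_sum V smooth_map_linear_outer[OF _ bounded_linear_column]
          smooth_map_subset[OF loc_smooth[OF End_closed[OF TE s(1)] assms(3)]]) (simp add: V_def le_infI1)
    then have "smooth_map_on A V (coef c t [] T)"
    proof (rule smooth_map_eqI[OF _ V(1)])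
      fix z assume z: "z \<in> V"
      have "loc t (T (s i)) z = coef c t [] T z *v axis i 1" for i
        by (rule coef_Nil[OF Nil assms(3) _ s(1,2)]) (use z s in \<open>auto simp: V_def\<close>)
      then show "(\<Sum>i\<in>UNIV. (\<chi> j i'. if i' = i then loc t (T (s i)) z $ j else 0)) = coef c t [] T z"
        by (simp only: matrix_sum_columns[symmetric])
    qed
    then show "\<exists>V. open V \<and> x \<in> V \<and> smooth_map_on A V (coef c t [] T)" using V by blast
  qed
next
  let ?W = "fst c \<inter> fst t"
  have oW: "open ?W" using chart_open[OF assms(2)] triv_open[OF assms(3)] by (rule open_Int)
  case (Cons b \<alpha>)
  show ?case
  proof (rule smooth_map_local)
    fix x assume x: "x \<in> ?W"
    obtain u N where u: "u \<in> Cinf" "open N" "x \<in> N" "N \<subseteq> ?W" "\<And>z. z \<in> N \<Longrightarrow> u z = snd c z \<bullet> b + 0"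
      by (rule cutoff_coordinate[OF assms(2) oW inf_le1 x]) blast
    have "smooth_map_on A N (\<lambda>z. (1 / (real (length \<alpha>) + 1)) *\<^sub>R coef c t \<alpha> (ad u T) z)"
      by (intro smooth_map_scaleR smooth_map_const u smooth_map_subset[OF Cons.IH[OF G_ad_same[OF Cons.prems u(1)]]])
    then have "smooth_map_on A N (coef c t (b # \<alpha>) T)"
      by (rule smooth_map_eqI[OF _ u(2)])
        (rule coef_Cons[OF Cons.prems assms(2) _ assms(3) _ u(1,2) _ u(5), symmetric]; use u(4) in blast)
    then show "\<exists>V. open V \<and> x \<in> V \<and> smooth_map_on A V (coef c t (b # \<alpha>) T)" using u by blast
  qed
qed

lemma chart_preimage_open:
  assumes "c \<in> A" "open S" shows "open (fst c \<inter> snd c -` S)"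
  using continuous_open_preimage[OF _ chart_open[OF assms(1)] assms(2)] chart_homeomorphism[OF assms(1)]
  by (auto simp: homeomorphism_def)

lemma loc_chart_smooth:
  assumes "c \<in> A" "t \<in> L" "s \<in> \<Gamma>"
  shows "smooth_on (snd c ` (fst c \<inter> fst t)) (loc t s \<circ> chart_inv c)"
  using smooth_map_onD[OF loc_smooth[OF assms(3,2)] assms(1)] by (simp add: o_def)

text \<open>By Hadamard's lemma a section is near \<open>x\<close> the sum of a constant section and of products
  \<open>u\<^sub>b G\<^sub>b\<close> with \<open>u\<^sub>b\<close> vanishing at \<open>x\<close>, and \<open>T\<close> maps \<open>u\<^sub>b G\<^sub>b\<close> to \<open>[T, u\<^sub>b] G\<^sub>b\<close> at \<open>x\<close>.\<close>

lemma local_expansion: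
  assumes "T \<in> G k" "s \<in> \<Gamma>" "c \<in> A" "t \<in> L" "x \<in> fst c" "x \<in> fst t"
  shows "loc t (T s) x = (\<Sum>\<alpha> | set \<alpha> \<subseteq> coord_basis \<and> length \<alpha> < k.
     coef c t (rev \<alpha>) T x *v iterated_derivative \<alpha> (loc t s \<circ> chart_inv c) (snd c x))"
  using assms(1,2)
proof (induction k arbitrary: T s)
  case 0
  then show ?case by (simp add: G_0 op_apply loc_0 assms)
next
  case (Suc k)
  let ?B = "coord_basis :: 'b set"
  let ?W = "fst c \<inter> fst t"
  define y where "y = snd c x"
  define f where "f = loc t s \<circ> chart_inv c"
  have TE: "T \<in> \<E>" by (rule G_End[OF Suc.prems(1)])
  have oW: "open ?W" using chart_open[OF assms(3)] triv_open[OF assms(4)] by (rule open_Int)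
  have cx: "chart_inv c y = x" using assms by (simp add: y_def)
  have "open (snd c ` ?W)" "y \<in> snd c ` ?W" using chart_image_open[OF assms(3) triv_open[OF assms(4)]] assms
    by (auto simp: y_def)
  then obtain \<rho> where \<rho>: "\<rho> > 0" "ball y \<rho> \<subseteq> snd c ` ?W" by (meson openE)
  define S where "S = ball y \<rho>"
  interpret open_starlike S y ?B
  proof
    show "open S" "y \<in> S" using \<rho>(1) by (auto simp: S_def)
    show "is_coord_basis ?B" by (rule coord_basis)
    fix z and r :: real assume z: "z \<in> S" and r: "r \<in> {0..1}"
    have "dist y (y + r *\<^sub>R (z - y)) = r * dist y z" using r by (simp add: dist_norm norm_minus_commute)
    also have "\<dots> \<le> 1 * dist y z" using r by (intro mult_right_mono) auto
    finally show "y + r *\<^sub>R (z - y) \<in> S" using z by (simp add: S_def)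
  qed
  have fS: "smooth_on S f" unfolding f_def S_def
    by (rule smooth_on_subset[OF loc_chart_smooth[OF assms(3,4) Suc.prems(2)] \<rho>(2)])
  define g where "g b = ray_mean y 0 (\<lambda>p. frechet_derivative f (at p) b)" for b
  have gS: "smooth_on S (g b)" for b unfolding g_def by (rule ray_mean_smooth[OF smooth_on_derivative[OF fS]])
  define W' where "W' = ?W \<inter> (fst c \<inter> snd c -` S)"
  have W': "open W'" "W' \<subseteq> fst c" "W' \<subseteq> fst t" "x \<in> W'"
    unfolding W'_def using oW chart_preimage_open[OF assms(3) open_S] assms x_S by (auto simp: y_def intro: open_Int)
  have gW: "smooth_map_on A W' (\<lambda>z. g b (snd c z))" for b
  proof (rule smooth_map_chart[OF assms(3) W'(1,2)])
    have o: "open (snd c ` W')" using chart_image_open[OF assms(3) W'(1)] W'(2) by (simp add: Int_absorb1)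
    show "smooth_on (snd c ` W') (\<lambda>p. g b (snd c (chart_inv c p)))"
      by (rule smooth_on_eqI[OF smooth_on_subset[OF gS] o]) (use W'(2) assms(3) in \<open>auto simp: W'_def\<close>)
  qed
  have "\<exists>s' N. s' \<in> \<Gamma> \<and> open N \<and> x \<in> N \<and> N \<subseteq> W' \<and> (\<forall>z\<in>N. s' z = snd t z (g b (snd c z)))" for b
    using frame_germ_exists[OF assms(4) W'(1,3,4) gW] by metis
  then obtain Gs N where Gs: "\<And>b. Gs b \<in> \<Gamma>" "\<And>b. open (N b)" "\<And>b. x \<in> N b" "\<And>b. N b \<subseteq> W'"
    "\<And>b z. z \<in> N b \<Longrightarrow> Gs b z = snd t z (g b (snd c z))" by metis
  obtain S0 N0 where S0: "S0 \<in> \<Gamma>" "open N0" "x \<in> N0" "N0 \<subseteq> W'" "\<And>z. z \<in> N0 \<Longrightarrow> S0 z = snd t z (f y)"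
    by (rule frame_germ_exists[OF assms(4) W'(1,3,4) smooth_map_const[of _ "f y"]]) blast
  have "\<exists>u N. u \<in> Cinf \<and> open N \<and> x \<in> N \<and> N \<subseteq> W' \<and> (\<forall>z\<in>N. u z = snd c z \<bullet> b + - (y \<bullet> b))" for b
    using cutoff_coordinate[OF assms(3) W'(1,2,4)] by metis
  then obtain u M where u: "\<And>b. u b \<in> Cinf" "\<And>b. open (M b)" "\<And>b. x \<in> M b" "\<And>b. M b \<subseteq> W'"
    "\<And>b z. z \<in> M b \<Longrightarrow> u b z = snd c z \<bullet> b + - (y \<bullet> b)" by metis
  \<comment> \<open>The constant was chosen for this: a factor vanishing at \<open>x\<close> turns
    \<open>T\<close> applied to the product into a commutator at \<open>x\<close>.\<close>
  have ux: "u b x = 0" for b using u(5)[OF u(3)] by (simp add: y_def)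
  define V where "V = N0 \<inter> (\<Inter>b\<in>?B. N b \<inter> M b)"
  have V: "open V" "x \<in> V" unfolding V_def using S0 Gs u finite_coord_basis by (auto intro!: open_Int open_INT)
  define s' where "s' z = S0 z + (\<Sum>b\<in>?B. u b z *\<^sub>R Gs b z)" for z
  have sum: "(\<lambda>z. \<Sum>b\<in>?B. u b z *\<^sub>R Gs b z) \<in> \<Gamma>"
    "T (\<lambda>z. \<Sum>b\<in>?B. u b z *\<^sub>R Gs b z) = (\<lambda>z. \<Sum>b\<in>?B. T (\<lambda>z. u b z *\<^sub>R Gs b z) z)"
    using End_sum[OF TE finite_coord_basis, of "\<lambda>b z. u b z *\<^sub>R Gs b z"] section_mult[OF u(1) Gs(1)] by auto
  have s': "s' \<in> \<Gamma>" unfolding s'_def by (rule section_add[OF S0(1) sum(1)])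
  have "s z = s' z" if z: "z \<in> V" for z
  proof -
    have zW: "z \<in> W'" using z S0(4) by (auto simp: V_def)
    then have z': "z \<in> fst c" "z \<in> fst t" "snd c z \<in> S" by (auto simp: W'_def)
    have lin: "linear (snd t z)" by (rule triv_linear[OF assms(4) z'(2)])
    have "s z = snd t z (f (snd c z))"
      using z' assms by (simp add: f_def loc_inverse section_fiber Suc.prems)
    also have "f (snd c z) = f y + (\<Sum>b\<in>?B. ((snd c z - y) \<bullet> b) *\<^sub>R g b (snd c z))"
      unfolding g_def by (rule hadamard[OF fS z'(3)])
    also have "snd t z \<dots> = snd t z (f y) + (\<Sum>b\<in>?B. ((snd c z - y) \<bullet> b) *\<^sub>R snd t z (g b (snd c z)))"
      by (simp add: linear_add[OF lin] linear_sum[OF lin] linear_scale[OF lin])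
    also have "\<dots> = s' z"
      unfolding s'_def using z S0(5) Gs(5) u(5) by (auto simp: V_def inner_diff_left intro!: sum.cong)
    finally show ?thesis .
  qed
  then have "T s x = T s' x" by (rule G_local_eq[OF Suc.prems s' V])
  also have "\<dots> = T S0 x + (\<Sum>b\<in>?B. T (\<lambda>z. u b z *\<^sub>R Gs b z) x)"
    unfolding s'_def End_add[OF TE S0(1) sum(1)] sum(2) ..
  also have "\<dots> = T S0 x + (\<Sum>b\<in>?B. ad (u b) T (Gs b) x)"
    using ux by (simp add: ad_apply[OF TE Gs(1)])
  finally have Ts: "T s x = T S0 x + (\<Sum>b\<in>?B. ad (u b) T (Gs b) x)" .
  have adG: "ad (u b) T \<in> G k" for b by (rule G_ad[OF Suc.prems(1) u(1)])
  have secs: "T S0 \<in> \<Gamma>" "ad (u b) T (Gs b) \<in> \<Gamma>" for b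
    using End_closed[OF TE S0(1)] End_closed[OF G_End[OF adG] Gs(1)] by auto
  \<comment> \<open>\<open>End_sum\<close> is applied to the zero operator only to conclude that a
    finite sum of sections is a section.\<close>
  have sec_sum: "(\<lambda>z. \<Sum>b\<in>?B. ad (u b) T (Gs b) z) \<in> \<Gamma>"
    using End_sum[OF op_zero_End finite_coord_basis, of "\<lambda>b. ad (u b) T (Gs b)"] secs(2) by blast
  have "loc t (T s) x = loc t (\<lambda>z. T S0 z + (\<Sum>b\<in>?B. ad (u b) T (Gs b) z)) x"
    using Ts by (simp add: local_section_def)
  also have "\<dots> = loc t (T S0) x + (\<Sum>b\<in>?B. loc t (ad (u b) T (Gs b)) x)"
    using loc_add[where s = "T S0" and s' = "\<lambda>z. \<Sum>b\<in>?B. ad (u b) T (Gs b) z", OF assms(4,6)]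
      section_fiber[OF secs(1)] section_fiber[OF sec_sum]
      loc_sum[OF assms(4,6) finite_coord_basis, of "\<lambda>b. ad (u b) T (Gs b)"] secs(2) by simp
  also have "loc t (T S0) x = coef c t [] T x *v f y"
    by (rule coef_Nil[OF Suc.prems(1) assms(4,6) S0(1-3,5)])
  also have "loc t (ad (u b) T (Gs b)) x =
      (\<Sum>\<alpha> | set \<alpha> \<subseteq> ?B \<and> length \<alpha> < k. coef c t (rev (\<alpha> @ [b])) T x *v iterated_derivative (\<alpha> @ [b]) f y)"
    if "b \<in> ?B" for b
    unfolding Suc.IH[OF adG Gs(1)]
  proof (rule sum.cong[OF refl])
    fix \<alpha> :: "'b list"
    have o: "open (snd c ` (fst c \<inter> N b))" by (rule chart_image_open[OF assms(3) Gs(2)])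
    have yN: "y \<in> snd c ` (fst c \<inter> N b)" using assms Gs(3) by (auto simp: y_def)
    have e1: "iterated_derivative \<alpha> (g b) y = iterated_derivative \<alpha> (loc t (Gs b) \<circ> chart_inv c) y"
    proof (rule iterated_derivative_cong[OF smooth_on_subset[OF gS] o _ yN])
      show "snd c ` (fst c \<inter> N b) \<subseteq> S" using Gs(4) by (auto simp: W'_def)
      fix p assume "p \<in> snd c ` (fst c \<inter> N b)"
      then obtain z where z: "z \<in> fst c" "z \<in> N b" "p = snd c z" by blast
      then have "z \<in> fst t" using Gs(4) by (auto simp: W'_def)
      then show "g b p = (loc t (Gs b) \<circ> chart_inv c) p"
        using z assms Gs(5)[OF z(2)] by (simp add: local_section_def)
    qed
    \<comment> \<open>The factor 1/(length + 1) comes from the weight of the ray mean at its centre.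
      The same factor in \<open>e3\<close>, put there by the definition of \<open>coef\<close>,
      makes the two sides match.\<close>
    have e2: "iterated_derivative \<alpha> (g b) y = (1 / (real (length \<alpha>) + 1)) *\<^sub>R iterated_derivative (\<alpha> @ [b]) f y"
      unfolding g_def ray_mean_iterated[OF smooth_on_derivative[OF fS] x_S] ray_mean_center
      by (simp add: iterated_derivative_append)
    have e3: "coef c t (rev (\<alpha> @ [b])) T x = (1 / (real (length \<alpha>) + 1)) *\<^sub>R coef c t (rev \<alpha>) (ad (u b) T) x"
      using coef_Cons[OF Suc.prems(1) assms(3,5,4,6) u(1,2,3,5), where \<alpha> = "rev \<alpha>"] by simp
    show "coef c t (rev \<alpha>) (ad (u b) T) x *v iterated_derivative \<alpha> (loc t (Gs b) \<circ> chart_inv c) (snd c x)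
      = coef c t (rev (\<alpha> @ [b])) T x *v iterated_derivative (\<alpha> @ [b]) f y"
      unfolding y_def[symmetric] e1[symmetric] e2 e3 scaleR_matrix_vector_assoc[symmetric] matrix_vector_mult_scaleR ..
  qed
  then have "(\<Sum>b\<in>?B. loc t (ad (u b) T (Gs b)) x) = (\<Sum>b\<in>?B. \<Sum>\<alpha> | set \<alpha> \<subseteq> ?B \<and> length \<alpha> < k.
      coef c t (rev (\<alpha> @ [b])) T x *v iterated_derivative (\<alpha> @ [b]) f y)" by (rule sum.cong[OF refl])
  also have "\<dots> = (\<Sum>(b, \<alpha>) \<in> ?B \<times> {\<alpha>. set \<alpha> \<subseteq> ?B \<and> length \<alpha> < k}.
      coef c t (rev (\<alpha> @ [b])) T x *v iterated_derivative (\<alpha> @ [b]) f y)"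
    by (rule sum.cartesian_product)
  \<comment> \<open>Nonempty words are split into their initial part and last letter; the empty word
    is accounted for by the constant section.\<close>
  also have "\<dots> = (\<Sum>\<alpha> \<in> {\<alpha>. set \<alpha> \<subseteq> ?B \<and> length \<alpha> < Suc k} - {[]}. coef c t (rev \<alpha>) T x *v iterated_derivative \<alpha> f y)"
    by (rule sum.reindex_bij_witness[of _ "\<lambda>\<alpha>. (last \<alpha>, butlast \<alpha>)" "\<lambda>(b, \<alpha>). \<alpha> @ [b]"])
      (auto dest: in_set_butlastD simp: less_Suc_eq_le, metis Suc_pred length_greater_0_conv less_eq_Suc_le)
  finally have "loc t (T s) x = coef c t [] T x *v f y
     + (\<Sum>\<alpha> \<in> {\<alpha>. set \<alpha> \<subseteq> ?B \<and> length \<alpha> < Suc k} - {[]}. coef c t (rev \<alpha>) T x *v iterated_derivative \<alpha> f y)"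
    by simp
  moreover have "finite {\<alpha>. set \<alpha> \<subseteq> ?B \<and> length \<alpha> < Suc k}"
    unfolding multi_indices_upto_eq[symmetric] by (rule finite_multi_indices)
  ultimately show ?case unfolding y_def[symmetric] f_def[symmetric]
    by (subst sum.remove[of _ "[]"]) simp_all
qed

lemma G_local_expression:
  assumes "T \<in> G k" "c \<in> A" "t \<in> L"
  shows "local_expression A E L (int k - 1) T c t (\<lambda>\<alpha>. coef c t (rev \<alpha>) T)"
  unfolding local_expression_def multi_indices_upto_eq
  using coef_smooth[OF assms] local_expansion[OF assms(1) _ assms(2,3)] by auto

lemma P_local_expression:
  assumes "T \<in> P k" "c \<in> A" "t \<in> L"
  shows "local_expression A E L (int k) T c t (\<lambda>\<alpha>. coef c t (rev \<alpha>) T)"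
  using G_local_expression[OF P_G[OF assms(1)] assms(2,3)] by simp

end

section \<open>The symbol as a function on the cotangent bundle\<close>

text \<open>Each derivative of g^k f lowers the power of g by at most one. On the zero set of g only
  the terms that always differentiate the power survive. Evaluating an operator on such products
  isolates its top-order part.\<close>

lemma iterated_derivative_power:
  fixes g :: "'a::real_normed_vector \<Rightarrow> real" and f :: "'a \<Rightarrow> 'c::real_normed_vector"
  assumes "open S" "smooth_on S g" "smooth_on S f" "length \<alpha> + j = k"
  shows "\<exists>R. smooth_on S R \<and> (\<forall>y\<in>S. iterated_derivative \<alpha> (\<lambda>y. g y ^ k *\<^sub>R f y) y = g y ^ j *\<^sub>R R y)
     \<and> (\<forall>y\<in>S. g y = 0 \<longrightarrow> R y = (fact k / fact j * (\<Prod>v\<leftarrow>\<alpha>. frechet_derivative g (at y) v)) *\<^sub>R f y)"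
  using assms(4)
proof (induction \<alpha> arbitrary: j)
  case Nil
  then show ?case using assms(3) by (intro exI[of _ f]) simp
next
  case (Cons v \<alpha>)
  obtain R where R: "smooth_on S R"
    "\<And>y. y \<in> S \<Longrightarrow> iterated_derivative \<alpha> (\<lambda>y. g y ^ k *\<^sub>R f y) y = g y ^ Suc j *\<^sub>R R y"
    "\<And>y. y \<in> S \<Longrightarrow> g y = 0 \<Longrightarrow> R y = (fact k / fact (Suc j) * (\<Prod>v\<leftarrow>\<alpha>. frechet_derivative g (at y) v)) *\<^sub>R f y"
    using Cons.IH[of "Suc j"] Cons.prems by auto
  define R' where "R' y = (real (Suc j) * frechet_derivative g (at y) v) *\<^sub>R R y + g y *\<^sub>R frechet_derivative R (at y) v" for y
  have "smooth_on S R'" unfolding R'_def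
    by (intro smooth_on_add smooth_on_scaleR smooth_on_linear_outer[OF _ bounded_linear_mult_right]
        smooth_on_derivative assms R)
  moreover have "iterated_derivative (v # \<alpha>) (\<lambda>y. g y ^ k *\<^sub>R f y) y = g y ^ j *\<^sub>R R' y" if y: "y \<in> S" for y
  proof -
    have "((\<lambda>y. g y ^ Suc j *\<^sub>R R y) has_derivative
      (\<lambda>h. g y ^ Suc j *\<^sub>R frechet_derivative R (at y) h + (real (Suc j) * frechet_derivative g (at y) h * g y ^ j) *\<^sub>R R y)) (at y)"
      by (intro has_derivative_scaleR smooth_on_has_derivative[OF R(1) y]
          has_derivative_eq_rhs[OF has_derivative_power[OF smooth_on_has_derivative[OF assms(2) y], of "Suc j"]])
        (simp add: fun_eq_iff algebra_simps)
    then have "(iterated_derivative \<alpha> (\<lambda>y. g y ^ k *\<^sub>R f y) has_derivative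
      (\<lambda>h. g y ^ Suc j *\<^sub>R frechet_derivative R (at y) h + (real (Suc j) * frechet_derivative g (at y) h * g y ^ j) *\<^sub>R R y)) (at y)"
      by (rule has_derivative_transform_within_open[OF _ assms(1) y]) (simp add: R(2))
    from frechet_derivative_eq[OF this, of v] show ?thesis
      by (simp add: R'_def scaleR_add_right algebra_simps)
  qed
  moreover have "R' y = (fact k / fact j * (\<Prod>v\<leftarrow>v # \<alpha>. frechet_derivative g (at y) v)) *\<^sub>R f y"
    if y: "y \<in> S" "g y = 0" for y
  proof -
    have "real (Suc j) * (fact k / fact (Suc j)) = fact k / fact j" by (simp add: divide_simps)
    then have "real (Suc j) * d * (fact k / fact (Suc j) * p) = fact k / fact j * (d * p)" for d p
      by (metis (no_types, lifting) mult.assoc mult.left_commute)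
    then show ?thesis by (simp add: R'_def R(3)[OF y] y(2))
  qed
  ultimately show ?case by blast
qed

lemma smooth_on_fst:
  fixes h :: "'a::real_inner \<Rightarrow> 'c::real_normed_vector"
  assumes "is_coord_basis (B::'a set)" "open S" "smooth_on S h"
  shows "smooth_on (S \<times> (UNIV::'d::real_normed_vector set)) (\<lambda>p. h (fst p))"
  by (rule smooth_on_compose[OF assms(1) _ assms(2,3) smooth_on_linear[OF _ bounded_linear_fst]])
    (auto simp: open_Times assms(2))

lemma smooth_on_monomial:
  assumes "open S" shows "smooth_on (S :: ('a::real_inner \<times> 'a) set) (\<lambda>p. monomial \<alpha> (snd p))"
proof (induction \<alpha>)
  case Nil show ?case by (simp add: monomial_def smooth_on_const)
next
  case (Cons b \<alpha>)
  have "smooth_on S (\<lambda>p. (snd p \<bullet> b) * monomial \<alpha> (snd p))"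
    by (intro smooth_on_mult assms Cons smooth_on_linear_outer[OF _ bounded_linear_inner_left]
        smooth_on_linear bounded_linear_snd)
  then show ?case by (simp add: monomial_def)
qed

context vector_bundle begin

lemma smooth_functions_power: "u \<in> Cinf \<Longrightarrow> (\<lambda>z. u z ^ k) \<in> Cinf"
  by (induction k) (simp_all add: smooth_functions_const smooth_functions_mult)

text \<open>Since \<open>u\<close> vanishes at \<open>x\<close>, one factor \<open>u\<close> at a
  time can be moved into a commutator; after k moves the k-fold commutator acts on
  \<open>s\<close>.\<close>

lemma symb_power:
  "T \<in> P k \<Longrightarrow> u \<in> Cinf \<Longrightarrow> s \<in> \<Gamma> \<Longrightarrow> u x = 0 \<Longrightarrow>
    T (\<lambda>z. u z ^ k *\<^sub>R s z) x = (fact k * symb k T u x) *\<^sub>R s x"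
proof (induction k arbitrary: T)
  case 0
  then show ?case using symb_0_eq[OF 0(1,3), of x u] by simp
next
  case (Suc k)
  have TE: "T \<in> \<E>" by (rule P_End[OF Suc.prems(1)])
  have "(\<lambda>z. u z ^ k *\<^sub>R s z) \<in> \<Gamma>" by (intro section_mult smooth_functions_power Suc.prems)
  from ad_apply[OF TE this, of u]
  have "T (\<lambda>z. u z ^ Suc k *\<^sub>R s z) x = ad u T (\<lambda>z. u z ^ k *\<^sub>R s z) x"
    using Suc.prems(4) by simp
  also have "\<dots> = (fact k * symb k (ad u T) u x) *\<^sub>R s x"
    using Suc.IH[OF P_ad[OF Suc.prems(1,2)] Suc.prems(2-4)] .
  also have "fact k * symb k (ad u T) u x = fact (Suc k) * symb (Suc k) T u x" by simp
  finally show ?case .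
qed

lemma symb_shift:
  "T \<in> P k \<Longrightarrow> u \<in> Cinf \<Longrightarrow> symb k T (\<lambda>z. u z + r) x = symb k T u x"
proof (induction k arbitrary: T)
  case 0 then show ?case by simp
next
  case (Suc k)
  have TE: "T \<in> \<E>" by (rule P_End[OF Suc.prems(1)])
  have "ad (\<lambda>z. r) T = op_zero"
    by (rule End_eqI) (use TE in \<open>auto intro!: commutator_End mu_End smooth_functions_const op_zero_End
        simp: ad_apply op_apply End_scale\<close>)
  then have "ad (\<lambda>z. u z + r) T = ad u T"
    using ad_add_fun[OF TE Suc.prems(2) smooth_functions_const, of r] by (simp add: op_add_zero)
  then show ?case using Suc.IH[OF P_ad[OF Suc.prems] Suc.prems(2)] by simp
qed

text \<open>The operator is evaluated at \<open>x\<close> on g^k s, with g vanishing at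
  \<open>x\<close>, in two ways: by commutators through \<open>symb_power\<close>, and by the given
  local expression. As the latter is arbitrary, all local expressions yield the same principal
  symbol.\<close>

lemma symb_local_expression:
  assumes T: "T \<in> P k" and a: "local_expression A E L (int k) T c t a"
    and c: "c \<in> A" "x \<in> fst c" and t: "t \<in> L" "x \<in> fst t"
    and u: "u \<in> covector_at A c x \<xi>"
  shows "(\<Sum>\<alpha>\<in>multi_indices (int k). monomial \<alpha> \<xi> *\<^sub>R (a \<alpha> x *v w)) = symb k T u x *\<^sub>R w"
proof -
  let ?W = "fst c \<inter> fst t"
  let ?S = "snd c ` ?W"
  define y where "y = snd c x"
  have uC: "u \<in> Cinf" and du: "((u \<circ> chart_inv c) has_derivative (\<lambda>v. \<xi> \<bullet> v)) (at y)"
    using u by (auto simp: covector_at_def y_def)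
  \<comment> \<open>Subtracting the value at \<open>x\<close> changes neither the differential nor,
    by \<open>symb_shift\<close>, the symbol.\<close>
  define g where "g z = u z + - u x" for z
  have g: "g \<in> Cinf" "g x = 0" unfolding g_def[abs_def] by (rule smooth_functions_add[OF uC smooth_functions_const]) simp
  define e where "e = snd t x w"
  have "e \<in> E x" by (simp add: e_def fiber_eq_range[OF t])
  then obtain s where s: "s \<in> \<Gamma>" "s x = e" by (rule section_through)
  have locsx: "loc t s x = w" using s t by (simp add: local_section_def e_def)
  define gc where "gc = g \<circ> chart_inv c"
  define sc where "sc = loc t s \<circ> chart_inv c"
  have oS: "open ?S" by (rule chart_image_open[OF c(1) triv_open[OF t(1)]])
  have yS: "y \<in> ?S" using c t by (auto simp: y_def)
  have cy: "chart_inv c y = x" using c by (simp add: y_def)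
  have gcy: "gc y = 0" "sc y = w" using g locsx cy by (auto simp: gc_def sc_def)
  have sm: "smooth_on ?S gc" "smooth_on ?S sc"
    using smooth_on_subset[OF smooth_map_onD[OF g(1)[unfolded smooth_functions_iff] c(1)], of ?S]
      loc_chart_smooth[OF c(1) t(1) s(1)] by (auto simp: gc_def sc_def o_def)
  have "gc = (\<lambda>p. (u \<circ> chart_inv c) p + - u x)" by (simp add: gc_def g_def fun_eq_iff)
  then have "(gc has_derivative (\<lambda>v. \<xi> \<bullet> v)) (at y)"
    using has_derivative_add[OF du has_derivative_const[of "- u x"]] by simp
  then have dg: "frechet_derivative gc (at y) v = \<xi> \<bullet> v" for v by (rule frechet_derivative_eq)
  define r where "r = (\<lambda>z. g z ^ k *\<^sub>R s z)"
  have r: "r \<in> \<Gamma>" unfolding r_def by (intro section_mult smooth_functions_power g s)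
  have rc: "(loc t r \<circ> chart_inv c) p = gc p ^ k *\<^sub>R sc p" if p: "p \<in> ?S" for p
  proof -
    have q: "chart_inv c p \<in> fst t" using p c(1) by auto
    show ?thesis
      using loc_scale[where u = "\<lambda>z. g z ^ k" and s = s, OF t(1) q section_fiber[OF s(1)]] by (simp add: gc_def sc_def r_def)
  qed
  have gs: "smooth_on ?S (loc t r \<circ> chart_inv c)" by (rule loc_chart_smooth[OF c(1) t(1) r])
  \<comment> \<open>Below order k a positive power of \<open>gc\<close> remains and vanishes at
    \<open>y\<close>; at order k the derivative of the power leaves k! times the monomial.\<close>
  have it: "iterated_derivative \<alpha> (loc t r \<circ> chart_inv c) y =
      (if length \<alpha> = k then (fact k * monomial \<alpha> \<xi>) *\<^sub>R w else 0)" if "length \<alpha> \<le> k" for \<alpha>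
  proof -
    have "length \<alpha> + (k - length \<alpha>) = k" using that by simp
    from iterated_derivative_power[OF oS sm this]
    obtain R where R: "\<And>y. y \<in> ?S \<Longrightarrow> iterated_derivative \<alpha> (\<lambda>y. gc y ^ k *\<^sub>R sc y) y = gc y ^ (k - length \<alpha>) *\<^sub>R R y"
      "\<And>y. y \<in> ?S \<Longrightarrow> gc y = 0 \<Longrightarrow> R y = (fact k / fact (k - length \<alpha>) * (\<Prod>v\<leftarrow>\<alpha>. frechet_derivative gc (at y) v)) *\<^sub>R sc y"
      by blast
    have "iterated_derivative \<alpha> (loc t r \<circ> chart_inv c) y = iterated_derivative \<alpha> (\<lambda>y. gc y ^ k *\<^sub>R sc y) y"
      by (rule iterated_derivative_cong[OF gs oS rc yS])
    then show ?thesis using R[OF yS] gcy that by (auto simp: dg monomial_def power_0_left)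
  qed
  have "loc t (T r) x = (\<Sum>\<alpha>\<in>multi_indices_upto (int k). a \<alpha> x *v iterated_derivative \<alpha> (loc t r \<circ> chart_inv c) y)"
    using a r c t unfolding local_expression_def y_def by blast
  also have "\<dots> = (\<Sum>\<alpha>\<in>multi_indices (int k). a \<alpha> x *v ((fact k * monomial \<alpha> \<xi>) *\<^sub>R w))"
    by (rule sum.mono_neutral_cong_right[OF finite_multi_indices(1)])
      (auto simp: multi_indices_def multi_indices_upto_def it)
  also have "\<dots> = fact k *\<^sub>R (\<Sum>\<alpha>\<in>multi_indices (int k). monomial \<alpha> \<xi> *\<^sub>R (a \<alpha> x *v w))"
    by (simp add: scaleR_sum_right matrix_vector_mult_scaleR)
  finally have 1: "loc t (T r) x = fact k *\<^sub>R (\<Sum>\<alpha>\<in>multi_indices (int k). monomial \<alpha> \<xi> *\<^sub>R (a \<alpha> x *v w))" .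
  have "T r x = (fact k * symb k T u x) *\<^sub>R s x"
    unfolding r_def symb_power[OF T g(1) s(1) g(2)] unfolding g_def[abs_def] symb_shift[OF T uC] ..
  then have 2: "loc t (T r) x = fact k *\<^sub>R (symb k T u x *\<^sub>R w)"
    using triv_inv_scale[OF t section_fiber[OF s(1)]] locsx by (simp add: local_section_def)
  show ?thesis using trans[OF 1[symmetric] 2] unfolding scaleR_cancel_left by simp
qed

section \<open>Covectors in charts, and the symbol as a function of them\<close>

lemma covector_nonempty:
  assumes "c \<in> A" "x \<in> fst c" obtains u where "u \<in> covector_at A c x \<xi>"
proof -
  obtain u N where u: "u \<in> Cinf" "open N" "x \<in> N" "N \<subseteq> fst c" "\<And>z. z \<in> N \<Longrightarrow> u z = snd c z \<bullet> \<xi> + 0"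
    by (rule cutoff_coordinate[OF assms(1) chart_open[OF assms(1)] order_refl assms(2)]) blast
  have "((\<lambda>p. \<xi> \<bullet> p) has_derivative (\<lambda>v. \<xi> \<bullet> v)) (at (snd c x))"
    by (rule bounded_linear_imp_has_derivative[OF bounded_linear_inner_right])
  then have "((u \<circ> chart_inv c) has_derivative (\<lambda>v. \<xi> \<bullet> v)) (at (snd c x))"
    by (rule has_derivative_transform_within_open[OF _ chart_image_open[OF assms(1) u(2)]])
      (use assms u in \<open>auto simp: inner_commute\<close>)
  then show ?thesis using that u(1) by (simp add: covector_at_def)
qed

lemma chart_derivative:
  assumes "u \<in> Cinf" "c \<in> A" "x \<in> fst c"
  shows "((u \<circ> chart_inv c) has_derivative frechet_derivative (u \<circ> chart_inv c) (at (snd c x))) (at (snd c x))"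
  using smooth_on_has_derivative[OF smooth_map_onD[OF assms(1)[unfolded smooth_functions_iff] assms(2)]] assms(3)
  by (simp add: o_def)

lemma covector_of_function:
  assumes "u \<in> Cinf" "c \<in> A" "x \<in> fst c" obtains \<xi> where "u \<in> covector_at A c x \<xi>"
proof -
  let ?D = "frechet_derivative (u \<circ> chart_inv c) (at (snd c x))"
  note d = chart_derivative[OF assms]
  define \<xi> where "\<xi> = (\<Sum>b\<in>coord_basis. ?D b *\<^sub>R b)"
  have "?D v = \<xi> \<bullet> v" for v unfolding \<xi>_def
    using linear_coord_expand[OF coord_basis has_derivative_linear[OF d], of v]
    by (simp add: inner_sum_left inner_commute[of v] mult.commute)
  then have "?D = (\<lambda>v. \<xi> \<bullet> v)" by (rule ext)
  then show ?thesis using that[of \<xi>] d assms(1) by (simp add: covector_at_def)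
qed

text \<open>\<open>differential_at\<close> compares derivatives in all charts,
  \<open>covector_at\<close> in one; the chain rule with the transition map closes the gap.\<close>

lemma differential_at_covector:
  assumes "c \<in> A" "x \<in> fst c" "u \<in> covector_at A c x \<xi>"
  shows "differential_at A x u = covector_at A c x \<xi>"
proof -
  have u: "u \<in> Cinf" "((u \<circ> chart_inv c) has_derivative (\<lambda>v. \<xi> \<bullet> v)) (at (snd c x))"
    using assms(3) by (auto simp: covector_at_def)
  have D: "differential_at A x u = {g \<in> Cinf. \<forall>c\<in>A. x \<in> fst c \<longrightarrow>
     frechet_derivative (g \<circ> chart_inv c) (at (snd c x)) = frechet_derivative (u \<circ> chart_inv c) (at (snd c x))}"
    by (auto simp: differential_at_def chart_inv_def split_beta)
  have "g \<in> covector_at A c x \<xi>" if g: "g \<in> differential_at A x u" for g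
  proof -
    have "frechet_derivative (g \<circ> chart_inv c) (at (snd c x)) = (\<lambda>v. \<xi> \<bullet> v)"
      using g assms(1,2) frechet_derivative_at[OF u(2)] by (auto simp: D)
    then show ?thesis using chart_derivative[OF _ assms(1,2), of g] g by (auto simp: covector_at_def D)
  qed
  moreover have "g \<in> differential_at A x u" if g: "g \<in> covector_at A c x \<xi>" for g
  proof -
    have g': "g \<in> Cinf" "((g \<circ> chart_inv c) has_derivative (\<lambda>v. \<xi> \<bullet> v)) (at (snd c x))"
      using g by (auto simp: covector_at_def)
    have "frechet_derivative (g \<circ> chart_inv c') (at (snd c' x)) = frechet_derivative (u \<circ> chart_inv c') (at (snd c' x))"
      if c': "c' \<in> A" "x \<in> fst c'" for c'
    proof -
      let ?\<tau> = "\<lambda>p. snd c (chart_inv c' p)"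
      let ?S = "snd c' ` (fst c' \<inter> fst c)"
      have oS: "open ?S" by (rule chart_image_open[OF c'(1) chart_open[OF assms(1)]])
      have xS: "snd c' x \<in> ?S" using c' assms(2) by blast
      have \<tau>: "(?\<tau> has_derivative frechet_derivative ?\<tau> (at (snd c' x))) (at (snd c' x))"
        by (rule smooth_on_has_derivative[OF transition_smooth[OF c'(1) assms(1)] xS])
      have \<tau>x: "?\<tau> (snd c' x) = snd c x" using c' by simp
      have "((h \<circ> chart_inv c') has_derivative (\<lambda>v. \<xi> \<bullet> frechet_derivative ?\<tau> (at (snd c' x)) v)) (at (snd c' x))"
        if h: "((h \<circ> chart_inv c) has_derivative (\<lambda>v. \<xi> \<bullet> v)) (at (snd c x))" for h :: "'m \<Rightarrow> real"
      proof -
        have "((\<lambda>p. (h \<circ> chart_inv c) (?\<tau> p)) has_derivative (\<lambda>v. \<xi> \<bullet> frechet_derivative ?\<tau> (at (snd c' x)) v)) (at (snd c' x))"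
          by (rule has_derivative_compose[OF \<tau>]) (simp only: \<tau>x h)
        then show ?thesis
          by (rule has_derivative_transform_within_open[OF _ oS xS]) (use c' assms(1) in auto)
      qed
      from frechet_derivative_at[OF this[OF g'(2)]] frechet_derivative_at[OF this[OF u(2)]] show ?thesis by simp
    qed
    then show ?thesis using g'(1) by (simp add: D)
  qed
  ultimately show ?thesis by blast
qed

lemma cotangent_cases:
  assumes "q \<in> cotangent_bundle A"
  obtains x u where "u \<in> Cinf" "q = (x, differential_at A x u)"
  using assms by (auto simp: cotangent_bundle_def)

lemma covector_cotangent:
  assumes "c \<in> A" "x \<in> fst c" shows "(x, covector_at A c x \<xi>) \<in> cotangent_bundle A"
proof -
  obtain u where u: "u \<in> covector_at A c x \<xi>" by (rule covector_nonempty[OF assms])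
  then have "u \<in> Cinf" by (simp add: covector_at_def)
  then show ?thesis using differential_at_covector[OF assms u] by (auto simp: cotangent_bundle_def)
qed

text \<open>A covector is a set of functions, so any member may serve as the argument of
  \<open>symb\<close>; independence of the choice is \<open>symb_covector_eq\<close>.\<close>

definition psymb :: "nat \<Rightarrow> ('m, 'v) operator \<Rightarrow> 'm cofunction" where
  "psymb k T q = (if q \<in> cotangent_bundle A then symb k T (SOME u. u \<in> snd q) (fst q) else 0)"

text \<open>A local expression computes the symbol from the components of the covector
  alone.\<close>

lemma symb_covector_eq:
  assumes "T \<in> P k" "c \<in> A" "x \<in> fst c" "u \<in> covector_at A c x \<xi>" "u' \<in> covector_at A c x \<xi>"
  shows "symb k T u x = symb k T u' x"
proof -
  obtain t where t: "t \<in> L" "x \<in> fst t" by (rule triv_exists)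
  note le = P_local_expression[OF assms(1,2) t(1)]
  have "symb k T u x *\<^sub>R (1 :: real^'n) = symb k T u' x *\<^sub>R 1"
    using symb_local_expression[OF assms(1) le assms(2,3) t assms(4), of 1]
      symb_local_expression[OF assms(1) le assms(2,3) t assms(5), of 1] by simp
  then show ?thesis by simp
qed

lemma psymb_covector:
  assumes "T \<in> P k" "c \<in> A" "x \<in> fst c" "u \<in> covector_at A c x \<xi>"
  shows "psymb k T (x, covector_at A c x \<xi>) = symb k T u x"
proof -
  have "(SOME u. u \<in> covector_at A c x \<xi>) \<in> covector_at A c x \<xi>" 
    by (rule someI[of "\<lambda>u. u \<in> covector_at A c x \<xi>", OF assms(4)])
  from symb_covector_eq[OF assms(1-3) this assms(4)] show ?thesis
    using covector_cotangent[OF assms(2,3)] by (simp add: psymb_def)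
qed

lemma psymb_differential:
  assumes "T \<in> P k" "u \<in> Cinf" shows "psymb k T (x, differential_at A x u) = symb k T u x"
proof -
  obtain c where c: "c \<in> A" "x \<in> fst c" by (rule chart_exists)
  obtain \<xi> where \<xi>: "u \<in> covector_at A c x \<xi>" by (rule covector_of_function[OF assms(2) c])
  show ?thesis unfolding differential_at_covector[OF c \<xi>] by (rule psymb_covector[OF assms(1) c \<xi>])
qed

lemma psymb_eqI:
  assumes "T \<in> P k" "\<And>q. q \<notin> cotangent_bundle A \<Longrightarrow> F q = 0"
    "\<And>x u. u \<in> Cinf \<Longrightarrow> F (x, differential_at A x u) = symb k T u x"
  shows "psymb k T = F"
proof
  fix q show "psymb k T q = F q"
  proof (cases "q \<in> cotangent_bundle A")
    case True
    then obtain x u where "u \<in> Cinf" "q = (x, differential_at A x u)" by (rule cotangent_cases)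
    then show ?thesis using psymb_differential[OF assms(1)] assms(3) by simp
  qed (simp add: assms(2) psymb_def)
qed

lemma psymb_add: "T \<in> P k \<Longrightarrow> D \<in> P k \<Longrightarrow> psymb k (op_add T D) = (\<lambda>q. psymb k T q + psymb k D q)"
  by (rule psymb_eqI) (auto simp: P_add symb_add psymb_differential, simp add: psymb_def)

lemma psymb_scale: "T \<in> P k \<Longrightarrow> psymb k (op_scale r T) = (\<lambda>q. r * psymb k T q)"
  by (rule psymb_eqI) (auto simp: P_scale symb_scale psymb_differential, simp add: psymb_def)

lemma psymb_eq_0_iff: assumes "T \<in> P k" shows "psymb k T = (\<lambda>q. 0) \<longleftrightarrow> T \<in> G k"
proof
  assume *: "psymb k T = (\<lambda>q. 0)"
  have "symb k T u x = 0" if "u \<in> Cinf" for u x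
    using psymb_differential[OF assms that, of x] * by simp
  then show "T \<in> G k" using symb_eq_0_iff[OF assms] by blast
next
  assume "T \<in> G k"
  then show "psymb k T = (\<lambda>q. 0)" using symb_eq_0_iff[OF assms] by (intro psymb_eqI[OF assms]) auto
qed

text \<open>The description has a solution because \<open>P_local_expression\<close> provides a
  local expression, and only one because \<open>symb_local_expression\<close> evaluates every
  admissible choice of chart, frame and coefficients.\<close>

lemma principal_symbol_eq:
  assumes T: "T \<in> P k" and q: "q \<in> cotangent_bundle A" and e: "e \<in> E (fst q)"
  shows "principal_symbol A E L (int k) T q e = psymb k T q *\<^sub>R e"
proof -
  obtain x \<omega> where q': "q = (x, \<omega>)" by (cases q)
  obtain f where f: "f \<in> Cinf" "\<omega> = differential_at A x f" using q q' by (auto simp: cotangent_bundle_def)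
  obtain c where c: "c \<in> A" "x \<in> fst c" by (rule chart_exists)
  obtain \<xi> where \<xi>: "f \<in> covector_at A c x \<xi>" by (rule covector_of_function[OF f(1) c])
  have \<omega>: "\<omega> = covector_at A c x \<xi>" using differential_at_covector[OF c \<xi>] f by simp
  obtain t where t: "t \<in> L" "x \<in> fst t" by (rule triv_exists)
  have sy: "psymb k T q = symb k T f x" unfolding q' f(2) by (rule psymb_differential[OF T f(1)])
  have val: "snd t' x (\<Sum>\<alpha>\<in>multi_indices (int k). monomial \<alpha> \<xi>' *\<^sub>R (a \<alpha> x *v inv_into UNIV (snd t' x) e)) = psymb k T q *\<^sub>R e"
    if "c' \<in> A" "t' \<in> L" "x \<in> fst c'" "x \<in> fst t'" "local_expression A E L (int k) T c' t' a" "\<omega> = covector_at A c' x \<xi>'" for c' t' a \<xi>'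
  proof -
    have "f \<in> covector_at A c' x \<xi>'" using that(6) \<omega> \<xi> by simp
    from symb_local_expression[OF T that(5,1,3,2,4) this] show ?thesis
      using linear_scale[OF triv_linear[OF that(2,4)]] triv_inv_right[OF that(2,4)] e sy by (simp add: q')
  qed
  show ?thesis
    unfolding principal_symbol_def
  proof (rule the_equality)
    show "\<exists>c\<in>A. \<exists>t\<in>L. \<exists>a \<xi>. fst q \<in> fst c \<inter> fst t \<and> local_expression A E L (int k) T c t a \<and>
     snd q = covector_at A c (fst q) \<xi> \<and>
     psymb k T q *\<^sub>R e = snd t (fst q) (\<Sum>\<alpha>\<in>multi_indices (int k).
            monomial \<alpha> \<xi> *\<^sub>R (a \<alpha> (fst q) *v inv_into UNIV (snd t (fst q)) e))"
      using c t P_local_expression[OF T c(1) t(1)] \<omega> val[OF c(1) t(1) c(2) t(2) P_local_expression[OF T c(1) t(1)] \<omega>]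
      unfolding q' fst_conv snd_conv
      by (intro bexI[of _ c] bexI[of _ t] exI[of _ "\<lambda>\<alpha>. coef c t (rev \<alpha>) T"] exI[of _ \<xi>]) simp_all
  next
    fix e' assume "\<exists>c\<in>A. \<exists>t\<in>L. \<exists>a \<xi>. fst q \<in> fst c \<inter> fst t \<and> local_expression A E L (int k) T c t a \<and>
     snd q = covector_at A c (fst q) \<xi> \<and>
     e' = snd t (fst q) (\<Sum>\<alpha>\<in>multi_indices (int k).
            monomial \<alpha> \<xi> *\<^sub>R (a \<alpha> (fst q) *v inv_into UNIV (snd t (fst q)) e))"
    then obtain c' t' a \<xi>' where "c' \<in> A" "t' \<in> L" "x \<in> fst c'" "x \<in> fst t'"
      "local_expression A E L (int k) T c' t' a" "\<omega> = covector_at A c' x \<xi>'"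
      "e' = snd t' x (\<Sum>\<alpha>\<in>multi_indices (int k). monomial \<alpha> \<xi>' *\<^sub>R (a \<alpha> x *v inv_into UNIV (snd t' x) e))"
      unfolding q' by auto
    then show "e' = psymb k T q *\<^sub>R e" using val by simp
  qed
qed

lemma scalar_symbol_eq:
  assumes "T \<in> P k" shows "scalar_symbol A E L (int k) T = psymb k T"
  unfolding scalar_symbol_def
proof (rule the_equality)
  show "(\<forall>q. q \<notin> cotangent_bundle A \<longrightarrow> psymb k T q = 0) \<and>
     (\<forall>q\<in>cotangent_bundle A. \<forall>e\<in>E (fst q). principal_symbol A E L (int k) T q e = psymb k T q *\<^sub>R e)"
    by (simp add: principal_symbol_eq[OF assms]) (simp add: psymb_def)
  fix p assume p: "(\<forall>q. q \<notin> cotangent_bundle A \<longrightarrow> p q = 0) \<and>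
     (\<forall>q\<in>cotangent_bundle A. \<forall>e\<in>E (fst q). principal_symbol A E L (int k) T q e = p q *\<^sub>R e)"
  show "p = psymb k T"
  proof
    fix q show "p q = psymb k T q"
    proof (cases "q \<in> cotangent_bundle A")
      case True
      obtain e where e: "e \<in> E (fst q)" "e \<noteq> 0" by (rule fiber_nonzero)
      have "p q *\<^sub>R e = psymb k T q *\<^sub>R e" using p True e(1) principal_symbol_eq[OF assms True e(1)] by auto
      then show ?thesis using e(2) by simp
    next
      case False
      then have "p q = 0" using conjunct1[OF p] by blast
      then show ?thesis using False by (simp add: psymb_def)
    qed
  qed
qed

text \<open>Reconciles the case distinction in \<open>delta_degree\<close> with the symbol: where it
  prescribes 0, the symbol is 0 as well.\<close>

lemma psymb_lower_order:
  assumes T: "T \<in> P k" and D: "T \<in> differential_operators A E L (int k - 1)"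
  shows "psymb k T = (\<lambda>q. 0)"
proof (rule psymb_eqI[OF T])
  fix x u assume u: "u \<in> Cinf"
  obtain c where c: "c \<in> A" "x \<in> fst c" by (rule chart_exists)
  obtain t where t: "t \<in> L" "x \<in> fst t" by (rule triv_exists)
  obtain \<xi> where \<xi>: "u \<in> covector_at A c x \<xi>" by (rule covector_of_function[OF u c])
  obtain a where a: "local_expression A E L (int k - 1) T c t a"
    using D c(1) t(1) by (auto simp: differential_operators_def)
  \<comment> \<open>Padding with zero coefficients in the top degree turns the expression of order k
    - 1 into one of order k whose leading part is zero.\<close>
  define a' where "a' \<alpha> = (if \<alpha> \<in> multi_indices_upto (int k - 1) then a \<alpha> else (\<lambda>x. 0))" for \<alpha>
  have "local_expression A E L (int k) T c t a'"
    unfolding local_expression_def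
  proof (intro conjI ballI)
    fix \<alpha> :: "'b list"
    show "smooth_map_on A (fst c \<inter> fst t) (a' \<alpha>)"
      using a by (auto simp: a'_def local_expression_def smooth_map_const)
  next
    fix s z assume s: "s \<in> \<Gamma>" and z: "z \<in> fst c \<inter> fst t"
    have "loc t (T s) z = (\<Sum>\<alpha>\<in>multi_indices_upto (int k - 1).
           a \<alpha> z *v iterated_derivative \<alpha> (loc t s \<circ> chart_inv c) (snd c z))"
      using a s z unfolding local_expression_def by blast
    also have "\<dots> = (\<Sum>\<alpha>\<in>multi_indices_upto (int k).
           a' \<alpha> z *v iterated_derivative \<alpha> (loc t s \<circ> chart_inv c) (snd c z))"
      by (rule sum.mono_neutral_cong_left[OF finite_multi_indices(1)])
        (auto simp: a'_def multi_indices_upto_def)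
    finally show "loc t (T s) z = (\<Sum>\<alpha>\<in>multi_indices_upto (int k).
           a' \<alpha> z *v iterated_derivative \<alpha> (loc t s \<circ> chart_inv c) (snd c z))" .
  qed
  from symb_local_expression[OF T this c t \<xi>, of 1]
  have "symb k T u x *\<^sub>R (1 :: real^'n) = (\<Sum>\<alpha>\<in>multi_indices (int k). monomial \<alpha> \<xi> *\<^sub>R (a' \<alpha> x *v 1))" by simp
  also have "\<dots> = 0"
    by (rule sum.neutral) (auto simp: a'_def multi_indices_def multi_indices_upto_def)
  finally show "0 = symb k T u x" by simp
qed simp

lemma psymb_Pol_degree:
  assumes T: "T \<in> P k" shows "psymb k T \<in> Pol_degree A k"
proof -
  \<comment> \<open>Any index will do: the leading part is a scalar matrix, so one diagonal entry
    shows the symbol as a polynomial with smooth coefficients.\<close>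
  obtain i :: 'n where True by simp
  have formula: "psymb k T (x, covector_at A c x \<xi>) = (\<Sum>\<alpha>\<in>multi_indices (int k). coef c t (rev \<alpha>) T x $ i $ i * monomial \<alpha> \<xi>)"
    if c: "c \<in> A" "x \<in> fst c" and t: "t \<in> L" "x \<in> fst t" for c t x \<xi>
  proof -
    obtain u where u: "u \<in> covector_at A c x \<xi>" by (rule covector_nonempty[OF c])
    have "(symb k T u x *\<^sub>R (axis i 1 :: real^'n)) $ i =
        (\<Sum>\<alpha>\<in>multi_indices (int k). monomial \<alpha> \<xi> *\<^sub>R (coef c t (rev \<alpha>) T x *v axis i 1)) $ i"
      by (simp only: symb_local_expression[OF T P_local_expression[OF T c(1) t(1)] c t u])
    then show ?thesis
      by (simp add: psymb_covector[OF T c u] matrix_vector_mult_basis column_def mult.commute)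
  qed
  have "smooth_on (snd c ` fst c \<times> UNIV) (\<lambda>(y, \<xi>). psymb k T (chart_inv c y, covector_at A c (chart_inv c y) \<xi>))"
    if c: "c \<in> A" for c
  proof (rule smooth_on_local)
    fix p assume "p \<in> snd c ` fst c \<times> (UNIV :: 'b set)"
    then obtain x where x: "x \<in> fst c" "fst p = snd c x" by auto
    obtain t where t: "t \<in> L" "x \<in> fst t" by (rule triv_exists)
    let ?S = "snd c ` (fst c \<inter> fst t)"
    have oS: "open ?S" by (rule chart_image_open[OF c triv_open[OF t(1)]])
    then have o: "open (?S \<times> (UNIV :: 'b set))" by (simp add: open_Times)
    have cf: "smooth_on ?S (\<lambda>y. coef c t (rev \<alpha>) T (chart_inv c y) $ i $ i)" for \<alpha>
      by (intro smooth_on_linear_outer[OF oS bounded_linear_vec_nth]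
          smooth_on_subset[OF smooth_map_onD[OF coef_smooth[OF P_G[OF T] c t(1)] c]]) auto
    have "smooth_on (?S \<times> UNIV) (\<lambda>p. \<Sum>\<alpha>\<in>multi_indices (int k). coef c t (rev \<alpha>) T (chart_inv c (fst p)) $ i $ i * monomial \<alpha> (snd p))"
      by (intro smooth_on_sum o smooth_on_mult smooth_on_monomial smooth_on_fst[OF coord_basis oS cf])
    then have "smooth_on (?S \<times> UNIV) (\<lambda>(y, \<xi>). psymb k T (chart_inv c y, covector_at A c (chart_inv c y) \<xi>))"
    proof (rule smooth_on_eqI[OF _ o])
      fix p :: "'b \<times> 'b" assume "p \<in> ?S \<times> UNIV"
      then obtain z \<xi> where z: "z \<in> fst c" "z \<in> fst t" "p = (snd c z, \<xi>)" by auto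
      show "(\<Sum>\<alpha>\<in>multi_indices (int k). coef c t (rev \<alpha>) T (chart_inv c (fst p)) $ i $ i * monomial \<alpha> (snd p))
          = (case p of (y, \<xi>) \<Rightarrow> psymb k T (chart_inv c y, covector_at A c (chart_inv c y) \<xi>))"
        using formula[OF c z(1) t(1) z(2), of \<xi>] c z by simp
    qed
    moreover have "p \<in> ?S \<times> UNIV" using x t by (cases p) auto
    ultimately show "\<exists>V. open V \<and> p \<in> V \<and> smooth_on V (\<lambda>(y, \<xi>). psymb k T (chart_inv c y, covector_at A c (chart_inv c y) \<xi>))"
      using o by blast
  qed
  then have "psymb k T \<in> smooth_cofunctions A" by (simp add: smooth_cofunctions_def psymb_def)
  moreover have "\<exists>a. \<forall>\<xi>. psymb k T (x, covector_at A c x \<xi>) = (\<Sum>\<alpha>\<in>multi_indices (int k). a \<alpha> * monomial \<alpha> \<xi>)"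
    if "c \<in> A" "x \<in> fst c" for c x
  proof -
    obtain t where t: "t \<in> L" "x \<in> fst t" by (rule triv_exists)
    show ?thesis
      by (rule exI[of _ "\<lambda>\<alpha>. coef c t (rev \<alpha>) T x $ i $ i"], rule allI, rule formula[OF that t])
  qed
  ultimately show ?thesis by (simp add: Pol_degree_def)
qed

end

section \<open>Partitions of unity and quantization\<close>

text \<open>Words that differ by a permutation give the same monomial, so the spanning functions may
  be dependent; hence the span is used rather than coordinates.\<close>

definition lincombs :: "('i \<Rightarrow> 'x \<Rightarrow> real) \<Rightarrow> 'i set \<Rightarrow> ('x \<Rightarrow> real) set" where
  "lincombs f S = {\<lambda>\<xi>. \<Sum>i\<in>S. a i * f i \<xi> | a. True}"

lemma lincombsI: "(\<lambda>\<xi>. \<Sum>i\<in>S. a i * f i \<xi>) \<in> lincombs f S"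
  unfolding lincombs_def mem_Collect_eq by (rule exI[of _ a]) simp

lemma lincombsE:
  assumes "p \<in> lincombs f S" obtains a where "p = (\<lambda>\<xi>. \<Sum>i\<in>S. a i * f i \<xi>)"
  using assms unfolding lincombs_def mem_Collect_eq by (elim exE conjE)

lemma lincombs_add:
  assumes "p \<in> lincombs f S" "q \<in> lincombs f S" shows "(\<lambda>\<xi>. p \<xi> + q \<xi>) \<in> lincombs f S"
proof -
  obtain a where a: "p = (\<lambda>\<xi>. \<Sum>i\<in>S. a i * f i \<xi>)" by (rule lincombsE[OF assms(1)])
  obtain b where b: "q = (\<lambda>\<xi>. \<Sum>i\<in>S. b i * f i \<xi>)" by (rule lincombsE[OF assms(2)])
  have "(\<lambda>\<xi>. p \<xi> + q \<xi>) = (\<lambda>\<xi>. \<Sum>i\<in>S. (a i + b i) * f i \<xi>)"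
    by (simp add: a b sum.distrib[symmetric] distrib_right)
  then show ?thesis by (simp only: lincombsI)
qed

lemma lincombs_scale:
  assumes "p \<in> lincombs f S" shows "(\<lambda>\<xi>. r * p \<xi>) \<in> lincombs f S"
proof -
  obtain a where a: "p = (\<lambda>\<xi>. \<Sum>i\<in>S. a i * f i \<xi>)" by (rule lincombsE[OF assms])
  have "(\<lambda>\<xi>. r * p \<xi>) = (\<lambda>\<xi>. \<Sum>i\<in>S. (r * a i) * f i \<xi>)"
    by (simp add: a sum_distrib_left mult.assoc)
  then show ?thesis by (simp only: lincombsI)
qed

lemma lincombs_zero: "(\<lambda>\<xi>. 0) \<in> lincombs f S"
  using lincombsI[where S = S and a = "\<lambda>_. 0" and f = f] by simp

lemma lincombs_sum:
  "finite J \<Longrightarrow> (\<And>j. j \<in> J \<Longrightarrow> p j \<in> lincombs f S) \<Longrightarrow> (\<lambda>\<xi>. \<Sum>j\<in>J. p j \<xi>) \<in> lincombs f S"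
  by (induction J rule: finite_induct) (simp_all add: lincombs_zero lincombs_add)

lemma lincombs_insert:
  assumes "finite S" "s \<notin> S"
  shows "p \<in> lincombs f (insert s S) \<longleftrightarrow> (\<exists>p0\<in>lincombs f S. \<exists>r. p = (\<lambda>\<xi>. p0 \<xi> + r * f s \<xi>))"
proof
  assume "p \<in> lincombs f (insert s S)"
  then obtain a where "p = (\<lambda>\<xi>. \<Sum>i\<in>insert s S. a i * f i \<xi>)" by (rule lincombsE)
  then have "p = (\<lambda>\<xi>. (\<Sum>i\<in>S. a i * f i \<xi>) + a s * f s \<xi>)" using assms by (simp add: add.commute)
  then show "\<exists>p0\<in>lincombs f S. \<exists>r. p = (\<lambda>\<xi>. p0 \<xi> + r * f s \<xi>)"
    by (intro bexI[OF _ lincombsI[where S = S and a = a and f = f]] exI[of _ "a s"])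
next
  assume "\<exists>p0\<in>lincombs f S. \<exists>r. p = (\<lambda>\<xi>. p0 \<xi> + r * f s \<xi>)"
  then obtain p0 r where p0: "p0 \<in> lincombs f S" and p: "p = (\<lambda>\<xi>. p0 \<xi> + r * f s \<xi>)" by (elim bexE exE)
  obtain a where a: "p0 = (\<lambda>\<xi>. \<Sum>i\<in>S. a i * f i \<xi>)" by (rule lincombsE[OF p0])
  have "(\<Sum>i\<in>S. (a(s := r)) i * f i \<xi>) = (\<Sum>i\<in>S. a i * f i \<xi>)" for \<xi>
    by (rule sum.cong) (use assms in auto)
  then have "p = (\<lambda>\<xi>. \<Sum>i\<in>insert s S. (a(s := r)) i * f i \<xi>)" using assms by (simp add: p a add.commute)
  then show "p \<in> lincombs f (insert s S)" by (simp only: lincombsI)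
qed

text \<open>The interpolation formula expresses coefficients of a polynomial linearly in finitely many of
  its values; therefore they depend smoothly on parameters if the polynomial does.\<close>

lemma interpolation:
  fixes f :: "'i \<Rightarrow> 'x \<Rightarrow> real"
  assumes "finite S"
  shows "\<exists>(N::nat) pt q. (\<forall>j<N. q j \<in> lincombs f S) \<and>
    (\<forall>p\<in>lincombs f S. \<forall>\<xi>. p \<xi> = (\<Sum>j<N. p (pt j) * q j \<xi>))"
  using assms
proof induction
  case empty
  have "\<forall>p\<in>lincombs f {}. \<forall>\<xi>. p \<xi> = 0" by (auto elim!: lincombsE)
  then show ?case by (intro exI[of _ 0]) simp
next
  case (insert s S)
  obtain N pt q where q: "\<And>j. j < N \<Longrightarrow> q j \<in> lincombs f S"
    and p: "\<And>p \<xi>. p \<in> lincombs f S \<Longrightarrow> p \<xi> = (\<Sum>j<(N::nat). p (pt j) * q j \<xi>)"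
    using insert.IH by metis
  have sub: "lincombs f S \<subseteq> lincombs f (insert s S)"
  proof
    fix p assume "p \<in> lincombs f S"
    moreover have "p = (\<lambda>\<xi>. p \<xi> + 0 * f s \<xi>)" by simp
    ultimately show "p \<in> lincombs f (insert s S)" unfolding lincombs_insert[OF insert.hyps]
      by (intro bexI[of _ p] exI[of _ 0])
  qed
  have fs: "f s \<in> lincombs f (insert s S)"
    unfolding lincombs_insert[OF insert.hyps] by (rule bexI[OF _ lincombs_zero], rule exI[of _ 1]) simp
  define \<pi> where "\<pi> p \<xi> = (\<Sum>j<N. p (pt j) * q j \<xi>)" for p \<xi>
  \<comment> \<open>The part of the new function that interpolation at the old nodes misses. If it
    is identically zero, the old nodes suffice.\<close>
  define g where "g \<xi> = f s \<xi> - \<pi> (f s) \<xi>" for \<xi>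
  have \<pi>S: "(\<lambda>\<xi>. \<pi> p \<xi>) \<in> lincombs f (insert s S)" for p
    unfolding \<pi>_def using q sub by (intro lincombs_sum lincombs_scale) auto
  have gS: "g \<in> lincombs f (insert s S)"
    using lincombs_add[OF fs lincombs_scale[OF \<pi>S[of "f s"], of "-1"]] by (simp add: g_def[abs_def])
  have key: "\<exists>r. \<forall>\<xi>. p \<xi> = \<pi> p \<xi> + r * g \<xi>" if "p \<in> lincombs f (insert s S)" for p
  proof -
    obtain p0 r where p0: "p0 \<in> lincombs f S" "p = (\<lambda>\<xi>. p0 \<xi> + r * f s \<xi>)"
      using \<open>p \<in> lincombs f (insert s S)\<close> unfolding lincombs_insert[OF insert.hyps] by (elim bexE exE)
    have "\<pi> p \<xi> = \<pi> p0 \<xi> + r * \<pi> (f s) \<xi>" for \<xi>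
      unfolding \<pi>_def p0(2) by (simp add: sum.distrib sum_distrib_left algebra_simps)
    moreover have "\<pi> p0 \<xi> = p0 \<xi>" for \<xi> unfolding \<pi>_def by (rule p[OF p0(1), symmetric])
    ultimately have "p \<xi> = \<pi> p \<xi> + r * g \<xi>" for \<xi> by (simp add: p0(2) g_def algebra_simps)
    then show ?thesis by (intro exI[of _ r] allI)
  qed
  show ?case
  proof (cases "\<forall>\<xi>. g \<xi> = 0")
    case True
    have "p \<xi> = (\<Sum>j<N. p (pt j) * q j \<xi>)" if "p \<in> lincombs f (insert s S)" for p \<xi>
    proof -
      from key[OF that] obtain r where "\<forall>\<xi>. p \<xi> = \<pi> p \<xi> + r * g \<xi>" by (rule exE)
      from spec[OF this, of \<xi>] show ?thesis using True unfolding \<pi>_def by simp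
    qed
    moreover have "q j \<in> lincombs f (insert s S)" if "j < N" for j using q[OF that] sub by (rule rev_subsetD)
    ultimately show ?thesis by (intro exI[of _ N] exI[of _ pt] exI[of _ q] conjI allI impI ballI)
  next
    case False
    then obtain x0 where x0: "g x0 \<noteq> 0" by blast
    define pt' where "pt' j = (if j < N then pt j else x0)" for j
    \<comment> \<open>The new node \<open>x0\<close> is a point where the residual is nonzero. The
      old interpolating functions are corrected by multiples of \<open>g\<close> so as to vanish at
      \<open>x0\<close>.\<close>
    define q' where "q' j \<xi> = (if j < N then q j \<xi> + (- (q j x0 / g x0)) * g \<xi> else (1 / g x0) * g \<xi>)" for j \<xi>
    have "q' j \<in> lincombs f (insert s S)" for j
    proof (cases "j < N")
      case True
      then have eq: "q' j = (\<lambda>\<xi>. q j \<xi> + (- (q j x0 / g x0)) * g \<xi>)" by (simp add: q'_def fun_eq_iff)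
      have "q j \<in> lincombs f (insert s S)" using q[OF True] sub by (rule rev_subsetD)
      then show ?thesis unfolding eq by (rule lincombs_add[OF _ lincombs_scale[OF gS]])
    next
      case False
      then have eq: "q' j = (\<lambda>\<xi>. (1 / g x0) * g \<xi>)" by (simp add: q'_def fun_eq_iff)
      show ?thesis unfolding eq by (rule lincombs_scale[OF gS])
    qed
    moreover have "p \<xi> = (\<Sum>j<Suc N. p (pt' j) * q' j \<xi>)" if pS: "p \<in> lincombs f (insert s S)" for p \<xi>
    proof -
      from key[OF pS] obtain r where "\<forall>\<xi>. p \<xi> = \<pi> p \<xi> + r * g \<xi>" by (rule exE)
      then have r: "p \<xi> = \<pi> p \<xi> + r * g \<xi>" for \<xi> by (rule spec)
      have r': "r = (p x0 - \<pi> p x0) / g x0" using r[of x0] x0 by (simp add: field_simps)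
      have "(\<Sum>j<Suc N. p (pt' j) * q' j \<xi>) = (\<Sum>j<N. p (pt j) * (q j \<xi> + (- (q j x0 / g x0)) * g \<xi>)) + p x0 * ((1 / g x0) * g \<xi>)"
        by (simp add: pt'_def q'_def)
      also have "(\<Sum>j<N. p (pt j) * (q j \<xi> + (- (q j x0 / g x0)) * g \<xi>)) = \<pi> p \<xi> - \<pi> p x0 / g x0 * g \<xi>"
        by (simp add: \<pi>_def distrib_left sum.distrib sum_negf sum_distrib_right sum_divide_distrib
            right_diff_distrib sum_subtractf mult.assoc)
      also have "\<dots> + p x0 * ((1 / g x0) * g \<xi>) = p \<xi>"
        unfolding r[of \<xi>] r' using x0 by (simp add: field_simps)
      finally show ?thesis by simp
    qed
    ultimately show ?thesis by (intro exI[of _ "Suc N"] exI[of _ pt'] exI[of _ q'] conjI allI impI ballI)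
  qed
qed

text \<open>Composition of smooth maps requires an orthonormal basis of the outer domain, which is
  base times fiber when a fiberwise polynomial is restricted to constant \<xi>.\<close>

lemma is_coord_basis_prod:
  fixes B :: "'a::real_inner set"
  assumes "is_coord_basis B"
  shows "is_coord_basis ((\<lambda>b. (b, 0)) ` B \<union> (\<lambda>b. (0, b)) ` B :: ('a \<times> 'a) set)"
proof -
  let ?P = "(\<lambda>b. (b, 0)) ` B \<union> (\<lambda>b. (0, b)) ` B :: ('a \<times> 'a) set"
  have B: "finite B" "pairwise orthogonal B" "\<And>b. b \<in> B \<Longrightarrow> norm b = 1" "span B = UNIV"
    using assms by (auto simp: is_coord_basis_def)
  have "p \<in> span ?P" for p
  proof -
    have "(fst p, 0) = (\<Sum>b\<in>B. (fst p \<bullet> b) *\<^sub>R (b, 0 :: 'a))"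
      by (rule linear_coord_expand[OF assms, of "\<lambda>x. (x, 0)"]) (auto intro!: linearI)
    moreover have "(0, snd p) = (\<Sum>b\<in>B. (snd p \<bullet> b) *\<^sub>R (0 :: 'a, b))"
      by (rule linear_coord_expand[OF assms, of "\<lambda>x. (0, x)"]) (auto intro!: linearI)
    moreover have "(\<Sum>b\<in>B. (fst p \<bullet> b) *\<^sub>R (b, 0 :: 'a)) \<in> span ?P" "(\<Sum>b\<in>B. (snd p \<bullet> b) *\<^sub>R (0 :: 'a, b)) \<in> span ?P"
      by (intro span_sum span_scale span_base; blast)+
    ultimately have "(fst p, 0) + (0, snd p) \<in> span ?P" by (simp only: span_add)
    then show ?thesis by simp
  qed
  moreover have "pairwise orthogonal ?P"
    using B(2) by (auto simp: pairwise_def orthogonal_def) blast+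
  ultimately show ?thesis using B by (auto simp: is_coord_basis_def norm_Pair)
qed

context vector_bundle begin

lemma P_sum: "finite I \<Longrightarrow> (\<And>i. i \<in> I \<Longrightarrow> F i \<in> P k) \<Longrightarrow> op_sum I F \<in> P k"
  by (induction I rule: finite_induct) (simp_all add: op_sum_empty P_zero op_sum_insert P_add)

lemma symb_sum:
  assumes "finite I" "\<And>i. i \<in> I \<Longrightarrow> F i \<in> P k" "u \<in> Cinf"
  shows "symb k (op_sum I F) u x = (\<Sum>i\<in>I. symb k (F i) u x)"
  using assms(1,2)
  by (induction I rule: finite_induct) (simp_all add: op_sum_empty symb_zero assms(3) op_sum_insert symb_add P_sum)

text \<open>The coefficients are fixed linear combinations of the values of F at finitely many
  covectors whose components do not depend on the base point. Hence they are linear in F, for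
  arbitrary F, and smooth in the point when F is a smooth polynomial.\<close>

lemma Pol_degree_coefficients:
  assumes c: "c \<in> A"
  obtains a :: "'m cofunction \<Rightarrow> 'b list \<Rightarrow> 'm \<Rightarrow> real" where
    "\<And>F \<alpha>. F \<in> Pol_degree A k \<Longrightarrow> smooth_map_on A (fst c) (a F \<alpha>)"
    "\<And>F x \<xi>. F \<in> Pol_degree A k \<Longrightarrow> x \<in> fst c \<Longrightarrow>
       F (x, covector_at A c x \<xi>) = (\<Sum>\<alpha>\<in>multi_indices (int k). a F \<alpha> x * monomial \<alpha> \<xi>)"
    "\<And>F F' \<alpha> x. a (\<lambda>q. F q + F' q) \<alpha> x = a F \<alpha> x + a F' \<alpha> x"
    "\<And>F r \<alpha> x. a (\<lambda>q. r * F q) \<alpha> x = r * a F \<alpha> x"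
proof -
  let ?I = "multi_indices (int k) :: 'b list set"
  obtain N :: nat and pt :: "nat \<Rightarrow> 'b" and q where q: "\<And>j. j < N \<Longrightarrow> q j \<in> lincombs monomial ?I"
    and p: "\<And>p \<xi>. p \<in> lincombs monomial ?I \<Longrightarrow> p \<xi> = (\<Sum>j<N. p (pt j) * q j \<xi>)"
    using interpolation[OF finite_multi_indices(2)[of "int k"], of monomial] by metis
  have "\<exists>d. j < N \<longrightarrow> q j = (\<lambda>\<xi>. \<Sum>\<alpha>\<in>?I. d \<alpha> * monomial \<alpha> \<xi>)" for j
  proof (cases "j < N")
    case True
    obtain d where "q j = (\<lambda>\<xi>. \<Sum>\<alpha>\<in>?I. d \<alpha> * monomial \<alpha> \<xi>)" by (rule lincombsE[OF q[OF True]])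
    then show ?thesis by (intro exI[of _ d] impI)
  qed simp
  then have "\<forall>j. \<exists>d. j < N \<longrightarrow> q j = (\<lambda>\<xi>. \<Sum>\<alpha>\<in>?I. d \<alpha> * monomial \<alpha> \<xi>)" by (rule allI)
  from choice[OF this] obtain d where
    d: "\<forall>j. j < N \<longrightarrow> q j = (\<lambda>\<xi>. \<Sum>\<alpha>\<in>?I. d j \<alpha> * monomial \<alpha> \<xi>)" by (rule exE)
  define a where "a F \<alpha> x = (\<Sum>j<N. F (x, covector_at A c x (pt j)) * d j \<alpha>)" for F :: "'m cofunction" and \<alpha> x
  show ?thesis
  proof (rule that[of a])
    fix F x \<xi> assume F: "F \<in> Pol_degree A k" and x: "x \<in> fst c"
    obtain e where "\<And>\<xi>. F (x, covector_at A c x \<xi>) = (\<Sum>\<alpha>\<in>?I. e \<alpha> * monomial \<alpha> \<xi>)"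
      using F c x unfolding Pol_degree_def mem_Collect_eq by metis
    then have "(\<lambda>\<xi>. F (x, covector_at A c x \<xi>)) \<in> lincombs monomial ?I" by (simp add: lincombsI)
    then have "F (x, covector_at A c x \<xi>) = (\<Sum>j<N. F (x, covector_at A c x (pt j)) * q j \<xi>)" by (rule p)
    also have "\<dots> = (\<Sum>j<N. F (x, covector_at A c x (pt j)) * (\<Sum>\<alpha>\<in>?I. d j \<alpha> * monomial \<alpha> \<xi>))"
      by (rule sum.cong) (simp_all add: d)
    also have "\<dots> = (\<Sum>\<alpha>\<in>?I. a F \<alpha> x * monomial \<alpha> \<xi>)"
      unfolding a_def sum_distrib_left sum_distrib_right mult.assoc by (rule sum.swap)
    finally show "F (x, covector_at A c x \<xi>) = (\<Sum>\<alpha>\<in>?I. a F \<alpha> x * monomial \<alpha> \<xi>)" .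
  next
    fix F \<alpha> assume F: "F \<in> Pol_degree A k"
    let ?S = "snd c ` fst c"
    have oS: "open ?S" by (rule chart_range_open[OF c])
    have "smooth_on (?S \<times> UNIV) (\<lambda>(y, \<xi>). F (chart_inv c y, covector_at A c (chart_inv c y) \<xi>))"
      using F c by (simp add: Pol_degree_def smooth_cofunctions_def)
    moreover have "smooth_on ?S (\<lambda>y. (y, 0) + (0 :: 'b, \<xi>))" for \<xi> :: 'b
      by (rule smooth_on_add[OF oS smooth_on_linear[OF oS
              bounded_linear_Pair[OF bounded_linear_ident bounded_linear_zero]] smooth_on_const])
    ultimately have sm: "smooth_on ?S (\<lambda>y. (\<lambda>(y, \<xi>). F (chart_inv c y, covector_at A c (chart_inv c y) \<xi>)) ((y, 0) + (0, \<xi>)))" for \<xi>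
      by (rule smooth_on_compose[OF is_coord_basis_prod[OF coord_basis] oS open_Times[OF oS open_UNIV]])
        auto
    have "smooth_map_on A (fst c) (\<lambda>x. F (x, covector_at A c x \<xi>))" for \<xi>
      by (rule smooth_map_chart[OF c chart_open[OF c] order_refl]) (use sm[of \<xi>] in \<open>simp add: add_Pair\<close>)
    then show "smooth_map_on A (fst c) (a F \<alpha>)"
      unfolding a_def[abs_def] by (intro smooth_map_sum smooth_map_mult smooth_map_const chart_open c)
  qed (simp_all add: a_def sum.distrib distrib_right sum_distrib_left mult.assoc)
qed

section \<open>Cut-off derivatives and quantization over one chart\<close>

definition dloc :: "('m, 'b) chart \<Rightarrow> ('m, 'n, 'v) triv \<Rightarrow> 'b \<Rightarrow> ('m \<Rightarrow> 'v) \<Rightarrow> 'm \<Rightarrow> (real, 'n) vec" where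
  "dloc c t b s z = frechet_derivative (loc t s \<circ> chart_inv c) (at (snd c z)) b"

definition dfun :: "('m, 'b) chart \<Rightarrow> 'b \<Rightarrow> ('m \<Rightarrow> real) \<Rightarrow> 'm \<Rightarrow> real" where
  "dfun c b u z = frechet_derivative (u \<circ> chart_inv c) (at (snd c z)) b"

lemma dloc_derivative:
  assumes "c \<in> A" "t \<in> L" "s \<in> \<Gamma>" "z \<in> fst c" "z \<in> fst t"
  shows "((loc t s \<circ> chart_inv c) has_derivative frechet_derivative (loc t s \<circ> chart_inv c) (at (snd c z))) (at (snd c z))"
  by (rule smooth_on_has_derivative[OF loc_chart_smooth[OF assms(1-3)]]) (use assms in blast)

lemma dloc_add:
  assumes c: "c \<in> A" and t: "t \<in> L" and s: "s \<in> \<Gamma>" "s' \<in> \<Gamma>" and z: "z \<in> fst c" "z \<in> fst t"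
  shows "dloc c t b (\<lambda>x. s x + s' x) z = dloc c t b s z + dloc c t b s' z"
proof -
  have oS: "open (snd c ` (fst c \<inter> fst t))" by (rule chart_image_open[OF c triv_open[OF t]])
  have zS: "snd c z \<in> snd c ` (fst c \<inter> fst t)" using z by blast
  have "((loc t (\<lambda>x. s x + s' x) \<circ> chart_inv c) has_derivative
    (\<lambda>v. frechet_derivative (loc t s \<circ> chart_inv c) (at (snd c z)) v + frechet_derivative (loc t s' \<circ> chart_inv c) (at (snd c z)) v)) (at (snd c z))"
    by (rule has_derivative_transform_within_open[OF has_derivative_add[OF dloc_derivative[OF c t s(1) z] dloc_derivative[OF c t s(2) z]] oS zS])
      (use c in \<open>auto simp: loc_add[OF t _ section_fiber[OF s(1)] section_fiber[OF s(2)]]\<close>)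
  then show ?thesis unfolding dloc_def by (rule frechet_derivative_eq)
qed

lemma dloc_mult:
  assumes c: "c \<in> A" and t: "t \<in> L" and s: "s \<in> \<Gamma>" "u \<in> Cinf" and z: "z \<in> fst c" "z \<in> fst t"
  shows "dloc c t b (\<lambda>x. u x *\<^sub>R s x) z = u z *\<^sub>R dloc c t b s z + dfun c b u z *\<^sub>R loc t s z"
proof -
  have oS: "open (snd c ` (fst c \<inter> fst t))" by (rule chart_image_open[OF c triv_open[OF t]])
  have zS: "snd c z \<in> snd c ` (fst c \<inter> fst t)" using z by blast
  have "((loc t (\<lambda>x. u x *\<^sub>R s x) \<circ> chart_inv c) has_derivative
    (\<lambda>v. (u \<circ> chart_inv c) (snd c z) *\<^sub>R frechet_derivative (loc t s \<circ> chart_inv c) (at (snd c z)) v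
       + frechet_derivative (u \<circ> chart_inv c) (at (snd c z)) v *\<^sub>R (loc t s \<circ> chart_inv c) (snd c z))) (at (snd c z))"
    by (rule has_derivative_transform_within_open[OF has_derivative_scaleR[OF chart_derivative[OF s(2) c z(1)] dloc_derivative[OF c t s(1) z]] oS zS])
      (use c in \<open>auto simp: loc_scale[OF t _ section_fiber[OF s(1)]]\<close>)
  from frechet_derivative_eq[OF this, of b] show ?thesis using c z by (simp add: dloc_def dfun_def)
qed

lemma smooth_map_derivative:
  assumes c: "c \<in> A" and W: "open W" "W \<subseteq> fst c" and f: "smooth_map_on A W f"
  shows "smooth_map_on A W (\<lambda>z. frechet_derivative (f \<circ> chart_inv c) (at (snd c z)) b)"
proof (rule smooth_map_chart[OF c W])
  have o: "open (snd c ` W)" using chart_image_open[OF c W(1)] W(2) by (simp add: Int_absorb1)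
  have "smooth_on (snd c ` W) (f \<circ> chart_inv c)"
    using smooth_map_onD[OF f c] W(2) by (simp add: Int_absorb1 o_def)
  from smooth_on_derivative[OF this, of b]
  show "smooth_on (snd c ` W) (\<lambda>y. frechet_derivative (f \<circ> chart_inv c) (at (snd c (chart_inv c y))) b)"
    by (rule smooth_on_eqI[OF _ o]) (use c W(2) in auto)
qed

text \<open>The directional derivative along a coordinate vector, taken with the flat connection of
  the trivialization and multiplied by the cutoff \<theta>; a global operator whose commutators with
  functions are multiplications.\<close>

definition nabla :: "('m, 'b) chart \<Rightarrow> ('m, 'n, 'v) triv \<Rightarrow> ('m \<Rightarrow> real) \<Rightarrow> 'm set \<Rightarrow> 'b \<Rightarrow> ('m, 'v) operator" where
  "nabla c t \<theta> C b s = (if s \<in> \<Gamma> then frame_section t C (\<lambda>z. \<theta> z *\<^sub>R dloc c t b s z) else (\<lambda>x. 0))"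

context
  fixes c :: "('m, 'b) chart" and t :: "('m, 'n, 'v) triv" and \<theta> :: "'m \<Rightarrow> real" and C :: "'m set"
  assumes c: "c \<in> A" and t: "t \<in> L" and \<theta>: "\<theta> \<in> Cinf" and C: "closed C" "C \<subseteq> fst c \<inter> fst t"
    and \<theta>0: "\<And>z. z \<notin> C \<Longrightarrow> \<theta> z = 0"
begin

lemma nabla_apply: "s \<in> \<Gamma> \<Longrightarrow> nabla c t \<theta> C b s z = (if z \<in> C then \<theta> z *\<^sub>R snd t z (dloc c t b s z) else 0)"
  using C(2) linear_scale[OF triv_linear[OF t]] by (auto simp: nabla_def frame_section_def)

lemma nabla_section: "s \<in> \<Gamma> \<Longrightarrow> nabla c t \<theta> C b s \<in> \<Gamma>"
proof -
  assume s: "s \<in> \<Gamma>"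
  have o: "open (fst c \<inter> fst t)" by (intro open_Int chart_open[OF c] triv_open[OF t])
  have "smooth_map_on A (fst c \<inter> fst t) (\<lambda>z. \<theta> z *\<^sub>R dloc c t b s z)"
    unfolding dloc_def
    by (intro smooth_map_scaleR o smooth_map_derivative[OF c o inf_le1] smooth_map_subset[OF loc_smooth[OF s t] inf_le2]
        smooth_map_subset[OF \<theta>[unfolded smooth_functions_iff]]) simp
  then have "frame_section t C (\<lambda>z. \<theta> z *\<^sub>R dloc c t b s z) \<in> \<Gamma>"
    by (rule frame_section_in[OF t o inf_le2 C]) (simp add: \<theta>0)
  then show ?thesis using s by (simp add: nabla_def)
qed

lemma dfun_smooth: "u \<in> Cinf \<Longrightarrow> (\<lambda>z. \<theta> z * dfun c b u z) \<in> Cinf"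
proof -
  assume u: "u \<in> Cinf"
  have o: "open (fst c)" by (rule chart_open[OF c])
  have "smooth_map_on A (fst c) (\<lambda>z. \<theta> z * dfun c b u z)"
    unfolding dfun_def
    by (intro smooth_map_mult o smooth_map_derivative[OF c o order_refl] smooth_map_subset[OF u[unfolded smooth_functions_iff]]
        smooth_map_subset[OF \<theta>[unfolded smooth_functions_iff]]) simp_all
  then show ?thesis unfolding smooth_functions_iff
    by (rule smooth_map_extend[OF _ o C(1)]) (use C(2) \<theta>0 in auto)
qed

lemma nabla_mult:
  assumes "s \<in> \<Gamma>" "u \<in> Cinf"
  shows "nabla c t \<theta> C b (\<lambda>x. u x *\<^sub>R s x) z = u z *\<^sub>R nabla c t \<theta> C b s z + (\<theta> z * dfun c b u z) *\<^sub>R s z"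
proof (cases "z \<in> C")
  case True
  then have z: "z \<in> fst c" "z \<in> fst t" using C(2) by auto
  have lin: "linear (snd t z)" by (rule triv_linear[OF t z(2)])
  show ?thesis
    using True by (simp add: nabla_apply section_mult assms dloc_mult[OF c t assms z] linear_add[OF lin] linear_scale[OF lin]
        loc_inverse[where s = s, OF t z(2) section_fiber[OF assms(1)]] scaleR_add_right mult.commute)
next
  case False
  then show ?thesis by (simp add: nabla_apply section_mult assms \<theta>0)
qed

lemma nabla_End: "nabla c t \<theta> C b \<in> \<E>"
proof (rule EndI)
  show "nabla c t \<theta> C b s = (\<lambda>x. 0)" if "s \<notin> \<Gamma>" for s using that by (simp add: nabla_def)
  show "nabla c t \<theta> C b (\<lambda>x. s x + s' x) = (\<lambda>x. nabla c t \<theta> C b s x + nabla c t \<theta> C b s' x)"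
    if s: "s \<in> \<Gamma>" "s' \<in> \<Gamma>" for s s'
  proof
    fix z show "nabla c t \<theta> C b (\<lambda>x. s x + s' x) z = nabla c t \<theta> C b s z + nabla c t \<theta> C b s' z"
    proof (cases "z \<in> C")
      case True
      then have z: "z \<in> fst c" "z \<in> fst t" using C(2) by auto
      show ?thesis using True
        by (simp add: nabla_apply section_add s dloc_add[OF c t s z] linear_add[OF triv_linear[OF t z(2)]] scaleR_add_right)
    qed (simp add: nabla_apply section_add s)
  qed
  show "nabla c t \<theta> C b (\<lambda>x. r *\<^sub>R s x) = (\<lambda>x. r *\<^sub>R nabla c t \<theta> C b s x)" if s: "s \<in> \<Gamma>" for r s
  proof
    fix z
    have "dfun c b (\<lambda>x. r) z = 0" by (simp add: dfun_def o_def)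
    then show "nabla c t \<theta> C b (\<lambda>x. r *\<^sub>R s x) z = r *\<^sub>R nabla c t \<theta> C b s z"
      using nabla_mult[OF s smooth_functions_const, of b r z] by simp
  qed
qed (fact nabla_section)

lemma ad_nabla: "u \<in> Cinf \<Longrightarrow> ad u (nabla c t \<theta> C b) = mu (\<lambda>z. \<theta> z * dfun c b u z)"
  by (rule End_eqI) (simp_all add: commutator_End nabla_End mu_End dfun_smooth ad_apply nabla_mult mu_apply)

lemma nabla_P: "nabla c t \<theta> C b \<in> P (Suc 0)"
  by (rule P_SucI[OF nabla_End]) (auto simp: ad_nabla P_0 intro: dfun_smooth)

lemma symb_nabla: "u \<in> Cinf \<Longrightarrow> symb (Suc 0) (nabla c t \<theta> C b) u x = \<theta> x * dfun c b u x"
  by (simp add: ad_nabla symb_mu del: symb.simps(1))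

primrec nablas :: "'b list \<Rightarrow> ('m, 'v) operator" where
  "nablas [] = mu (\<lambda>x. 1)"
| "nablas (b # \<alpha>) = nabla c t \<theta> C b \<circ> nablas \<alpha>"

lemma nablas_P: "nablas \<alpha> \<in> P (length \<alpha>)"
proof (induction \<alpha>)
  case Nil show ?case by (auto simp: P_0 intro: smooth_functions_const)
next
  case (Cons b \<alpha>)
  have "nabla c t \<theta> C b \<circ> nablas \<alpha> \<in> P (Suc 0 + length \<alpha>)" by (rule P_comp[OF nabla_P Cons])
  then show ?case unfolding nablas.simps by (simp only: list.size add_Suc add_0 add_Suc_right add_0_right)
qed

lemma symb_nablas:
  assumes "u \<in> Cinf"
  shows "symb (length \<alpha>) (nablas \<alpha>) u x = (\<Prod>b\<leftarrow>\<alpha>. \<theta> x * dfun c b u x)"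
proof (induction \<alpha>)
  case Nil show ?case by (simp add: symb_mu del: symb.simps)
next
  case (Cons b \<alpha>)
  have "symb (Suc 0 + length \<alpha>) (nabla c t \<theta> C b \<circ> nablas \<alpha>) u x
      = symb (Suc 0) (nabla c t \<theta> C b) u x * symb (length \<alpha>) (nablas \<alpha>) u x"
    by (rule symb_comp[OF nabla_P nablas_P assms])
  then show ?case unfolding Cons symb_nabla[OF assms] by (simp add: comp_def del: symb.simps)
qed

text \<open>Each covector variable is replaced by a cut-off derivative, with coefficients on the
  left. The cutoff \<theta> equals 1 on a set containing the support of \<rho>, so it leaves no
  trace in the symbol. The factor \<rho> in front gives the pointwise vanishing that makes infinite
  sums locally finite.\<close>

lemma local_quantization:
  assumes K: "closed K" "\<And>z. z \<in> K \<Longrightarrow> \<theta> z = 1" and \<rho>: "\<rho> \<in> Cinf" "\<And>z. z \<notin> K \<Longrightarrow> \<rho> z = 0"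
  shows "\<exists>Op. (\<forall>F\<in>Pol_degree A k. Op F \<in> P k \<and>
        (\<forall>u\<in>Cinf. \<forall>z. symb k (Op F) u z = \<rho> z * F (z, differential_at A z u))) \<and>
      (\<forall>F F'. Op (\<lambda>q. F q + F' q) = op_add (Op F) (Op F')) \<and>
      (\<forall>r F. Op (\<lambda>q. r * F q) = op_scale r (Op F)) \<and>
      (\<forall>F s z. \<rho> z = 0 \<longrightarrow> Op F s z = 0)"
proof -
  have KC: "K \<subseteq> C" using K(2) \<theta>0 by fastforce
  obtain a where a: "\<And>F \<alpha>. F \<in> Pol_degree A k \<Longrightarrow> smooth_map_on A (fst c) (a F \<alpha>)"
    "\<And>F x \<xi>. F \<in> Pol_degree A k \<Longrightarrow> x \<in> fst c \<Longrightarrow>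
       F (x, covector_at A c x \<xi>) = (\<Sum>\<alpha>\<in>multi_indices (int k). a F \<alpha> x * monomial \<alpha> \<xi>)"
    "\<And>F F' \<alpha> x. a (\<lambda>q. F q + F' q) \<alpha> x = a F \<alpha> x + a F' \<alpha> x"
    "\<And>F r \<alpha> x. a (\<lambda>q. r * F q) \<alpha> x = r * a F \<alpha> x"
    by (rule Pol_degree_coefficients[OF c, of k]) blast
  let ?I = "multi_indices (int k) :: 'b list set"
  define Op where "Op F = op_sum ?I (\<lambda>\<alpha>. mu (\<lambda>z. \<rho> z * a F \<alpha> z) \<circ> nablas \<alpha>)" for F
  have len: "length \<alpha> = k" if "\<alpha> \<in> ?I" for \<alpha> using that by (simp add: multi_indices_def)
  have nS: "nablas \<alpha> s \<in> \<Gamma>" if "s \<in> \<Gamma>" for \<alpha> s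
    by (rule End_closed[OF P_End[OF nablas_P] that])
  have n0: "nablas \<alpha> s = (\<lambda>x. 0)" if "s \<notin> \<Gamma>" for \<alpha> s
    by (rule End_out[OF P_End[OF nablas_P] that])
  have Op_apply: "Op F s z = (\<Sum>\<alpha>\<in>?I. (\<rho> z * a F \<alpha> z) *\<^sub>R nablas \<alpha> s z)" for F s z
  proof (cases "s \<in> \<Gamma>")
    case True
    then show ?thesis by (simp add: Op_def op_sum_apply mu_apply nS)
  next
    case False
    then show ?thesis by (simp add: Op_def op_sum_apply n0 mu_apply section_0)
  qed
  have "Op F \<in> P k \<and> (\<forall>u\<in>Cinf. \<forall>z. symb k (Op F) u z = \<rho> z * F (z, differential_at A z u))"
    if F: "F \<in> Pol_degree A k" for F
  proof -
    have co: "(\<lambda>z. \<rho> z * a F \<alpha> z) \<in> Cinf" for \<alpha>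
      unfolding smooth_functions_iff
    proof (rule smooth_map_extend[OF _ chart_open[OF c] K(1)])
      show "smooth_map_on A (fst c) (\<lambda>z. \<rho> z * a F \<alpha> z)"
        by (intro smooth_map_mult chart_open c a(1)[OF F] smooth_map_subset[OF \<rho>(1)[unfolded smooth_functions_iff]]) simp
    qed (use KC C(2) \<rho>(2) in auto)
    have term_P: "mu (\<lambda>z. \<rho> z * a F \<alpha> z) \<circ> nablas \<alpha> \<in> P k" if "\<alpha> \<in> ?I" for \<alpha>
      using P_comp[of "mu (\<lambda>z. \<rho> z * a F \<alpha> z)" 0, OF _ nablas_P] co len[OF that] by (auto simp: P_0)
    have "symb k (Op F) u z = \<rho> z * F (z, differential_at A z u)" if u: "u \<in> Cinf" for u z
    proof -
      have "symb k (Op F) u z = (\<Sum>\<alpha>\<in>?I. symb k (mu (\<lambda>z. \<rho> z * a F \<alpha> z) \<circ> nablas \<alpha>) u z)"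
        unfolding Op_def by (rule symb_sum[OF finite_multi_indices(2) term_P u])
      also have "\<dots> = (\<Sum>\<alpha>\<in>?I. (\<rho> z * a F \<alpha> z) * (\<Prod>b\<leftarrow>\<alpha>. \<theta> z * dfun c b u z))"
      proof (rule sum.cong[OF refl])
        fix \<alpha> assume \<alpha>: "\<alpha> \<in> ?I"
        have "mu (\<lambda>z. \<rho> z * a F \<alpha> z) \<in> P 0" unfolding P_0 by (rule bexI[OF refl co])
        from symb_comp[OF this nablas_P u, of \<alpha> z] symb_nablas[OF u, of \<alpha> z]
        show "symb k (mu (\<lambda>z. \<rho> z * a F \<alpha> z) \<circ> nablas \<alpha>) u z = (\<rho> z * a F \<alpha> z) * (\<Prod>b\<leftarrow>\<alpha>. \<theta> z * dfun c b u z)"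
          unfolding symb_mu len[OF \<alpha>] add_0 by (simp only:)
      qed
      also have "\<dots> = \<rho> z * F (z, differential_at A z u)"
      proof (cases "z \<in> K")
        case True
        then have z: "z \<in> fst c" using KC C(2) by blast
        obtain \<xi> where \<xi>: "u \<in> covector_at A c z \<xi>" by (rule covector_of_function[OF u c z])
        have "dfun c b u z = \<xi> \<bullet> b" for b
          unfolding dfun_def by (rule frechet_derivative_eq) (use \<xi> in \<open>simp add: covector_at_def comp_def\<close>)
        then have "(\<Sum>\<alpha>\<in>?I. (\<rho> z * a F \<alpha> z) * (\<Prod>b\<leftarrow>\<alpha>. \<theta> z * dfun c b u z))
            = \<rho> z * (\<Sum>\<alpha>\<in>?I. a F \<alpha> z * monomial \<alpha> \<xi>)"
          using K(2)[OF True] by (simp add: monomial_def sum_distrib_left mult.assoc)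
        then show ?thesis using a(2)[OF F z, of \<xi>] differential_at_covector[OF c z \<xi>] by simp
      qed (simp add: \<rho>(2))
      finally show ?thesis .
    qed
    moreover have "Op F \<in> P k" unfolding Op_def by (rule P_sum[OF finite_multi_indices(2) term_P])
    ultimately show ?thesis by blast
  qed
  moreover have "Op (\<lambda>q. F q + F' q) = op_add (Op F) (Op F')" for F F'
    by (intro ext) (simp add: Op_apply op_add_apply a(3) distrib_left scaleR_add_left sum.distrib)
  moreover have "Op (\<lambda>q. r * F q) = op_scale r (Op F)" for r F
    by (intro ext) (simp add: Op_apply op_scale_apply a(4) scaleR_sum_right mult.left_commute)
  moreover have "Op F s z = 0" if "\<rho> z = 0" for F s z using that by (simp add: Op_apply)
  ultimately show ?thesis by blast
qed

end

text \<open>Agreement on \<open>V\<close> passes to commutators with the same function, down to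
  degree 0, where a section nonzero at \<open>x\<close> compares the scalars.\<close>

lemma symb_germ:
  assumes "T \<in> P k" "D \<in> P k" "u \<in> Cinf" "x \<in> V" "\<And>s z. s \<in> \<Gamma> \<Longrightarrow> z \<in> V \<Longrightarrow> T s z = D s z"
  shows "symb k T u x = symb k D u x"
  using assms(1,2,5)
proof (induction k arbitrary: T D)
  case 0
  obtain s where s: "s \<in> \<Gamma>" "s x \<noteq> 0" by (rule nonvanishing_section)
  have "symb 0 T u x *\<^sub>R s x = symb 0 D u x *\<^sub>R s x"
    using 0(3)[OF s(1) assms(4)] by (simp only: symb_0_eq[OF 0(1) s(1), symmetric] symb_0_eq[OF 0(2) s(1), symmetric])
  then show ?case using s(2) by (simp del: symb.simps)
next
  case (Suc k)
  have "symb k (ad u T) u x = symb k (ad u D) u x"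
  proof (rule Suc.IH)
    show "ad u T s z = ad u D s z" if "s \<in> \<Gamma>" "z \<in> V" for s z
      using Suc.prems(3)[OF section_mult[OF assms(3) that(1)] that(2)] Suc.prems(3)[OF that]
      by (simp add: ad_apply[OF P_End[OF Suc.prems(1)] that(1)] ad_apply[OF P_End[OF Suc.prems(2)] that(1)])
  qed (intro P_ad Suc.prems assms)+
  then show ?case by simp
qed

text \<open>Membership in \<open>P k\<close> is a local property. Commutators of \<open>T\<close>
  agree on \<open>V i\<close> with those of \<open>D i\<close>, which drives the induction; in
  degree 0 the local multipliers coincide on overlaps.\<close>

lemma P_glue:
  fixes V :: "'i \<Rightarrow> 'm set"
  assumes "\<And>i. open (V i)" "(\<Union>i. V i) = UNIV" "\<And>i. D i \<in> P k"
    "\<And>i s z. s \<in> \<Gamma> \<Longrightarrow> z \<in> V i \<Longrightarrow> T s z = D i s z" "\<And>s. s \<notin> \<Gamma> \<Longrightarrow> T s = (\<lambda>x. 0)"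
  shows "T \<in> P k"
proof -
  define n where "n z = (SOME i. z \<in> V i)" for z
  have n: "z \<in> V (n z)" for z
  proof -
    have "\<exists>i. z \<in> V i" using assms(2) by blast
    then show ?thesis unfolding n_def by (rule someI_ex)
  qed
  \<comment> \<open>Stated for arbitrary degree and families because it is used again for each
    operator met in the induction.\<close>
  have TE: "T \<in> \<E>" if D: "\<And>i. D i \<in> P k" and T: "\<And>i s z. s \<in> \<Gamma> \<Longrightarrow> z \<in> V i \<Longrightarrow> T s z = D i s z"
    "\<And>s. s \<notin> \<Gamma> \<Longrightarrow> T s = (\<lambda>x. 0)" for D k T
  proof (rule EndI)
    have DE: "D i \<in> \<E>" for i by (rule P_End[OF D])
    show "T s \<in> \<Gamma>" if s: "s \<in> \<Gamma>" for s
    proof (rule section_localI)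
      fix x show "\<exists>s'\<in>\<Gamma>. \<exists>V. open V \<and> x \<in> V \<and> (\<forall>z\<in>V. T s z = s' z)"
        using End_closed[OF DE[of "n x"] s] assms(1)[of "n x"] n[of x] T(1)[OF s] by blast
    qed
    show "T (\<lambda>x. s x + s' x) = (\<lambda>x. T s x + T s' x)" if s: "s \<in> \<Gamma>" "s' \<in> \<Gamma>" for s s'
      using End_add[OF DE s] T(1)[OF _ n] by (auto simp: fun_eq_iff section_add s)
    show "T (\<lambda>x. r *\<^sub>R s x) = (\<lambda>x. r *\<^sub>R T s x)" if s: "s \<in> \<Gamma>" for r s
      using End_scale[OF DE s] T(1)[OF _ n] by (auto simp: fun_eq_iff section_scale s)
  qed (fact T(2))
  show ?thesis
    using assms(3-5)
  proof (induction k arbitrary: D T)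
    case 0
    have "\<exists>w. w \<in> Cinf \<and> D i = mu w" for i using 0(1)[of i] by (auto simp: P_0)
    then obtain w where w: "\<And>i. w i \<in> Cinf" "\<And>i. D i = mu (w i)" by metis
    have Tw: "T s z = w i z *\<^sub>R s z" if "s \<in> \<Gamma>" "z \<in> V i" for s z i
      using 0(2)[OF that] by (simp add: w(2) mu_apply that(1))
    define w' where "w' z = w (n z) z" for z
    have w': "w' z = w i z" if z: "z \<in> V i" for z i
    proof -
      obtain s where s: "s \<in> \<Gamma>" "s z \<noteq> 0" by (rule nonvanishing_section)
      have "w (n z) z *\<^sub>R s z = w i z *\<^sub>R s z" using Tw[OF s(1) n] Tw[OF s(1) z] by simp
      then show ?thesis using s(2) by (simp add: w'_def)
    qed
    have "w' \<in> Cinf"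
      unfolding smooth_functions_iff
    proof (rule smooth_map_local)
      fix x
      have "smooth_map_on A (V (n x)) (w (n x))"
        by (rule smooth_map_subset[OF w(1)[unfolded smooth_functions_iff]]) simp
      then have "smooth_map_on A (V (n x)) w'"
        by (rule smooth_map_eqI[OF _ assms(1)]) (simp add: w')
      then show "\<exists>V. open V \<and> x \<in> V \<and> smooth_map_on A V w'" using assms(1) n by blast
    qed
    moreover have "T = mu w'"
    proof (rule End_eqI[OF TE[OF 0] mu_End[OF \<open>w' \<in> Cinf\<close>]])
      fix s x assume s: "s \<in> \<Gamma>"
      show "T s x = mu w' s x" using Tw[OF s n, of x] by (simp add: mu_apply[OF s] w'_def)
    qed
    ultimately show ?case by (auto simp: P_0)
  next
    case (Suc k)
    note E = TE[OF Suc.prems]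
    show ?case
    proof (rule P_SucI[OF E])
      fix u assume u: "u \<in> Cinf"
      show "ad u T \<in> P k"
      proof (rule Suc.IH[of "\<lambda>i. ad u (D i)"])
        show "ad u (D i) \<in> P k" for i by (rule P_ad[OF Suc.prems(1) u])
        show "ad u T s z = ad u (D i) s z" if "s \<in> \<Gamma>" "z \<in> V i" for i s z
          using Suc.prems(2)[OF section_mult[OF u that(1)] that(2)] Suc.prems(2)[OF that]
          by (simp add: ad_apply[OF E that(1)] ad_apply[OF P_End[OF Suc.prems(1)] that(1)])
        show "ad u T s = (\<lambda>x. 0)" if "s \<notin> \<Gamma>" for s
          by (rule End_out[OF commutator_End[OF E mu_End[OF u]] that])
      qed
    qed
  qed
qed

text \<open>The partition of unity \<open>\<rho>\<^sub>j = f\<^sub>j \<Prod>\<^sub>i\<^sub><\<^sub>j (1 - f\<^sub>i)\<close> is locally finite because the sets on which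
  \<open>f\<^sub>i = 1\<close> already cover the manifold.\<close>

lemma quantization:
  obtains Q :: "'m cofunction \<Rightarrow> ('m, 'v) operator" where
    "\<And>F. F \<in> Pol_degree A k \<Longrightarrow> Q F \<in> P k \<and> psymb k (Q F) = F"
    "\<And>F F'. Q (\<lambda>q. F q + F' q) = op_add (Q F) (Q F')"
    "\<And>r F. Q (\<lambda>q. r * F q) = op_scale r (Q F)"
proof -
  \<comment> \<open>Three nested regions: f is 1 on V and supported in K, and a second cutoff
    \<theta>, supported in one chart and one trivialization, is 1 on K, as
    \<open>local_quantization\<close> demands.\<close>
  define good where "good f V K \<longleftrightarrow> f \<in> Cinf \<and> open V \<and> closed K \<and> (\<forall>z\<in>V. f z = 1) \<and> (\<forall>z. z \<notin> K \<longrightarrow> f z = 0) \<and>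
     (\<exists>c t \<theta> C. c \<in> A \<and> t \<in> L \<and> \<theta> \<in> Cinf \<and> closed C \<and> C \<subseteq> fst c \<inter> fst t \<and> (\<forall>z. z \<notin> C \<longrightarrow> \<theta> z = 0) \<and> (\<forall>z\<in>K. \<theta> z = 1))"
    for f :: "'m \<Rightarrow> real" and V K
  have "\<exists>f V K. good f V K \<and> x \<in> V" for x
  proof -
    obtain c where c: "c \<in> A" "x \<in> fst c" by (rule chart_exists)
    obtain t where t: "t \<in> L" "x \<in> fst t" by (rule triv_exists)
    have o: "open (fst c \<inter> fst t)" "x \<in> fst c \<inter> fst t"
      using chart_open[OF c(1)] triv_open[OF t(1)] c t by auto
    obtain \<theta> N C where \<theta>: "\<theta> \<in> Cinf" "open N" "closed C" "x \<in> N" "N \<subseteq> C" "C \<subseteq> fst c \<inter> fst t"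
      "\<And>z. z \<in> N \<Longrightarrow> \<theta> z = 1" "\<And>z. z \<notin> C \<Longrightarrow> \<theta> z = 0"
      by (rule bump_on_manifold[OF o]) blast
    obtain f V K where f: "f \<in> Cinf" "open V" "closed K" "x \<in> V" "V \<subseteq> K" "K \<subseteq> N"
      "\<And>z. z \<in> V \<Longrightarrow> f z = 1" "\<And>z. z \<notin> K \<Longrightarrow> f z = 0"
      by (rule bump_on_manifold[OF \<theta>(2,4)]) blast
    have "\<forall>z\<in>K. \<theta> z = 1" using f(6) \<theta>(7) by blast
    then have "good f V K" unfolding good_def using c(1) t(1) \<theta> f by blast
    then show ?thesis using f(4) by blast
  qed
  then obtain f0 V0 K0 where g0: "\<And>x. good (f0 x) (V0 x) (K0 x)" "\<And>x. x \<in> V0 x" by metis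
  have "\<And>S. S \<in> range V0 \<Longrightarrow> open S" using g0(1) by (auto simp: good_def)
  \<comment> \<open>Second countability reduces the cover to a sequence, which the products over
    earlier indices require.\<close>
  then obtain \<F> where \<F>: "\<F> \<subseteq> range V0" "countable \<F>" "\<Union>\<F> = \<Union>(range V0)" by (rule Lindelof)
  have UV: "\<Union>(range V0) = UNIV" using g0(2) by blast
  then have "\<F> \<noteq> {}" using \<F>(3) by auto
  then have ran: "range (from_nat_into \<F>) = \<F>" by (rule range_from_nat_into[OF _ \<F>(2)])
  then have "\<forall>i. \<exists>x. from_nat_into \<F> i = V0 x" using \<F>(1) by blast
  then obtain xs where xs: "\<And>i. from_nat_into \<F> i = V0 (xs i)" by metis
  define f where "f i = f0 (xs i)" for i
  define V where "V i = V0 (xs i)" for i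
  define K where "K i = K0 (xs i)" for i
  have g: "good (f i) (V i) (K i)" for i using g0(1) by (simp add: f_def V_def K_def)
  have cover: "(\<Union>i. V i) = UNIV" using ran \<F>(3) UV xs by (simp add: V_def)
  have fC: "f i \<in> Cinf" and oV: "open (V i)" and clK: "closed (K i)" and f1: "z \<in> V i \<Longrightarrow> f i z = 1" and f0: "z \<notin> K i \<Longrightarrow> f i z = 0" for i z
    using g[of i] by (auto simp: good_def)
  define \<rho> where "\<rho> j z = f j z * (\<Prod>i<j. 1 - f i z)" for j z
  have \<rho>C: "\<rho> j \<in> Cinf" for j unfolding \<rho>_def[abs_def]
    by (intro smooth_functions_mult fC smooth_functions_prod smooth_functions_diff smooth_functions_const)
  have \<rho>0: "\<rho> j z = 0" if "z \<in> V n" "n < j" for j n z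
    using f1[OF that(1)] that(2) by (auto simp: \<rho>_def intro!: prod_zero)
  \<comment> \<open>Telescoping: each term is the difference of two consecutive products of the
    factors 1 - f.\<close>
  have \<rho>sum: "(\<Sum>j<m. \<rho> j z) = 1 - (\<Prod>i<m. 1 - f i z)" for m z
    by (induction m) (simp_all add: \<rho>_def algebra_simps)
  have \<rho>1: "(\<Sum>j\<le>n. \<rho> j z) = 1" if "z \<in> V n" for n z
    using \<rho>sum[of z "Suc n"] f1[OF that] by (simp add: lessThan_Suc_atMost[symmetric])
  define quant where "quant j Op \<longleftrightarrow> (\<forall>F\<in>Pol_degree A k. Op F \<in> P k \<and>
        (\<forall>u\<in>Cinf. \<forall>z. symb k (Op F) u z = \<rho> j z * F (z, differential_at A z u))) \<and>
      (\<forall>F F'. Op (\<lambda>q. F q + F' q) = op_add (Op F) (Op F')) \<and>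
      (\<forall>r F. Op (\<lambda>q. r * F q) = op_scale r (Op F)) \<and>
      (\<forall>F s z. \<rho> j z = 0 \<longrightarrow> Op F s z = 0)" for j Op
  have "\<exists>Op. quant j Op" for j
  proof -
    obtain c t \<theta> C where *: "c \<in> A" "t \<in> L" "\<theta> \<in> Cinf" "closed C" "C \<subseteq> fst c \<inter> fst t" "\<And>z. z \<notin> C \<Longrightarrow> \<theta> z = 0" "\<And>z. z \<in> K j \<Longrightarrow> \<theta> z = 1"
      using g[of j] unfolding good_def by blast
    show ?thesis
      unfolding quant_def by (rule local_quantization[OF *(1-6) clK *(7) \<rho>C]) (auto simp: \<rho>_def f0)
  qed
  then have "\<forall>j. \<exists>Op. quant j Op" by (rule allI)
  from choice[OF this] obtain Op where quant: "\<forall>j. quant j (Op j)" by (rule exE)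
  have Op: "F \<in> Pol_degree A k \<Longrightarrow> Op j F \<in> P k"
    "F \<in> Pol_degree A k \<Longrightarrow> u \<in> Cinf \<Longrightarrow> symb k (Op j F) u z = \<rho> j z * F (z, differential_at A z u)"
    "Op j (\<lambda>q. F q + F' q) = op_add (Op j F) (Op j F')"
    "Op j (\<lambda>q. r * F q) = op_scale r (Op j F)"
    "\<rho> j z = 0 \<Longrightarrow> Op j F s z = 0" for j F F' u z r s
    using spec[OF quant, of j] unfolding quant_def by blast+
  define n where "n z = (LEAST i. z \<in> V i)" for z
  have n: "z \<in> V (n z)" for z
  proof -
    have "\<exists>i. z \<in> V i" using cover by blast
    then show ?thesis unfolding n_def by (rule LeastI_ex)
  qed
  \<comment> \<open>All terms beyond the first index n with z in \<open>V n\<close> vanish at z, so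
    on each \<open>V m\<close> this equals the finite sum up to m. That is the form in which
    \<open>P_glue\<close> and \<open>symb_germ\<close> can be applied.\<close>
  define Q where "Q F s z = (\<Sum>j\<le>n z. Op j F s z)" for F s z
  have Q_eq: "Q F s z = op_sum {..m} (\<lambda>j. Op j F) s z" if "z \<in> V m" for F s z m
  proof -
    have "n z \<le> m" unfolding n_def using that by (rule Least_le)
    then have "(\<Sum>j\<le>n z. Op j F s z) = (\<Sum>j\<le>m. Op j F s z)"
      by (intro sum.mono_neutral_left) (auto intro!: Op(5) \<rho>0[OF n])
    then show ?thesis by (simp add: Q_def op_sum_apply)
  qed
  show ?thesis
  proof (rule that[of Q])
    fix F assume F: "F \<in> Pol_degree A k"
    have sumP: "op_sum {..m} (\<lambda>j. Op j F) \<in> P k" for m by (intro P_sum Op(1) F) simp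
    have QP: "Q F \<in> P k"
    proof (rule P_glue[OF oV cover sumP])
      show "Q F s = (\<lambda>x. 0)" if "s \<notin> \<Gamma>" for s
        using End_out[OF P_End[OF Op(1)[OF F]] that] by (simp add: Q_def fun_eq_iff)
    qed (simp add: Q_eq)
    have "psymb k (Q F) = F"
    proof (rule psymb_eqI[OF QP])
      show "F q = 0" if "q \<notin> cotangent_bundle A" for q
        using F that unfolding Pol_degree_def smooth_cofunctions_def by blast
      fix x u assume u: "u \<in> Cinf"
      have "symb k (Q F) u x = symb k (op_sum {..n x} (\<lambda>j. Op j F)) u x"
        by (rule symb_germ[OF QP sumP u n]) (simp add: Q_eq)
      also have "\<dots> = (\<Sum>j\<le>n x. \<rho> j x * F (x, differential_at A x u))"
        using Op(1,2)[OF F] u by (simp add: symb_sum)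
      also have "\<dots> = F (x, differential_at A x u)"
        using \<rho>1[OF n] by (simp add: sum_distrib_right[symmetric])
      finally show "F (x, differential_at A x u) = symb k (Q F) u x" by simp
    qed
    then show "Q F \<in> P k \<and> psymb k (Q F) = F" using QP by blast
  next
    fix F F' show "Q (\<lambda>q. F q + F' q) = op_add (Q F) (Q F')"
      by (intro ext) (simp add: Q_def op_add_apply Op(3) sum.distrib)
  next
    fix r F show "Q (\<lambda>q. r * F q) = op_scale r (Q F)"
      by (intro ext) (simp add: Q_def op_scale_apply Op(4) scaleR_sum_right)
  qed
qed

end

section \<open>The symbol algebra\<close>

lemma cring_real_ring: "cring real_ring"
proof (rule cringI)
  show "abelian_group real_ring"
    by (rule abelian_groupI) (auto simp: real_ring_def add.assoc intro: exI[of _ "- _"] left_minus)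
  show "Group.comm_monoid real_ring"
    by (rule comm_monoidI) (auto simp: real_ring_def)
qed (simp add: real_ring_def distrib_right)

context vector_bundle begin

abbreviation "PZ \<equiv> P_filtration A E L"
abbreviation "sc \<equiv> symbol_class A E L"
abbreviation "S \<equiv> symbol_algebra A E L"

lemma PZ_int [simp]: "PZ (int k) = P k"
  by (simp add: P_filtration_def)

lemma PZ_neg: "i < 0 \<Longrightarrow> PZ i = {op_zero}"
  by (simp add: P_filtration_def)

lemma PZ_cases:
  obtains "i < 0" "PZ i = {op_zero}" | k where "i = int k" "PZ i = P k"
  by (metis PZ_int PZ_neg int_nat_eq linorder_not_less)

lemma PZ_zero: "op_zero \<in> PZ i"
  by (rule PZ_cases[of i]) (simp_all add: P_zero)

lemma PZ_End: "T \<in> PZ i \<Longrightarrow> T \<in> \<E>"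
  by (rule PZ_cases[of i]) (auto simp: op_zero_End P_End)

lemma PZ_add: "T \<in> PZ i \<Longrightarrow> D \<in> PZ i \<Longrightarrow> op_add T D \<in> PZ i"
  by (rule PZ_cases[of i]) (auto simp: op_add_zero P_add)

lemma PZ_scale: "T \<in> PZ i \<Longrightarrow> op_scale r T \<in> PZ i"
  by (rule PZ_cases[of i]) (auto simp: op_scale_zero P_scale)

lemma PZ_mono: "i \<le> j \<Longrightarrow> T \<in> PZ i \<Longrightarrow> T \<in> PZ j"
proof (rule PZ_cases[of i]; rule PZ_cases[of j])
  show "i \<le> j \<Longrightarrow> T \<in> PZ i \<Longrightarrow> i = int k \<Longrightarrow> PZ i = P k \<Longrightarrow> j = int l \<Longrightarrow> PZ j = P l \<Longrightarrow> T \<in> PZ j" for k l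
    using P_mono[of k l T] by simp
qed (auto simp: PZ_zero P_zero)

lemma PZ_sum: "finite I \<Longrightarrow> (\<And>i. i \<in> I \<Longrightarrow> F i \<in> PZ k) \<Longrightarrow> op_sum I F \<in> PZ k"
  by (induction I rule: finite_induct) (simp_all add: op_sum_empty PZ_zero op_sum_insert PZ_add)

lemma PZ_comp: "T \<in> PZ i \<Longrightarrow> D \<in> PZ j \<Longrightarrow> T \<circ> D \<in> PZ (i + j)"
proof (rule PZ_cases[of i]; rule PZ_cases[of j])
  show "T \<in> PZ i \<Longrightarrow> D \<in> PZ j \<Longrightarrow> i = int k \<Longrightarrow> PZ i = P k \<Longrightarrow> j = int l \<Longrightarrow> PZ j = P l \<Longrightarrow> T \<circ> D \<in> PZ (i + j)" for k l
    using P_comp[of T k D l] PZ_int[of "k + l"] by simp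
qed (auto simp: zero_comp comp_zero PZ_zero P_End op_zero_End simp del: o_apply)

lemma PZ_commutator: "T \<in> PZ i \<Longrightarrow> D \<in> PZ j \<Longrightarrow> commutator T D \<in> PZ (i + j - 1)"
proof (rule PZ_cases[of i]; rule PZ_cases[of j])
  show "T \<in> PZ i \<Longrightarrow> D \<in> PZ j \<Longrightarrow> i = int k \<Longrightarrow> PZ i = P k \<Longrightarrow> j = int l \<Longrightarrow> PZ j = P l \<Longrightarrow> commutator T D \<in> PZ (i + j - 1)" for k l
  proof -
    assume *: "T \<in> PZ i" "D \<in> PZ j" "i = int k" "PZ i = P k" "j = int l" "PZ j = P l"
    show "commutator T D \<in> PZ (i + j - 1)"
    proof (cases "k + l = 0")
      case True
      then show ?thesis using P_commutator[of T k D l] * PZ_zero by simp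
    next
      case False
      then have "i + j - 1 = int (k + l - 1)" using * by (simp add: of_nat_diff Suc_le_eq)
      then show ?thesis using False P_commutator[of T k D l] * by (simp only: PZ_int) simp
    qed
  qed
qed (auto simp: commutator_def zero_comp comp_zero P_End op_zero_End op_diff_eq op_scale_zero op_add_zero PZ_zero)

lemma sc_self: "T \<in> PZ i \<Longrightarrow> T \<in> sc i T"
proof -
  have "op_diff T T = op_zero" by (simp add: op_diff_def op_zero_def)
  then show "T \<in> PZ i \<Longrightarrow> T \<in> sc i T" by (simp add: symbol_class_def PZ_zero)
qed

lemma op_diff_telescope: "op_diff T F = op_add (op_diff T D) (op_diff D F)"
  and op_diff_swap: "op_diff D T = op_scale (-1) (op_diff T D)"
  by (simp_all add: op_diff_def op_add_def op_scale_def)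

lemma sc_eq_iff: assumes "T \<in> PZ i" "D \<in> PZ i" shows "sc i T = sc i D \<longleftrightarrow> op_diff T D \<in> PZ (i - 1)"
proof
  assume "sc i T = sc i D"
  then show "op_diff T D \<in> PZ (i - 1)" using sc_self[OF assms(1)] by (simp add: symbol_class_def)
next
  assume d: "op_diff T D \<in> PZ (i - 1)"
  have d': "op_diff D T \<in> PZ (i - 1)" unfolding op_diff_swap[of D T] by (rule PZ_scale[OF d])
  have "op_diff F T \<in> PZ (i - 1) \<longleftrightarrow> op_diff F D \<in> PZ (i - 1)" for F
  proof
    show "op_diff F D \<in> PZ (i - 1)" if "op_diff F T \<in> PZ (i - 1)"
      using PZ_add[OF that d] by (simp only: op_diff_telescope[of F D T])
    show "op_diff F T \<in> PZ (i - 1)" if "op_diff F D \<in> PZ (i - 1)"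
      using PZ_add[OF that d'] by (simp only: op_diff_telescope[of F T D])
  qed
  then show "sc i T = sc i D" by (simp add: symbol_class_def)
qed

lemma sc_zero: "sc i op_zero = PZ (i - 1)"
proof -
  have "op_diff T op_zero = T" for T :: "('m, 'v) operator" by (simp add: op_diff_def op_zero_def)
  then show ?thesis using PZ_mono[of "i - 1" i] by (auto simp: symbol_class_def)
qed

text \<open>Finitely supported families of representatives. All computations in the symbol algebra
  are lifted to them through \<open>cls\<close>, with \<open>conv\<close> as the lifted
  product.\<close>

definition fam :: "(int \<Rightarrow> ('m, 'v) operator) set" where
  "fam = {T. (\<forall>i. T i \<in> PZ i) \<and> finite {i. T i \<noteq> op_zero}}"

definition cls :: "(int \<Rightarrow> ('m, 'v) operator) \<Rightarrow> int \<Rightarrow> ('m, 'v) operator set" where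
  "cls T = (\<lambda>i. sc i (T i))"

definition conv :: "(int \<Rightarrow> ('m, 'v) operator) \<Rightarrow> (int \<Rightarrow> ('m, 'v) operator) \<Rightarrow> int \<Rightarrow> ('m, 'v) operator" where
  "conv T D k = op_sum {0..k} (\<lambda>i. T i \<circ> D (k - i))"

definition fam_one :: "int \<Rightarrow> ('m, 'v) operator" where
  "fam_one k = (if k = 0 then mu (\<lambda>x. 1) else op_zero)"

lemma fam_PZ: "T \<in> fam \<Longrightarrow> T i \<in> PZ i" by (simp add: fam_def)
lemma fam_End: "T \<in> fam \<Longrightarrow> T i \<in> \<E>" by (rule PZ_End[OF fam_PZ])

lemma cls_eqI: "T \<in> fam \<Longrightarrow> D \<in> fam \<Longrightarrow> (\<And>i. op_diff (T i) (D i) \<in> PZ (i - 1)) \<Longrightarrow> cls T = cls D"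
  by (simp add: cls_def fun_eq_iff sc_eq_iff fam_PZ)

lemma cls_eq_iff: "T \<in> fam \<Longrightarrow> D \<in> fam \<Longrightarrow> cls T = cls D \<longleftrightarrow> (\<forall>i. op_diff (T i) (D i) \<in> PZ (i - 1))"
  by (simp add: cls_def fun_eq_iff sc_eq_iff fam_PZ)

lemma fam_add: "T \<in> fam \<Longrightarrow> D \<in> fam \<Longrightarrow> (\<lambda>i. op_add (T i) (D i)) \<in> fam"
proof -
  assume *: "T \<in> fam" "D \<in> fam"
  have "{i. op_add (T i) (D i) \<noteq> op_zero} \<subseteq> {i. T i \<noteq> op_zero} \<union> {i. D i \<noteq> op_zero}"
    by (auto simp: op_add_zero)
  with * show ?thesis by (auto simp: fam_def PZ_add intro: finite_subset)
qed

lemma fam_scale: "T \<in> fam \<Longrightarrow> (\<lambda>i. op_scale r (T i)) \<in> fam"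
proof -
  assume *: "T \<in> fam"
  have "{i. op_scale r (T i) \<noteq> op_zero} \<subseteq> {i. T i \<noteq> op_zero}" by (auto simp: op_scale_zero)
  with * show ?thesis by (auto simp: fam_def PZ_scale intro: finite_subset)
qed

lemma fam_zero: "(\<lambda>i. op_zero) \<in> fam" by (simp add: fam_def PZ_zero)

lemma fam_one: "fam_one \<in> fam"
proof -
  have "mu (\<lambda>x. 1) \<in> PZ 0" using PZ_int[of 0] smooth_functions_const by (auto simp: P_0)
  moreover have "{i. fam_one i \<noteq> op_zero} \<subseteq> {0}" by (auto simp: fam_one_def)
  ultimately show ?thesis by (auto simp: fam_def fam_one_def PZ_zero intro: finite_subset)
qed

lemma conv_PZ: "T \<in> fam \<Longrightarrow> D \<in> fam \<Longrightarrow> conv T D k \<in> PZ k"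
  unfolding conv_def
proof (rule PZ_sum)
  show "T i \<circ> D (k - i) \<in> PZ k" if "T \<in> fam" "D \<in> fam" for i
    using PZ_comp[OF fam_PZ[OF that(1), of i] fam_PZ[OF that(2), of "k - i"]] by simp
qed simp

lemma fam_conv: assumes "T \<in> fam" "D \<in> fam" shows "conv T D \<in> fam"
proof -
  let ?T = "{i. T i \<noteq> op_zero}" and ?D = "{i. D i \<noteq> op_zero}"
  have "{k. conv T D k \<noteq> op_zero} \<subseteq> (\<lambda>(i, j). i + j) ` (?T \<times> ?D)"
  proof
    fix k assume "k \<in> {k. conv T D k \<noteq> op_zero}"
    then have "conv T D k \<noteq> op_zero" by simp
    then obtain i where "T i \<circ> D (k - i) \<noteq> op_zero"
      by (force simp: conv_def op_sum_def op_zero_def fun_eq_iff intro: sum.neutral)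
    then have "T i \<noteq> op_zero" "D (k - i) \<noteq> op_zero"
      using zero_comp comp_zero[OF fam_End[OF assms(1)]] by metis+
    then show "k \<in> (\<lambda>(i, j). i + j) ` (?T \<times> ?D)" by (intro image_eqI[of _ _ "(i, k - i)"]) auto
  qed
  then have "finite {k. conv T D k \<noteq> op_zero}"
    by (rule finite_subset) (use assms in \<open>simp add: fam_def\<close>)
  then show ?thesis using conv_PZ[OF assms] by (simp add: fam_def)
qed

lemma carrier_eq: "carrier S = cls ` fam"
proof
  show "cls ` fam \<subseteq> carrier S"
  proof
    fix c assume "c \<in> cls ` fam"
    then obtain T where T: "T \<in> fam" "c = cls T" by blast
    have "{i. c i \<noteq> PZ (i - 1)} \<subseteq> {i. T i \<noteq> op_zero}" by (auto simp: T(2) cls_def sc_zero)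
    then have "finite {i. c i \<noteq> PZ (i - 1)}" by (rule finite_subset) (use T in \<open>simp add: fam_def\<close>)
    moreover have "\<forall>i. c i \<in> sc i ` PZ i" using T by (simp add: cls_def fam_PZ)
    ultimately show "c \<in> carrier S" by (simp add: symbol_algebra_def)
  qed
  show "carrier S \<subseteq> cls ` fam"
  proof
    fix c assume "c \<in> carrier S"
    then have c: "\<And>i. c i \<in> sc i ` PZ i" "finite {i. c i \<noteq> PZ (i - 1)}" by (simp_all add: symbol_algebra_def)
    \<comment> \<open>The last conjunct chooses zero in trivial cosets, so that the family of
      representatives has finite support.\<close>
    have "\<exists>T. T \<in> PZ i \<and> c i = sc i T \<and> (c i = PZ (i - 1) \<longrightarrow> T = op_zero)" for i
      using c(1)[of i] sc_zero[of i] PZ_zero[of i] by (cases "c i = PZ (i - 1)") auto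
    then obtain T where T: "\<And>i. T i \<in> PZ i" "\<And>i. c i = sc i (T i)" "\<And>i. c i = PZ (i - 1) \<Longrightarrow> T i = op_zero"
      by metis
    have "{i. T i \<noteq> op_zero} \<subseteq> {i. c i \<noteq> PZ (i - 1)}" using T(3) by blast
    then have "T \<in> fam" using c(2) T(1) by (auto simp: fam_def intro: finite_subset)
    moreover have "c = cls T" using T(2) by (auto simp: cls_def)
    ultimately show "c \<in> cls ` fam" by blast
  qed
qed

lemma cls_in: "T \<in> fam \<Longrightarrow> cls T \<in> carrier S" by (simp add: carrier_eq)

lemma carrierE: assumes "c \<in> carrier S" obtains T where "T \<in> fam" "c = cls T"
  using assms by (auto simp: carrier_eq)

lemma zero_cls: "\<zero>\<^bsub>S\<^esub> = cls (\<lambda>i. op_zero)" and one_cls: "\<one>\<^bsub>S\<^esub> = cls fam_one"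
  by (simp_all add: symbol_algebra_def cls_def fam_one_def fun_eq_iff)

lemma sc_mem_eq: "T \<in> PZ i \<Longrightarrow> T' \<in> sc i T \<Longrightarrow> T' \<in> PZ i \<and> op_diff T' T \<in> PZ (i - 1)"
  by (simp add: symbol_class_def)

lemma add_cls:
  assumes "T \<in> fam" "D \<in> fam"
  shows "cls T \<oplus>\<^bsub>S\<^esub> cls D = cls (\<lambda>i. op_add (T i) (D i))"
proof
  fix k
  have "sc k (op_add T' D') = sc k (op_add (T k) (D k))" if "T' \<in> sc k (T k)" "D' \<in> sc k (D k)" for T' D'
  proof -
    note a = sc_mem_eq[OF fam_PZ[OF assms(1)] that(1)] and b = sc_mem_eq[OF fam_PZ[OF assms(2)] that(2)]
    have "op_diff (op_add T' D') (op_add (T k) (D k)) = op_add (op_diff T' (T k)) (op_diff D' (D k))"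
      by (simp add: op_diff_def op_add_def algebra_simps)
    then show ?thesis using a b assms by (simp add: sc_eq_iff PZ_add fam_PZ)
  qed
  then have "(\<Union>T'\<in>sc k (T k). \<Union>D'\<in>sc k (D k). sc k (op_add T' D')) = (\<Union>T'\<in>sc k (T k). \<Union>D'\<in>sc k (D k). sc k (op_add (T k) (D k)))"
    by (intro SUP_cong refl)
  also have "\<dots> = sc k (op_add (T k) (D k))"
    using sc_self[OF fam_PZ[OF assms(1)], of k] sc_self[OF fam_PZ[OF assms(2)], of k] by blast
  finally show "(cls T \<oplus>\<^bsub>S\<^esub> cls D) k = cls (\<lambda>i. op_add (T i) (D i)) k"
    by (simp add: symbol_algebra_def cls_def)
qed

lemma smult_cls:
  assumes "T \<in> fam" shows "r \<odot>\<^bsub>S\<^esub> cls T = cls (\<lambda>i. op_scale r (T i))"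
proof
  fix k
  have "sc k (op_scale r T') = sc k (op_scale r (T k))" if "T' \<in> sc k (T k)" for T'
  proof -
    note a = sc_mem_eq[OF fam_PZ[OF assms(1)] that(1)]
    have "op_diff (op_scale r T') (op_scale r (T k)) = op_scale r (op_diff T' (T k))"
      by (simp add: op_diff_def op_scale_def scaleR_diff_right)
    then show ?thesis using a assms by (simp add: sc_eq_iff PZ_scale fam_PZ)
  qed
  then have "(\<Union>T'\<in>sc k (T k). sc k (op_scale r T')) = (\<Union>T'\<in>sc k (T k). sc k (op_scale r (T k)))"
    by (intro SUP_cong refl)
  also have "\<dots> = sc k (op_scale r (T k))"
    using sc_self[OF fam_PZ[OF assms(1)], of k] by blast
  finally show "(r \<odot>\<^bsub>S\<^esub> cls T) k = cls (\<lambda>i. op_scale r (T i)) k"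
    by (simp add: symbol_algebra_def cls_def)
qed

text \<open>From T' D' - T D = (T' - T) D' + T (D' - D): a change of representatives costs one
  degree in one factor.\<close>

lemma conv_cong:
  assumes T: "\<And>i. T i \<in> PZ i" "\<And>i. T' i \<in> PZ i" "\<And>i. op_diff (T' i) (T i) \<in> PZ (i - 1)"
    and D: "\<And>i. D i \<in> PZ i" "\<And>i. D' i \<in> PZ i" "\<And>i. op_diff (D' i) (D i) \<in> PZ (i - 1)"
  shows "op_diff (conv T' D' k) (conv T D k) \<in> PZ (k - 1)"
proof -
  have "op_diff (conv T' D' k) (conv T D k) = op_sum {0..k} (\<lambda>i. op_diff (T' i \<circ> D' (k - i)) (T i \<circ> D (k - i)))"
    by (simp add: conv_def op_diff_def op_sum_def sum_subtractf)
  moreover have "op_diff (T' i \<circ> D' (k - i)) (T i \<circ> D (k - i)) \<in> PZ (k - 1)" for i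
  proof -
    have "op_diff (T' i \<circ> D' (k - i)) (T i \<circ> D (k - i))
        = op_add (op_diff (T' i) (T i) \<circ> D' (k - i)) (T i \<circ> op_diff (D' (k - i)) (D (k - i)))"
    proof (rule End_eqI)
      fix s x assume s: "s \<in> \<Gamma>"
      have *: "D' (k - i) s \<in> \<Gamma>" "D (k - i) s \<in> \<Gamma>" using s D End_closed PZ_End by blast+
      show "op_diff (T' i \<circ> D' (k - i)) (T i \<circ> D (k - i)) s x
        = op_add (op_diff (T' i) (T i) \<circ> D' (k - i)) (T i \<circ> op_diff (D' (k - i)) (D (k - i))) s x"
        by (simp add: op_apply End_diff[OF PZ_End[OF T(1)] *])
    qed (intro op_diff_End op_add_End comp_End PZ_End[OF T(1)] PZ_End[OF T(2)] PZ_End[OF D(1)] PZ_End[OF D(2)])+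
    moreover have "op_diff (T' i) (T i) \<circ> D' (k - i) \<in> PZ (k - 1)"
      using PZ_comp[OF T(3)[of i] D(2)[of "k - i"]] by simp
    moreover have "T i \<circ> op_diff (D' (k - i)) (D (k - i)) \<in> PZ (k - 1)"
      using PZ_comp[OF T(1)[of i] D(3)[of "k - i"]] by simp
    ultimately show ?thesis by (simp only: PZ_add)
  qed
  ultimately show ?thesis by (simp add: PZ_sum)
qed

text \<open>The product is defined as a union over all representatives. All members of the union are
  the same coset, and \<open>T\<close> and \<open>D\<close> themselves show that the index sets are
  nonempty.\<close>

lemma mult_cls:
  assumes "T \<in> fam" "D \<in> fam" shows "cls T \<otimes>\<^bsub>S\<^esub> cls D = cls (conv T D)"
proof
  fix k
  let ?A = "{T'. \<forall>i. T' i \<in> sc i (T i)}" and ?B = "{D'. \<forall>i. D' i \<in> sc i (D i)}"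
  have "sc k (conv T' D' k) = sc k (conv T D k)" if "T' \<in> ?A" "D' \<in> ?B" for T' D'
  proof -
    have a: "T' i \<in> PZ i" "op_diff (T' i) (T i) \<in> PZ (i - 1)" for i
      using that(1) sc_mem_eq[OF fam_PZ[OF assms(1)]] by auto
    have b: "D' i \<in> PZ i" "op_diff (D' i) (D i) \<in> PZ (i - 1)" for i
      using that(2) sc_mem_eq[OF fam_PZ[OF assms(2)]] by auto
    have d: "op_diff (conv T' D' k) (conv T D k) \<in> PZ (k - 1)"
      by (rule conv_cong[OF fam_PZ[OF assms(1)] a fam_PZ[OF assms(2)] b])
    have "conv T' D' k \<in> PZ k" unfolding conv_def
    proof (rule PZ_sum)
      show "T' i \<circ> D' (k - i) \<in> PZ k" for i using PZ_comp[OF a(1)[of i] b(1)[of "k - i"]] by simp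
    qed simp
    then show ?thesis using d conv_PZ[OF assms] by (simp add: sc_eq_iff)
  qed
  then have "(\<Union>T'\<in>?A. \<Union>D'\<in>?B. sc k (conv T' D' k)) = (\<Union>T'\<in>?A. \<Union>D'\<in>?B. sc k (conv T D k))"
    by (intro SUP_cong refl)
  also have "\<dots> = sc k (conv T D k)"
  proof -
    have "T \<in> ?A" "D \<in> ?B" using sc_self fam_PZ assms by auto
    then show ?thesis by blast
  qed
  finally show "(cls T \<otimes>\<^bsub>S\<^esub> cls D) k = cls (conv T D) k"
    by (simp add: symbol_algebra_def cls_def conv_def)
qed

lemma fam_section: "T \<in> fam \<Longrightarrow> T i s \<in> \<Gamma>"
  using End_closed[OF fam_End] End_out[OF fam_End] section_0 by (cases "s \<in> \<Gamma>") auto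

lemma conv_apply: "conv T D k s = (\<lambda>x. \<Sum>i\<in>{0..k}. T i (D (k - i) s) x)"
  by (simp add: conv_def op_sum_apply)

lemma conv_assoc:
  assumes "T \<in> fam" "D \<in> fam" "F \<in> fam"
  shows "conv (conv T D) F = conv T (conv D F)"
proof (intro ext)
  fix k s x
  have "conv T (conv D F) k s x = (\<Sum>i\<in>{0..k}. \<Sum>j\<in>{0..k - i}. T i (D j (F (k - i - j) s)) x)"
  proof -
    have "T i (conv D F (k - i) s) x = (\<Sum>j\<in>{0..k - i}. T i (D j (F (k - i - j) s)) x)" for i
      using End_sum[OF fam_End[OF assms(1), of i], of "{0..k - i}" "\<lambda>j. D j (F (k - i - j) s)"] fam_section[OF assms(2)]
      by (simp add: conv_apply)
    then show ?thesis by (subst conv_apply) simp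
  qed
  moreover have "conv (conv T D) F k s x = (\<Sum>i\<in>{0..k}. \<Sum>j\<in>{0..i}. T j (D (i - j) (F (k - i) s)) x)"
    by (simp add: conv_apply)
  moreover have "(\<Sum>i\<in>{0..k}. \<Sum>j\<in>{0..i}. T j (D (i - j) (F (k - i) s)) x)
      = (\<Sum>i\<in>{0..k}. \<Sum>j\<in>{0..k - i}. T i (D j (F (k - i - j) s)) x)"
    unfolding sum.Sigma[OF finite_atLeastAtMost_int ballI[OF finite_atLeastAtMost_int]]
    by (rule sum.reindex_bij_witness[of _ "\<lambda>(i, j). (i + j, i)" "\<lambda>(i, j). (j, i - j)"]) (auto simp: algebra_simps)
  ultimately show "conv (conv T D) F k s x = conv T (conv D F) k s x" by simp
qed

text \<open>Commutativity holds only modulo lower degree: after reversing one sum, the difference is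
  a sum of commutators, which lose a degree.\<close>

lemma conv_commute:
  assumes "T \<in> fam" "D \<in> fam" shows "op_diff (conv T D k) (conv D T k) \<in> PZ (k - 1)"
proof -
  have "(\<Sum>i\<in>{0..k}. D i (T (k - i) s) x) = (\<Sum>i\<in>{0..k}. D (k - i) (T i s) x)" for s x
    by (rule sum.reindex_bij_witness[of _ "\<lambda>i. k - i" "\<lambda>i. k - i"]) auto
  then have "op_diff (conv T D k) (conv D T k) = op_sum {0..k} (\<lambda>i. commutator (T i) (D (k - i)))"
    by (simp add: op_diff_def conv_apply op_sum_def commutator_apply sum_subtractf fun_eq_iff)
  moreover have "commutator (T i) (D (k - i)) \<in> PZ (k - 1)" for i
    using PZ_commutator[OF fam_PZ[OF assms(1), of i] fam_PZ[OF assms(2), of "k - i"]] by simp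
  ultimately show ?thesis by (simp add: PZ_sum)
qed

text \<open>An identity of operators, not only of classes. In negative degree both sides are zero,
  since the filtration is trivial there.\<close>

lemma conv_one: assumes "T \<in> fam" shows "conv fam_one T = T"
proof (intro ext)
  fix k s x
  show "conv fam_one T k s x = T k s x"
  proof (cases "k < 0")
    case True
    then show ?thesis using fam_PZ[OF assms, of k] by (simp add: conv_apply PZ_neg op_apply)
  next
    case False
    have "conv fam_one T k s x = (\<Sum>i\<in>{0..k}. if i = 0 then T k s x else 0)"
      unfolding conv_apply
      by (rule sum.cong) (auto simp: fam_one_def op_apply mu_apply[OF fam_section[OF assms]])
    then show ?thesis using False by simp
  qed
qed

lemma symbol_cring: "cring S"
proof (rule cringI)
  show "abelian_group S"
  proof (rule abelian_groupI)
    fix x y assume "x \<in> carrier S" "y \<in> carrier S"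
    then obtain T D where *: "T \<in> fam" "D \<in> fam" "x = cls T" "y = cls D" by (metis carrierE)
    then show "x \<oplus>\<^bsub>S\<^esub> y \<in> carrier S" by (simp add: add_cls cls_in fam_add)
    show "x \<oplus>\<^bsub>S\<^esub> y = y \<oplus>\<^bsub>S\<^esub> x" using * by (simp add: add_cls) (simp add: op_add_def add.commute)
  next
    fix x y z assume "x \<in> carrier S" "y \<in> carrier S" "z \<in> carrier S"
    then obtain T D F where "T \<in> fam" "D \<in> fam" "F \<in> fam" "x = cls T" "y = cls D" "z = cls F" by (metis carrierE)
    then show "x \<oplus>\<^bsub>S\<^esub> y \<oplus>\<^bsub>S\<^esub> z = x \<oplus>\<^bsub>S\<^esub> (y \<oplus>\<^bsub>S\<^esub> z)"
      by (simp add: add_cls fam_add) (simp add: op_add_def add.assoc)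
  next
    show "\<zero>\<^bsub>S\<^esub> \<in> carrier S" by (simp add: zero_cls cls_in fam_zero)
  next
    fix x assume "x \<in> carrier S"
    then obtain T where T: "T \<in> fam" "x = cls T" by (rule carrierE)
    then show "\<zero>\<^bsub>S\<^esub> \<oplus>\<^bsub>S\<^esub> x = x" by (simp add: zero_cls add_cls fam_zero op_add_zero)
    have "op_add (op_scale (-1) (T i)) (T i) = op_zero" for i by (simp add: op_add_def op_scale_def op_zero_def)
    then show "\<exists>y\<in>carrier S. y \<oplus>\<^bsub>S\<^esub> x = \<zero>\<^bsub>S\<^esub>"
      using T by (intro bexI[of _ "cls (\<lambda>i. op_scale (-1) (T i))"]) (simp_all add: add_cls fam_scale cls_in zero_cls)
  qed
  show "Group.comm_monoid S"
  proof (rule comm_monoidI)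
    show "\<one>\<^bsub>S\<^esub> \<in> carrier S" by (simp add: one_cls cls_in fam_one)
    fix x y assume "x \<in> carrier S" "y \<in> carrier S"
    then obtain T D where *: "T \<in> fam" "D \<in> fam" "x = cls T" "y = cls D" by (metis carrierE)
    then show "x \<otimes>\<^bsub>S\<^esub> y \<in> carrier S" by (simp add: mult_cls cls_in fam_conv)
    show "x \<otimes>\<^bsub>S\<^esub> y = y \<otimes>\<^bsub>S\<^esub> x" using * by (simp add: mult_cls) (intro cls_eqI fam_conv conv_commute)
  next
    fix x y z assume "x \<in> carrier S" "y \<in> carrier S" "z \<in> carrier S"
    then obtain T D F where "T \<in> fam" "D \<in> fam" "F \<in> fam" "x = cls T" "y = cls D" "z = cls F" by (metis carrierE)
    then show "x \<otimes>\<^bsub>S\<^esub> y \<otimes>\<^bsub>S\<^esub> z = x \<otimes>\<^bsub>S\<^esub> (y \<otimes>\<^bsub>S\<^esub> z)"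
      by (simp add: mult_cls fam_conv conv_assoc)
  next
    fix x assume "x \<in> carrier S"
    then obtain T where T: "T \<in> fam" "x = cls T" by (rule carrierE)
    then show "\<one>\<^bsub>S\<^esub> \<otimes>\<^bsub>S\<^esub> x = x" by (simp add: one_cls mult_cls fam_one conv_one)
  qed
  fix x y z assume "x \<in> carrier S" "y \<in> carrier S" "z \<in> carrier S"
  then obtain T D F where *: "T \<in> fam" "D \<in> fam" "F \<in> fam" "x = cls T" "y = cls D" "z = cls F" by (metis carrierE)
  have "conv (\<lambda>i. op_add (T i) (D i)) F = (\<lambda>i. op_add (conv T F i) (conv D F i))"
    by (simp add: fun_eq_iff conv_apply op_add_apply sum.distrib)
  then show "(x \<oplus>\<^bsub>S\<^esub> y) \<otimes>\<^bsub>S\<^esub> z = x \<otimes>\<^bsub>S\<^esub> z \<oplus>\<^bsub>S\<^esub> y \<otimes>\<^bsub>S\<^esub> z"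
    using * by (simp add: mult_cls add_cls fam_add fam_conv)
qed

lemma symbol_abelian_group: "abelian_group S"
  using symbol_cring by (simp add: cring_def ring_def)

lemma symbol_module: "module real_ring S"
proof (rule moduleI[OF cring_real_ring symbol_abelian_group])
  fix a b x y assume "x \<in> carrier S" "y \<in> carrier S"
  then obtain T D where *: "T \<in> fam" "D \<in> fam" "x = cls T" "y = cls D" by (metis carrierE)
  then show "a \<odot>\<^bsub>S\<^esub> (x \<oplus>\<^bsub>S\<^esub> y) = a \<odot>\<^bsub>S\<^esub> x \<oplus>\<^bsub>S\<^esub> a \<odot>\<^bsub>S\<^esub> y"
    by (simp add: smult_cls add_cls fam_add fam_scale) (simp add: op_add_def op_scale_def scaleR_add_right)
next
  fix a b x assume "x \<in> carrier S"
  then obtain T where T: "T \<in> fam" "x = cls T" by (rule carrierE)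
  then show "a \<odot>\<^bsub>S\<^esub> x \<in> carrier S" by (simp add: smult_cls cls_in fam_scale)
  show "(a \<oplus>\<^bsub>real_ring\<^esub> b) \<odot>\<^bsub>S\<^esub> x = a \<odot>\<^bsub>S\<^esub> x \<oplus>\<^bsub>S\<^esub> b \<odot>\<^bsub>S\<^esub> x"
    using T by (simp add: smult_cls add_cls fam_scale) (simp add: real_ring_def op_add_def op_scale_def scaleR_add_left)
  show "(a \<otimes>\<^bsub>real_ring\<^esub> b) \<odot>\<^bsub>S\<^esub> x = a \<odot>\<^bsub>S\<^esub> (b \<odot>\<^bsub>S\<^esub> x)"
    using T by (simp add: smult_cls fam_scale) (simp add: real_ring_def op_scale_def)
  show "\<one>\<^bsub>real_ring\<^esub> \<odot>\<^bsub>S\<^esub> x = x"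
    using T by (simp add: smult_cls) (simp add: real_ring_def op_scale_def)
qed

lemma symbol_algebra: "Module.algebra real_ring S"
proof (intro algebra.intro symbol_module symbol_cring algebra_axioms.intro)
  fix a x y assume "x \<in> carrier S" "y \<in> carrier S"
  then obtain T D where *: "T \<in> fam" "D \<in> fam" "x = cls T" "y = cls D" by (metis carrierE)
  have "conv (\<lambda>i. op_scale a (T i)) D = (\<lambda>i. op_scale a (conv T D i))"
    by (simp add: fun_eq_iff conv_apply op_scale_apply scaleR_sum_right)
  then show "a \<odot>\<^bsub>S\<^esub> x \<otimes>\<^bsub>S\<^esub> y = a \<odot>\<^bsub>S\<^esub> (x \<otimes>\<^bsub>S\<^esub> y)"
    using * by (simp add: smult_cls mult_cls fam_scale fam_conv)
qed

lemma minus_cls: assumes "T \<in> fam" shows "\<ominus>\<^bsub>S\<^esub> cls T = cls (\<lambda>i. op_scale (-1) (T i))"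
proof -
  have "op_add (op_scale (-1) (T i)) (T i) = op_zero" for i by (simp add: op_add_def op_scale_def op_zero_def)
  then have "cls (\<lambda>i. op_scale (-1) (T i)) \<oplus>\<^bsub>S\<^esub> cls T = \<zero>\<^bsub>S\<^esub>"
    using assms by (simp add: add_cls fam_scale zero_cls)
  then show ?thesis by (rule abelian_group.minus_equality[OF symbol_abelian_group]) (simp_all add: assms cls_in fam_scale)
qed


section \<open>Square-zero symbols\<close>

text \<open>Shows that changing a representative does not affect membership in \<open>G\<close>. For
  k = 0 both sets contain only zero.\<close>

lemma G_P_lower: "T \<in> PZ (int k - 1) \<Longrightarrow> T \<in> G k"
proof (cases k)
  case (Suc j)
  assume "T \<in> PZ (int k - 1)"
  then show ?thesis using Suc P_G[of T j] by simp
qed (simp add: PZ_neg G_0)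

text \<open>Families whose components all have vanishing symbol; their classes turn out to be the
  square-zero symbols.\<close>

definition low :: "(int \<Rightarrow> ('m, 'v) operator) set" where
  "low = {T \<in> fam. \<forall>k. T (int k) \<in> G k}"

lemma low_cls:
  assumes "T \<in> fam" "D \<in> low" "cls T = cls D" shows "T \<in> low"
proof -
  have D: "D \<in> fam" "\<And>k. D (int k) \<in> G k" using assms(2) by (auto simp: low_def)
  have "T (int k) \<in> G k" for k
  proof -
    have "op_diff (T (int k)) (D (int k)) \<in> PZ (int k - 1)"
      using assms(3) cls_eq_iff[OF assms(1) D(1)] by blast
    from G_add[OF G_P_lower[OF this] D(2)[of k]] show ?thesis by (simp add: op_add_def op_diff_def)
  qed
  then show ?thesis using assms(1) by (simp add: low_def)
qed

lemma conv_nat: "conv T D (int m) = op_sum {..m} (\<lambda>i. T (int i) \<circ> D (int (m - i)))"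
  unfolding conv_def op_sum_def
  by (intro ext sum.reindex_bij_witness[of _ int nat]) (auto simp: of_nat_diff)

lemma conv_neg: "k < 0 \<Longrightarrow> conv T D k = op_zero"
  by (simp add: conv_def op_sum_empty)

text \<open>The symbol of the lifted product is the Cauchy product of the sequences of
  symbols.\<close>

lemma symb_conv:
  assumes "T \<in> fam" "D \<in> fam" "u \<in> Cinf"
  shows "symb m (conv T D (int m)) u x = (\<Sum>i\<le>m. symb i (T (int i)) u x * symb (m - i) (D (int (m - i))) u x)"
proof -
  have P: "T (int i) \<in> P i" "D (int i) \<in> P i" for i
    using fam_PZ[OF assms(1), of "int i"] fam_PZ[OF assms(2), of "int i"] by simp_all
  have "symb m (conv T D (int m)) u x = (\<Sum>i\<le>m. symb m (T (int i) \<circ> D (int (m - i))) u x)"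
    unfolding conv_nat
  proof (rule symb_sum[OF _ _ assms(3)])
    show "T (int i) \<circ> D (int (m - i)) \<in> P m" if "i \<in> {..m}" for i
      using P_comp[OF P(1)[of i] P(2)[of "m - i"]] that by simp
  qed simp
  also have "\<dots> = (\<Sum>i\<le>m. symb i (T (int i)) u x * symb (m - i) (D (int (m - i))) u x)"
  proof (rule sum.cong[OF refl])
    fix i assume "i \<in> {..m}"
    then have e: "i + (m - i) = m" by simp
    from symb_comp[where x = x, OF P(1)[of i] P(2)[of "m - i"] assms(3)]
    show "symb m (T (int i) \<circ> D (int (m - i))) u x = symb i (T (int i)) u x * symb (m - i) (D (int (m - i))) u x"
      unfolding e .
  qed
  finally show ?thesis .
qed

lemma symb_PZ_lower: assumes "T \<in> PZ (int k - 1)" "u \<in> Cinf" shows "symb k T u x = 0"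
  using symb_eq_0_iff[of T k] G_P_lower[OF assms(1)] G_P assms(2) by blast

text \<open>At fixed \<open>u\<close> and \<open>x\<close> the symbols form a sequence of reals. If
  those below degree n vanish, the component of degree 2n of the square is the square of the n-th
  one, since in every other product one index is below n.\<close>

lemma square_zero_low:
  assumes "T \<in> fam" "cls (conv T T) = cls (\<lambda>i. op_zero)" shows "T \<in> low"
proof -
  have P: "T (int i) \<in> P i" for i using fam_PZ[OF assms(1), of "int i"] by simp
  have c: "conv T T k \<in> PZ (k - 1)" for k
  proof -
    have "op_diff (conv T T k) op_zero \<in> PZ (k - 1)"
      using assms(2) cls_eq_iff[OF fam_conv[OF assms(1,1)] fam_zero] by blast
    then show ?thesis by (simp add: op_diff_def op_zero_def)
  qed
  have "symb k (T (int k)) u x = 0" if u: "u \<in> Cinf" for k u x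
  proof (induction k rule: less_induct)
    case (less n)
    let ?p = "\<lambda>i. symb i (T (int i)) u x"
    have z: "?p i * ?p (2 * n - i) = 0" if "i \<noteq> n" "i \<le> 2 * n" for i
      using less[of i] less[of "2 * n - i"] that by (cases "i < n") auto
    then have z: "\<forall>i\<in>{..2 * n} - {n}. ?p i * ?p (2 * n - i) = 0" by blast
    have "0 = symb (2 * n) (conv T T (int (2 * n))) u x"
      by (rule symb_PZ_lower[OF _ u, symmetric]) (rule c)
    also have "\<dots> = (\<Sum>i\<le>2 * n. ?p i * ?p (2 * n - i))" by (rule symb_conv[OF assms(1,1) u])
    also have "\<dots> = (\<Sum>i\<in>{n}. ?p i * ?p (2 * n - i))"
      by (rule sum.mono_neutral_right[OF _ _ z]) auto
    finally show ?case by (simp del: symb.simps)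
  qed
  then show ?thesis using assms(1) symb_eq_0_iff[OF P] by (auto simp: low_def)
qed

lemma low_fam: "T \<in> low \<Longrightarrow> T \<in> fam" by (simp add: low_def)
lemma low_G: "T \<in> low \<Longrightarrow> T (int k) \<in> G k" by (simp add: low_def)

lemma G_sum: "finite I \<Longrightarrow> (\<And>i. i \<in> I \<Longrightarrow> F i \<in> G k) \<Longrightarrow> op_sum I F \<in> G k"
  by (induction I rule: finite_induct) (simp_all add: op_sum_empty G_zero op_sum_insert G_add)

text \<open>By \<open>G_comp\<close> the component of degree m lies in \<open>G (m - 1)\<close>,
  hence in the filtration step m - 1, and its class in degree m is zero. For m = 0 truncated
  subtraction gives \<open>G 0\<close>, which is zero.\<close>

lemma conv_low_low:
  assumes "T \<in> low" "D \<in> low" shows "cls (conv T D) = cls (\<lambda>i. op_zero)"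
proof (rule cls_eqI[OF fam_conv[OF low_fam[OF assms(1)] low_fam[OF assms(2)]] fam_zero])
  fix k
  have "conv T D k \<in> PZ (k - 1)"
  proof (cases "k < 0")
    case True
    then show ?thesis by (simp add: conv_neg PZ_zero)
  next
    case False
    then obtain m where m: "k = int m" by (metis nonneg_int_cases linorder_not_less)
    have "T (int i) \<circ> D (int (m - i)) \<in> G (m - 1)" if "i \<le> m" for i
      using G_comp[OF low_G[OF assms(1), of i] low_G[OF assms(2), of "m - i"]] that by simp
    then have c: "conv T D k \<in> G (m - 1)" unfolding m conv_nat by (intro G_sum) auto
    show ?thesis
    proof (cases m)
      case 0
      then show ?thesis using c m by (simp add: G_0 PZ_zero)
    next
      case (Suc j)
      then show ?thesis using G_P[OF c] m by simp
    qed
  qed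
  then show "op_diff (conv T D k) op_zero \<in> PZ (k - 1)" by (simp add: op_diff_def op_zero_def)
qed

text \<open>Ideal property on representatives: \<open>P_G\<close> raises the index of the second
  factor by one, and \<open>G_comp\<close> lowers the total by one, so degree m keeps index
  m.\<close>

lemma conv_low:
  assumes "T \<in> low" "D \<in> fam" shows "conv T D \<in> low"
proof -
  have D: "D (int i) \<in> P i" for i using fam_PZ[OF assms(2), of "int i"] by simp
  have "T (int i) \<circ> D (int (m - i)) \<in> G m" if "i \<le> m" for i m
    using G_comp[OF low_G[OF assms(1), of i] P_G[OF D[of "m - i"]]] that by simp
  then have "conv T D (int m) \<in> G m" for m unfolding conv_nat by (intro G_sum) auto
  then show ?thesis using fam_conv[OF low_fam[OF assms(1)] assms(2)] by (simp add: low_def)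
qed

lemma square_zero_symbols_eq: "square_zero_symbols A E L = cls ` low"
proof
  show "square_zero_symbols A E L \<subseteq> cls ` low"
  proof
    fix c assume c: "c \<in> square_zero_symbols A E L"
    then have "c \<in> carrier S" by (simp add: square_zero_symbols_def)
    then obtain T where T: "T \<in> fam" "c = cls T" by (rule carrierE)
    then have "T \<in> low" using c by (intro square_zero_low) (simp_all add: square_zero_symbols_def mult_cls zero_cls)
    then show "c \<in> cls ` low" using T by blast
  qed
  show "cls ` low \<subseteq> square_zero_symbols A E L"
    by (auto simp: square_zero_symbols_def cls_in low_fam mult_cls conv_low_low zero_cls)
qed

lemma low_add: "T \<in> low \<Longrightarrow> D \<in> low \<Longrightarrow> (\<lambda>i. op_add (T i) (D i)) \<in> low"
  and low_scale: "T \<in> low \<Longrightarrow> (\<lambda>i. op_scale r (T i)) \<in> low"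
  and low_zero: "(\<lambda>i. op_zero) \<in> low"
  by (simp_all add: low_def fam_add fam_scale fam_zero G_add G_scale G_zero)

text \<open>Serves both the square-zero symbols and the complement.\<close>

lemma submodule_cls:
  assumes "X \<subseteq> fam" "(\<lambda>i. op_zero) \<in> X" "\<And>T D. T \<in> X \<Longrightarrow> D \<in> X \<Longrightarrow> (\<lambda>i. op_add (T i) (D i)) \<in> X"
    "\<And>r T. T \<in> X \<Longrightarrow> (\<lambda>i. op_scale r (T i)) \<in> X"
  shows "submodule (cls ` X) real_ring S"
proof (rule module.submoduleI[OF symbol_module])
  show "cls ` X \<subseteq> carrier S" using assms(1) cls_in by blast
  show "\<zero>\<^bsub>S\<^esub> \<in> cls ` X" using assms(2) zero_cls by blast
  show "\<ominus>\<^bsub>S\<^esub> a \<in> cls ` X" if "a \<in> cls ` X" for a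
    using that assms(1,4) minus_cls by blast
  show "a \<oplus>\<^bsub>S\<^esub> b \<in> cls ` X" if "a \<in> cls ` X" "b \<in> cls ` X" for a b
  proof -
    from that obtain T D where "T \<in> X" "D \<in> X" "a = cls T" "b = cls D" by blast
    then show ?thesis using assms(1,3) add_cls[of T D] by auto
  qed
  show "r \<odot>\<^bsub>S\<^esub> a \<in> cls ` X" if "a \<in> cls ` X" for r a
  proof -
    from that obtain T where "T \<in> X" "a = cls T" by blast
    then show ?thesis using assms(1,4) smult_cls[of T r] by auto
  qed
qed

lemma square_zero_submodule: "submodule (square_zero_symbols A E L) real_ring S"
  unfolding square_zero_symbols_eq by (rule submodule_cls) (auto simp: low_fam low_zero low_add low_scale)

lemma square_zero_ideal: "ideal (square_zero_symbols A E L) S"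
proof (rule idealI[OF cring.axioms(1)[OF symbol_cring] submodule.axioms(1)[OF square_zero_submodule]])
  fix a x assume "a \<in> square_zero_symbols A E L" and x: "x \<in> carrier S"
  then obtain T where T: "T \<in> low" "a = cls T" unfolding square_zero_symbols_eq by blast
  obtain D where D: "D \<in> fam" "x = cls D" using x by (rule carrierE)
  show r: "a \<otimes>\<^bsub>S\<^esub> x \<in> square_zero_symbols A E L"
    unfolding square_zero_symbols_eq using T D conv_low by (simp add: mult_cls low_fam)
  have "x \<otimes>\<^bsub>S\<^esub> a = a \<otimes>\<^bsub>S\<^esub> x"
    by (rule comm_monoid.m_comm[OF cring.axioms(2)[OF symbol_cring]]) (use x T cls_in low_fam in auto)
  then show "x \<otimes>\<^bsub>S\<^esub> a \<in> square_zero_symbols A E L" using r by simp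
qed

lemma square_zero_mult:
  assumes "a \<in> square_zero_symbols A E L" "b \<in> square_zero_symbols A E L"
  shows "a \<otimes>\<^bsub>S\<^esub> b = \<zero>\<^bsub>S\<^esub>"
  using assms unfolding square_zero_symbols_eq by (auto simp: mult_cls low_fam conv_low_low zero_cls)


section \<open>The map delta and the complement\<close>

text \<open>All representatives have the same symbol, since lower filtration steps have none, and
  both branches of the definition return it by \<open>psymb_lower_order\<close> and
  \<open>scalar_symbol_eq\<close>.\<close>

lemma delta_degree_eq:
  assumes "T \<in> P k" shows "delta_degree A E L (int k) (sc (int k) T) = psymb k T"
proof -
  have val: "(if D \<in> differential_operators A E L (int k - 1) then (\<lambda>q. 0) else scalar_symbol A E L (int k) D) = psymb k T"
    if "D \<in> sc (int k) T" for D
  proof -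
    have D: "D \<in> P k" "op_diff D T \<in> PZ (int k - 1)" using that by (auto simp: symbol_class_def)
    have "op_diff D T \<in> P k" by (rule P_diff[OF D(1) assms])
    then have "psymb k (op_add (op_diff D T) T) = (\<lambda>q. psymb k (op_diff D T) q + psymb k T q)" by (rule psymb_add[OF _ assms])
    moreover have "op_add (op_diff D T) T = D" by (simp add: op_add_def op_diff_def)
    moreover have "psymb k (op_diff D T) = (\<lambda>q. 0)"
      using psymb_eq_0_iff[OF \<open>op_diff D T \<in> P k\<close>] G_P_lower[OF D(2)] by blast
    ultimately have "psymb k D = psymb k T" by simp
    then show ?thesis using psymb_lower_order[OF D(1)] scalar_symbol_eq[OF D(1)] by auto
  qed
  have T: "T \<in> sc (int k) T" using sc_self[of T "int k"] assms by simp
  show ?thesis unfolding delta_degree_def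
  proof (rule the_equality)
    show "\<forall>D\<in>sc (int k) T. psymb k T =
      (if D \<in> differential_operators A E L (int k - 1) then (\<lambda>q. 0) else scalar_symbol A E L (int k) D)"
      using val by metis
    show "p = psymb k T" if "\<forall>D\<in>sc (int k) T. p =
      (if D \<in> differential_operators A E L (int k - 1) then (\<lambda>q. 0) else scalar_symbol A E L (int k) D)" for p
      using bspec[OF that T] val[OF T] by simp
  qed
qed

text \<open>\<open>delta\<close> sums over the nonzero components of a class only. The remaining
  degrees below N may be added, because a representative of the zero class has symbol 0.\<close>

lemma delta_cls:
  assumes "T \<in> fam" "\<And>k. k \<ge> N \<Longrightarrow> T (int k) = op_zero"
  shows "delta A E L (cls T) = (\<lambda>q. \<Sum>k<N. psymb k (T (int k)) q)"
proof
  fix q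
  have P: "T (int i) \<in> P i" for i using fam_PZ[OF assms(1), of "int i"] by simp
  let ?K = "{k. cls T k \<noteq> PZ (k - 1)}"
  have K: "?K \<subseteq> int ` {..<N}"
  proof
    fix k assume k: "k \<in> ?K"
    have "T k \<noteq> op_zero" using k by (auto simp: cls_def sc_zero)
    then have "\<not> k < 0" using fam_PZ[OF assms(1), of k] PZ_neg by auto
    then obtain m where m: "k = int m" by (metis nonneg_int_cases linorder_not_less)
    then have "m < N" using assms(2)[of m] \<open>T k \<noteq> op_zero\<close> by (meson linorder_not_less)
    then show "k \<in> int ` {..<N}" using m by blast
  qed
  have "delta A E L (cls T) q = (\<Sum>k\<in>?K. psymb (nat k) (T k) q)"
    unfolding delta_def
  proof (rule sum.cong[OF refl])
    fix k assume "k \<in> ?K"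
    then obtain m where m: "k = int m" using K by blast
    show "delta_degree A E L k (cls T k) q = psymb (nat k) (T k) q"
      unfolding m cls_def delta_degree_eq[OF P] by simp
  qed
  also have "\<dots> = (\<Sum>k\<in>int ` {..<N}. psymb (nat k) (T k) q)"
  proof (rule sum.mono_neutral_left[OF _ K], simp, rule ballI)
    fix k assume k: "k \<in> int ` {..<N} - ?K"
    then obtain m where m: "k = int m" by blast
    have "sc (int m) (T (int m)) = PZ (int m - 1)" using k m by (simp add: cls_def)
    moreover have "T (int m) \<in> sc (int m) (T (int m))" by (rule sc_self[OF fam_PZ[OF assms(1)]])
    ultimately have "T (int m) \<in> G m" using G_P_lower by simp
    then have "psymb m (T (int m)) = (\<lambda>q. 0)" using psymb_eq_0_iff[OF P[of m]] by blast
    then show "psymb (nat k) (T k) q = 0" by (simp add: m)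
  qed
  also have "\<dots> = (\<Sum>k<N. psymb k (T (int k)) q)"
    by (simp add: sum.reindex)
  finally show "delta A E L (cls T) q = (\<Sum>k<N. psymb k (T (int k)) q)" .
qed

lemma fam_bound: assumes "T \<in> fam" obtains N where "\<And>k. k \<ge> N \<Longrightarrow> T (int k) = op_zero"
proof -
  have "finite (nat ` {i. T i \<noteq> op_zero})" using assms by (simp add: fam_def)
  from finite_nat_set_iff_bounded[THEN iffD1, OF this]
  obtain N where N: "\<forall>n\<in>nat ` {i. T i \<noteq> op_zero}. n < N" by (rule exE)
  have "T (int k) = op_zero" if "k \<ge> N" for k
  proof (rule ccontr)
    assume "T (int k) \<noteq> op_zero"
    then have "k \<in> nat ` {i. T i \<noteq> op_zero}" by (intro image_eqI[of _ _ "int k"]) auto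
    then have "k < N" using N by blast
    then show False using that by simp
  qed
  then show ?thesis by (rule that)
qed

lemma Pol_degree_sym: assumes "F \<in> Pol_degree A k" obtains T where "T \<in> P k" "psymb k T = F"
  using quantization[of k] assms by metis

text \<open>Closure under sums is obtained from operators: every member is a symbol by quantization,
  and symbols add.\<close>

lemma Pol_degree_add:
  assumes "F \<in> Pol_degree A k" "F' \<in> Pol_degree A k" shows "(\<lambda>q. F q + F' q) \<in> Pol_degree A k"
proof -
  obtain T where T: "T \<in> P k" "psymb k T = F" by (rule Pol_degree_sym[OF assms(1)])
  obtain T' where T': "T' \<in> P k" "psymb k T' = F'" by (rule Pol_degree_sym[OF assms(2)])
  show ?thesis using psymb_Pol_degree[OF P_add[OF T(1) T'(1)]] psymb_add[OF T(1) T'(1)] T T' by simp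
qed

lemma Pol_degree_scale: assumes "F \<in> Pol_degree A k" shows "(\<lambda>q. r * F q) \<in> Pol_degree A k"
proof -
  obtain T where T: "T \<in> P k" "psymb k T = F" by (rule Pol_degree_sym[OF assms(1)])
  show ?thesis using psymb_Pol_degree[OF P_scale[OF T(1), of r]] psymb_scale[OF T(1)] T by simp
qed

lemma Pol_degree_zero: "(\<lambda>q. 0) \<in> Pol_degree A k"
  using psymb_Pol_degree[OF P_zero[of k]] psymb_eq_0_iff[OF P_zero[of k]] G_zero by simp

text \<open>Replacing u by r u turns both sums, by homogeneity, into polynomials in r; equal
  polynomials have equal coefficients. Thus the decomposition into degrees is unique.\<close>

lemma psymb_sum_eq:
  assumes T: "\<And>k. T k \<in> P k" and D: "\<And>k. D k \<in> P k"
    and eq: "(\<lambda>q. \<Sum>k<N. psymb k (T k) q) = (\<lambda>q. \<Sum>k<N. psymb k (D k) q)" and k: "k < N"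
  shows "psymb k (T k) = psymb k (D k)"
proof (rule psymb_eqI[OF T])
  show "psymb k (D k) q = 0" if "q \<notin> cotangent_bundle A" for q using that by (simp add: psymb_def)
  fix x u assume u: "u \<in> Cinf"
  have "(\<Sum>i\<le>N - 1. symb i (T i) u x * r ^ i) = (\<Sum>i\<le>N - 1. symb i (D i) u x * r ^ i)" for r
  proof -
    have N: "{..<N} = {..N - 1}" using k by auto
    have "(\<Sum>k<N. psymb k (T k) (x, differential_at A x (\<lambda>x. r * u x))) = (\<Sum>k<N. psymb k (D k) (x, differential_at A x (\<lambda>x. r * u x)))"
      by (rule fun_cong[OF eq])
    then show ?thesis unfolding N
      by (simp add: psymb_differential[OF T smooth_functions_scale[OF u]] psymb_differential[OF D smooth_functions_scale[OF u]]
          symb_scale_fun[OF T u] symb_scale_fun[OF D u] mult.commute del: symb.simps)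
  qed
  then have "\<forall>i\<le>N - 1. symb i (T i) u x = symb i (D i) u x"
    by (subst polyfun_eq_coeffs[symmetric]) blast
  then have "symb k (T k) u x = symb k (D k) u x" using k by simp
  then show "psymb k (D k) (x, differential_at A x u) = symb k (T k) u x"
    using psymb_differential[OF D u] by simp
qed

text \<open>The complement consists of the classes of degreewise quantized polynomials, and a
  representative splits into the quantization of its symbol plus a remainder without symbol.\<close>

lemma complement_exists:
  "\<exists>W. submodule W real_ring S \<and>
       square_zero_symbols A E L \<inter> W = {\<zero>\<^bsub>S\<^esub>} \<and>
       square_zero_symbols A E L <+>\<^bsub>S\<^esub> W = carrier S \<and>
       (\<forall>P\<in>W. \<forall>Q\<in>W. delta A E L (P \<oplus>\<^bsub>S\<^esub> Q) = (\<lambda>q. delta A E L P q + delta A E L Q q)) \<and>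
       (\<forall>r. \<forall>P\<in>W. delta A E L (r \<odot>\<^bsub>S\<^esub> P) = (\<lambda>q. r * delta A E L P q)) \<and>
       bij_betw (delta A E L) W (Pol A)"
proof -
  define quant where "quant k Q \<longleftrightarrow> (\<forall>F\<in>Pol_degree A k. Q F \<in> P k \<and> psymb k (Q F) = F) \<and>
    (\<forall>F F'. Q (\<lambda>q. F q + F' q) = op_add (Q F) (Q F')) \<and> (\<forall>r F. Q (\<lambda>q. r * F q) = op_scale r (Q F))" for k Q
  have "\<exists>Q. quant k Q" for k
  proof -
    obtain Q :: "'m cofunction \<Rightarrow> ('m, 'v) operator" where "\<And>F. F \<in> Pol_degree A k \<Longrightarrow> Q F \<in> P k \<and> psymb k (Q F) = F"
      "\<And>F F'. Q (\<lambda>q. F q + F' q) = op_add (Q F) (Q F')" "\<And>r F. Q (\<lambda>q. r * F q) = op_scale r (Q F)"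
      by (rule quantization[of k]) blast
    then have "quant k Q" by (simp add: quant_def)
    then show ?thesis by (rule exI[of _ Q])
  qed
  then have "\<forall>k. \<exists>Q. quant k Q" by (rule allI)
  from choice[OF this] obtain Q where quant: "\<forall>k. quant k (Q k)" by (rule exE)
  have QP: "F \<in> Pol_degree A k \<Longrightarrow> Q k F \<in> P k" and Qsym: "F \<in> Pol_degree A k \<Longrightarrow> psymb k (Q k F) = F"
    and Qadd: "Q k (\<lambda>q. F q + F' q) = op_add (Q k F) (Q k F')" and Qscale: "Q k (\<lambda>q. r * F q) = op_scale r (Q k F)"
    for k F F' r
    using spec[OF quant, of k] unfolding quant_def by blast+
  \<comment> \<open>Homogeneity with factor 0. Zero components are thus quantized to the zero
    operator itself, which gives \<open>qf F\<close> finite support.\<close>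
  have Q0: "Q k (\<lambda>q. 0) = op_zero" for k
    using Qscale[of k 0 "\<lambda>q. 0"] by (simp add: op_scale_def op_zero_def)
  define PF where "PF = {F. (\<forall>k. F k \<in> Pol_degree A k) \<and> (\<exists>N. \<forall>k\<ge>N. F k = (\<lambda>q. 0))}"
  define qf where "qf F i = (if i < 0 then op_zero else Q (nat i) (F (nat i)))" for F and i :: int
  have qf_int: "qf F (int k) = Q k (F k)" for F k by (simp add: qf_def)
  have qf_fam: "qf F \<in> fam" if F: "F \<in> PF" for F
  proof -
    obtain N where N: "\<And>k. k \<ge> N \<Longrightarrow> F k = (\<lambda>q. 0)" and d: "\<And>k. F k \<in> Pol_degree A k"
      using F by (auto simp: PF_def)
    have "qf F i \<in> PZ i" for i
      by (rule PZ_cases[of i]) (auto simp: qf_def QP d)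
    moreover have "{i. qf F i \<noteq> op_zero} \<subseteq> {0..<int N}"
    proof
      fix i assume "i \<in> {i. qf F i \<noteq> op_zero}"
      then have i: "qf F i \<noteq> op_zero" by simp
      then have "i \<ge> 0" by (auto simp: qf_def split: if_splits)
      moreover have "nat i < N" using i N[of "nat i"] Q0 \<open>i \<ge> 0\<close> by (auto simp: qf_def not_le[symmetric])
      ultimately show "i \<in> {0..<int N}" by auto
    qed
    then have "finite {i. qf F i \<noteq> op_zero}" by (rule finite_subset) simp
    ultimately show ?thesis by (simp add: fam_def)
  qed
  have qf_delta: "delta A E L (cls (qf F)) = (\<lambda>q. \<Sum>k<N. F k q)" if F: "F \<in> PF" and N: "\<And>k. k \<ge> N \<Longrightarrow> F k = (\<lambda>q. 0)" for F N
  proof -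
    have "delta A E L (cls (qf F)) = (\<lambda>q. \<Sum>k<N. psymb k (qf F (int k)) q)"
      by (rule delta_cls[OF qf_fam[OF F]]) (simp add: qf_int N Q0)
    moreover have "psymb k (qf F (int k)) = F k" for k
      using F Qsym by (simp add: qf_int PF_def)
    ultimately show ?thesis by simp
  qed
  have PF_deg: "F k \<in> Pol_degree A k" if "F \<in> PF" for F k using that by (simp add: PF_def)
  have PF_bound: "\<exists>N. \<forall>k\<ge>N. F k = (\<lambda>q. 0)" if "F \<in> PF" for F using that by (simp add: PF_def)
  have PF_bound2: "\<exists>N. \<forall>k\<ge>N. F k = (\<lambda>q. 0) \<and> F' k = (\<lambda>q. 0)" if FF: "F \<in> PF" "F' \<in> PF" for F F'
  proof -
    obtain N N' where "\<forall>k\<ge>N. F k = (\<lambda>q. 0)" "\<forall>k\<ge>N'. F' k = (\<lambda>q. 0)"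
      using PF_bound[OF FF(1)] PF_bound[OF FF(2)] by blast
    then show ?thesis by (intro exI[of _ "max N N'"]) simp
  qed
  have PF_add: "(\<lambda>k q. F k q + F' k q) \<in> PF" if FF: "F \<in> PF" "F' \<in> PF" for F F'
  proof -
    obtain N where "\<forall>k\<ge>N. F k = (\<lambda>q. 0) \<and> F' k = (\<lambda>q. 0)" using PF_bound2[OF FF] by blast
    then have "\<forall>k\<ge>N. (\<lambda>q. F k q + F' k q) = (\<lambda>q. 0)" by simp
    then show ?thesis using Pol_degree_add[OF PF_deg[OF FF(1)] PF_deg[OF FF(2)]] by (auto simp: PF_def)
  qed
  have PF_scale: "(\<lambda>k q. r * F k q) \<in> PF" if F: "F \<in> PF" for F r
  proof -
    obtain N where "\<forall>k\<ge>N. F k = (\<lambda>q. 0)" using PF_bound[OF F] by blast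
    then have "\<forall>k\<ge>N. (\<lambda>q. r * F k q) = (\<lambda>q. 0)" by simp
    then show ?thesis using Pol_degree_scale[OF PF_deg[OF F]] by (auto simp: PF_def)
  qed
  have PF_zero: "(\<lambda>k q. 0) \<in> PF" by (simp add: PF_def Pol_degree_zero)
  have qf_add: "qf (\<lambda>k q. F k q + F' k q) = (\<lambda>i. op_add (qf F i) (qf F' i))" for F F'
    by (simp add: qf_def fun_eq_iff[where f = "qf _"] Qadd op_add_zero)
  have qf_scale: "qf (\<lambda>k q. r * F k q) = (\<lambda>i. op_scale r (qf F i))" for F r
    by (simp add: qf_def fun_eq_iff[where f = "qf _"] Qscale op_scale_zero)
  have qf_zero: "qf (\<lambda>k q. 0) = (\<lambda>i. op_zero)"
    by (simp add: qf_def fun_eq_iff[where f = "qf _"] Q0)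
  define W where "W = cls ` qf ` PF"
  have sub: "submodule W real_ring S"
    unfolding W_def
  proof (rule submodule_cls)
    show "qf ` PF \<subseteq> fam" using qf_fam by blast
    show "(\<lambda>i. op_zero) \<in> qf ` PF" unfolding qf_zero[symmetric] by (intro imageI PF_zero)
    show "(\<lambda>i. op_add (T i) (D i)) \<in> qf ` PF" if "T \<in> qf ` PF" "D \<in> qf ` PF" for T D
    proof -
      from that obtain F F' where F: "F \<in> PF" "F' \<in> PF" "T = qf F" "D = qf F'" by blast
      show ?thesis unfolding F(3,4) qf_add[symmetric] by (intro imageI PF_add F)
    qed
    show "(\<lambda>i. op_scale r (T i)) \<in> qf ` PF" if "T \<in> qf ` PF" for r T
    proof -
      from that obtain F where F: "F \<in> PF" "T = qf F" by blast
      show ?thesis unfolding F(2) qf_scale[symmetric] by (intro imageI PF_scale F)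
    qed
  qed
  have W_E: "\<exists>F\<in>PF. c = cls (qf F)" if "c \<in> W" for c using that by (auto simp: W_def)
  have inter: "square_zero_symbols A E L \<inter> W = {\<zero>\<^bsub>S\<^esub>}"
  proof
    show "{\<zero>\<^bsub>S\<^esub>} \<subseteq> square_zero_symbols A E L \<inter> W"
    proof -
      have "\<zero>\<^bsub>S\<^esub> \<in> W" unfolding W_def zero_cls qf_zero[symmetric] by (intro imageI PF_zero)
      moreover have "\<zero>\<^bsub>S\<^esub> \<in> square_zero_symbols A E L"
        unfolding square_zero_symbols_eq zero_cls by (intro imageI low_zero)
      ultimately show ?thesis by blast
    qed
    show "square_zero_symbols A E L \<inter> W \<subseteq> {\<zero>\<^bsub>S\<^esub>}"
    proof
      fix c assume c: "c \<in> square_zero_symbols A E L \<inter> W"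
      then obtain F where F: "F \<in> PF" "c = cls (qf F)" using W_E by blast
      obtain D where D: "D \<in> low" "c = cls D" using c unfolding square_zero_symbols_eq by blast
      have "qf F \<in> low" by (rule low_cls[OF qf_fam[OF F(1)] D(1)]) (use F D in simp)
      then have "F k = (\<lambda>q. 0)" for k
        using psymb_eq_0_iff[OF QP[OF PF_deg[OF F(1)]], of k] Qsym[OF PF_deg[OF F(1)], of k] low_G[of "qf F" k]
        by (simp add: qf_int)
      then have "F = (\<lambda>k q. 0)" by (rule ext)
      then show "c \<in> {\<zero>\<^bsub>S\<^esub>}" using F(2) qf_zero by (simp add: zero_cls)
    qed
  qed
  have sum: "square_zero_symbols A E L <+>\<^bsub>S\<^esub> W = carrier S"
  proof
    have "square_zero_symbols A E L \<subseteq> carrier S" by (auto simp: square_zero_symbols_def)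
    moreover have "W \<subseteq> carrier S" using qf_fam cls_in by (auto simp: W_def)
    ultimately show "square_zero_symbols A E L <+>\<^bsub>S\<^esub> W \<subseteq> carrier S"
      using abelian_monoid.a_closed[OF abelian_group.axioms(1)[OF symbol_abelian_group]]
      by (auto simp: set_add_def')
    show "carrier S \<subseteq> square_zero_symbols A E L <+>\<^bsub>S\<^esub> W"
    proof
      fix c assume "c \<in> carrier S"
      then obtain T where T: "T \<in> fam" "c = cls T" by (rule carrierE)
      have P: "T (int i) \<in> P i" for i using fam_PZ[OF T(1), of "int i"] by simp
      define F where "F k = psymb k (T (int k))" for k
      obtain N where N: "\<And>k. k \<ge> N \<Longrightarrow> T (int k) = op_zero" by (rule fam_bound[OF T(1)]) blast
      have z: "psymb k op_zero = (\<lambda>q. 0)" for k using psymb_eq_0_iff[OF P_zero] G_zero by blast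
      have F: "F \<in> PF" unfolding PF_def F_def mem_Collect_eq
        by (intro conjI allI psymb_Pol_degree[OF P] exI[of _ N]) (use N z in simp)
      \<comment> \<open>Removing the quantization of the symbol leaves a family in
        \<open>low\<close>, the square-zero part.\<close>
      define D where "D i = op_add (T i) (op_scale (-1) (qf F i))" for i
      have Df: "D \<in> fam" unfolding D_def by (intro fam_add fam_scale T qf_fam F)
      have "D (int k) \<in> G k" for k
      proof -
        have Q: "Q k (F k) \<in> P k" by (rule QP[OF PF_deg[OF F]])
        have "psymb k (D (int k)) = (\<lambda>q. psymb k (T (int k)) q + - 1 * psymb k (Q k (F k)) q)"
          unfolding D_def qf_int psymb_add[OF P P_scale[OF Q]] psymb_scale[OF Q] ..
        also have "\<dots> = (\<lambda>q. 0)" using Qsym[OF PF_deg[OF F]] by (simp add: F_def)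
        finally show ?thesis using psymb_eq_0_iff[of "D (int k)" k] fam_PZ[OF Df, of "int k"] by simp
      qed
      then have "D \<in> low" using Df by (simp add: low_def)
      then have "cls D \<in> square_zero_symbols A E L" unfolding square_zero_symbols_eq by (rule imageI)
      moreover have "cls (qf F) \<in> W" unfolding W_def by (intro imageI F)
      moreover have "c = cls D \<oplus>\<^bsub>S\<^esub> cls (qf F)"
        unfolding add_cls[OF Df qf_fam[OF F]] T(2)
        by (rule arg_cong[where f = cls]) (simp add: D_def op_add_def op_scale_def)
      ultimately show "c \<in> square_zero_symbols A E L <+>\<^bsub>S\<^esub> W" unfolding set_add_def' by blast
    qed
  qed
  have dadd: "\<forall>P\<in>W. \<forall>Q\<in>W. delta A E L (P \<oplus>\<^bsub>S\<^esub> Q) = (\<lambda>q. delta A E L P q + delta A E L Q q)"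
  proof (intro ballI)
    fix c c' assume "c \<in> W" "c' \<in> W"
    then obtain F F' where F: "F \<in> PF" "c = cls (qf F)" and F': "F' \<in> PF" "c' = cls (qf F')" using W_E by meson
    obtain N where N: "\<forall>k\<ge>N. F k = (\<lambda>q. 0) \<and> F' k = (\<lambda>q. 0)" using PF_bound2[OF F(1) F'(1)] by blast
    have "c \<oplus>\<^bsub>S\<^esub> c' = cls (qf (\<lambda>k q. F k q + F' k q))"
      unfolding F F' add_cls[OF qf_fam[OF F(1)] qf_fam[OF F'(1)]] qf_add ..
    moreover have "delta A E L (cls (qf (\<lambda>k q. F k q + F' k q))) = (\<lambda>q. \<Sum>k<N. F k q + F' k q)"
      by (rule qf_delta[OF PF_add[OF F(1) F'(1)]]) (use N in simp)
    moreover have "delta A E L c = (\<lambda>q. \<Sum>k<N. F k q)" unfolding F(2) by (rule qf_delta[OF F(1)]) (use N in simp)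
    moreover have "delta A E L c' = (\<lambda>q. \<Sum>k<N. F' k q)" unfolding F'(2) by (rule qf_delta[OF F'(1)]) (use N in simp)
    ultimately show "delta A E L (c \<oplus>\<^bsub>S\<^esub> c') = (\<lambda>q. delta A E L c q + delta A E L c' q)"
      by (simp add: sum.distrib)
  qed
  have dscale: "\<forall>r. \<forall>P\<in>W. delta A E L (r \<odot>\<^bsub>S\<^esub> P) = (\<lambda>q. r * delta A E L P q)"
  proof (intro allI ballI)
    fix r c assume "c \<in> W"
    then obtain F where F: "F \<in> PF" "c = cls (qf F)" using W_E by meson
    obtain N where N: "\<forall>k\<ge>N. F k = (\<lambda>q. 0)" using PF_bound[OF F(1)] by blast
    have "r \<odot>\<^bsub>S\<^esub> c = cls (qf (\<lambda>k q. r * F k q))"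
      unfolding F smult_cls[OF qf_fam[OF F(1)]] qf_scale ..
    moreover have "delta A E L (cls (qf (\<lambda>k q. r * F k q))) = (\<lambda>q. \<Sum>k<N. r * F k q)"
      by (rule qf_delta[OF PF_scale[OF F(1)]]) (use N in simp)
    moreover have "delta A E L c = (\<lambda>q. \<Sum>k<N. F k q)" unfolding F(2) by (rule qf_delta[OF F(1)]) (use N in simp)
    ultimately show "delta A E L (r \<odot>\<^bsub>S\<^esub> c) = (\<lambda>q. r * delta A E L c q)"
      by (simp add: sum_distrib_left)
  qed
  have inj: "inj_on (delta A E L) W"
  proof (rule inj_onI)
    fix c c' assume "c \<in> W" "c' \<in> W" and eq: "delta A E L c = delta A E L c'"
    then obtain F F' where F: "F \<in> PF" "c = cls (qf F)" and F': "F' \<in> PF" "c' = cls (qf F')" using W_E by meson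
    obtain N where N: "\<forall>k\<ge>N. F k = (\<lambda>q. 0) \<and> F' k = (\<lambda>q. 0)" using PF_bound2[OF F(1) F'(1)] by blast
    have "delta A E L c = (\<lambda>q. \<Sum>k<N. F k q)" unfolding F(2) by (rule qf_delta[OF F(1)]) (use N in simp)
    moreover have "delta A E L c' = (\<lambda>q. \<Sum>k<N. F' k q)" unfolding F'(2) by (rule qf_delta[OF F'(1)]) (use N in simp)
    ultimately have s: "(\<lambda>q. \<Sum>k<N. psymb k (Q k (F k)) q) = (\<lambda>q. \<Sum>k<N. psymb k (Q k (F' k)) q)"
      using eq by (simp add: Qsym[OF PF_deg[OF F(1)]] Qsym[OF PF_deg[OF F'(1)]])
    have "F k = F' k" for k
    proof (cases "k < N")
      case True
      show ?thesis
        using psymb_sum_eq[OF QP[OF PF_deg[OF F(1)]] QP[OF PF_deg[OF F'(1)]] s True]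
        by (simp add: Qsym[OF PF_deg[OF F(1)]] Qsym[OF PF_deg[OF F'(1)]])
    qed (use N in simp)
    then have "F = F'" by (rule ext)
    then show "c = c'" using F F' by simp
  qed
  have img: "delta A E L ` W = Pol A"
  proof
    show "delta A E L ` W \<subseteq> Pol A"
    proof
      fix p assume "p \<in> delta A E L ` W"
      then obtain F where F: "F \<in> PF" "p = delta A E L (cls (qf F))" using W_E by blast
      obtain N where N: "\<forall>k\<ge>N. F k = (\<lambda>q. 0)" using PF_bound[OF F(1)] by blast
      have "p = (\<lambda>q. \<Sum>k<Suc N. F k q)" unfolding F(2) by (rule qf_delta[OF F(1)]) (use N in simp)
      then have "p = (\<lambda>q. \<Sum>k\<le>N. F k q)" by (simp only: lessThan_Suc_atMost)
      then show "p \<in> Pol A" using PF_deg[OF F(1)] unfolding Pol_def by blast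
    qed
    show "Pol A \<subseteq> delta A E L ` W"
    proof
      fix p assume "p \<in> Pol A"
      then obtain N F where F: "\<forall>k. F k \<in> Pol_degree A k" "p = (\<lambda>q. \<Sum>k\<le>N. F k q)" unfolding Pol_def by blast
      \<comment> \<open>\<open>Pol\<close> prescribes components in all degrees but sums only those
        up to N; truncation gives the finite support required in \<open>PF\<close>.\<close>
      define F' where "F' k = (if k \<le> N then F k else (\<lambda>q. 0))" for k
      have F': "F' \<in> PF" unfolding PF_def F'_def using F(1) Pol_degree_zero by (auto intro!: exI[of _ "Suc N"])
      have "delta A E L (cls (qf F')) = (\<lambda>q. \<Sum>k<Suc N. F' k q)"
        by (rule qf_delta[OF F']) (simp add: F'_def)
      also have "\<dots> = p" unfolding F(2) lessThan_Suc_atMost by (intro ext sum.cong) (auto simp: F'_def)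
      finally show "p \<in> delta A E L ` W" unfolding W_def using F' by blast
    qed
  qed
  show ?thesis
    using sub inter sum dadd dscale bij_betw_imageI[OF inj img] by blast
qed

end

theorem mainTheorem1:
  fixes A :: "('m::{t2_space, second_countable_topology}, 'b::real_inner) chart set"
    and E :: "'m \<Rightarrow> 'v::real_vector set"
    and L :: "('m, 'n::finite, 'v) triv set"
  assumes "smooth_manifold A"
    and "smooth_vector_bundle A E L"
    and "CARD('n) > 1"
  shows "Module.algebra real_ring (symbol_algebra A E L) \<and>
    ideal (square_zero_symbols A E L) (symbol_algebra A E L) \<and>
    submodule (square_zero_symbols A E L) real_ring (symbol_algebra A E L) \<and>
    (\<forall>P\<in>square_zero_symbols A E L. \<forall>Q\<in>square_zero_symbols A E L.
       P \<otimes>\<^bsub>symbol_algebra A E L\<^esub> Q = \<zero>\<^bsub>symbol_algebra A E L\<^esub>) \<and>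
    (\<exists>W. submodule W real_ring (symbol_algebra A E L) \<and>
       square_zero_symbols A E L \<inter> W = {\<zero>\<^bsub>symbol_algebra A E L\<^esub>} \<and>
       square_zero_symbols A E L <+>\<^bsub>symbol_algebra A E L\<^esub> W = carrier (symbol_algebra A E L) \<and>
       (\<forall>P\<in>W. \<forall>Q\<in>W. delta A E L (P \<oplus>\<^bsub>symbol_algebra A E L\<^esub> Q) =
          (\<lambda>q. delta A E L P q + delta A E L Q q)) \<and>
       (\<forall>r. \<forall>P\<in>W. delta A E L (r \<odot>\<^bsub>symbol_algebra A E L\<^esub> P) = (\<lambda>q. r * delta A E L P q)) \<and>
       bij_betw (delta A E L) W (Pol A))"
proof -
  interpret vector_bundle A E L
    by (intro vector_bundle.intro manifold.intro vector_bundle_axioms.intro assms)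
  show ?thesis
    using symbol_algebra square_zero_ideal square_zero_submodule square_zero_mult complement_exists by blast
qed

end
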